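(* For a triple $(\mathfrak g,\lambda,J')$ with $\lambda\in\mathfrak h^*$ and $J'\subset J_\lambda$, and for a highest weight $\mathfrak g$-module $\mathbb V^\lambda$ with highest weight $\lambda$, consider the implication $$(\ast)\qquad J(\mathbb V^\lambda)=J'\ \Longrightarrow\ \operatorname{wt}\mathbb V^\lambda=(\lambda-\mathbb Z\Delta)\cap\operatorname{conv}_{\mathbb R}\operatorname{wt}\mathbb V^\lambda.$$ (i) If $|J_\lambda\setminus J'|\le1$, then $(\ast)$ holds for every $\mathbb V^\lambda$. (ii) If $|J_\lambda\setminus J'|=2$, then $(\ast)$ need not always hold: there exist $\mathfrak g$, $\lambda$, $J'$ with $|J_\lambda\setminus J'|=2$ and a module $\mathbb V^\lambda$ for which $(\ast)$ fails. (iii) If $|J_\lambda\setminus J'|\ge3$, then $(\ast)$ always fails for some $\mathbb V^\lambda$, i.e. there exists a highest weight module $\mathbb V^\lambda$ with $J(\mathbb V^\lambda)=J'$ and $\operatorname{wt}\mathbb V^\lambda\neq(\lambda-\mathbb Z\Delta)\cap\operatorname{conv}_{\mathbb R}\operatorname{wt}\mathbb V^\lambda$.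
   Context: $\mathfrak g$ is a complex finite-dimensional semisimple Lie algebra with fixed triangular decomposition $\mathfrak g=\mathfrak n^+\oplus\mathfrak h\oplus\mathfrak n^-$, simple roots $\Delta=\{\alpha_i:i\in I\}$, and Chevalley generators $x^\pm_{\alpha_i}\in\mathfrak n^\pm$ with $[x^+_{\alpha_i},x^-_{\alpha_j}]=\delta_{ij}h_i$ ($h_i$ the simple coroots). $\mathbb Z\Delta$ is the root lattice and $\operatorname{conv}_{\mathbb R}$ is the usual convex hull. A highest weight module $\mathbb V^\lambda$ is a nonzero quotient of the Verma module $M(\lambda)$; $v_\lambda$ is a highest weight vector; $\operatorname{wt}M$ is the set of weights of $M$. $J_\lambda:=\{i\in I:\lambda(h_i)\in\mathbb Z_+\}$ and $J(\mathbb V^\lambda):=\{i\in J_\lambda:(x^-_{\alpha_i})^{\lambda(h_i)+1}v_\lambda=0\}$. *)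

theory Defs
  imports
    "HOL-Analysis.Analysis"
    "HOL-Library.Function_Algebras"
    "HOL-Library.Poly_Mapping"
begin

(* Elements of h* are complex-valued functions; the pointwise real vector space structure below
   makes the library constant "convex hull" the usual real convex hull in h*. *)

instantiation "fun" :: (type, real_vector) real_vector
begin

definition scaleR_fun :: "real \<Rightarrow> ('a \<Rightarrow> 'b) \<Rightarrow> 'a \<Rightarrow> 'b"
  where "scaleR_fun r f = (\<lambda>x. r *\<^sub>R f x)"

instance
  by standard (auto simp: scaleR_fun_def fun_eq_iff scaleR_add_right scaleR_add_left)

end

definition fun_scale :: "complex \<Rightarrow> ('a \<Rightarrow> complex) \<Rightarrow> 'a \<Rightarrow> complex"
  where "fun_scale c f = (\<lambda>x. c * f x)"

lemma vector_space_fun_scale: "vector_space fun_scale"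
  by standard (auto simp: fun_scale_def fun_eq_iff algebra_simps)

subsection \<open>Complex Lie algebras\<close>

(* The underlying space of the Lie algebra is the whole type 'g; 'i is the type of the indices of
   the simple roots.  The fields "scaling" and "bracket" give the complex Lie algebra, the
   remaining ones the triangular decomposition and the Chevalley generators. *)

record ('g, 'i) lie_data =
  scaling :: "complex \<Rightarrow> 'g \<Rightarrow> 'g"
  bracket :: "'g \<Rightarrow> 'g \<Rightarrow> 'g"
  cartan :: "'g set"
  nodes :: "'i set"
  simple_root :: "'i \<Rightarrow> 'g \<Rightarrow> complex"
  x_plus :: "'i \<Rightarrow> 'g"
  x_minus :: "'i \<Rightarrow> 'g"
  coroot :: "'i \<Rightarrow> 'g"

abbreviation lsubspace :: "('g::ab_group_add, 'i) lie_data \<Rightarrow> 'g set \<Rightarrow> bool"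
  where "lsubspace L \<equiv> module.subspace (scaling L)"

abbreviation lspan :: "('g::ab_group_add, 'i) lie_data \<Rightarrow> 'g set \<Rightarrow> 'g set"
  where "lspan L \<equiv> module.span (scaling L)"

definition lie_algebra :: "('g::ab_group_add, 'i) lie_data \<Rightarrow> bool" where
  "lie_algebra L \<longleftrightarrow>
     vector_space (scaling L) \<and>
     (\<forall>x. Vector_Spaces.linear (scaling L) (scaling L) (\<lambda>y. bracket L x y)) \<and>
     (\<forall>y. Vector_Spaces.linear (scaling L) (scaling L) (\<lambda>x. bracket L x y)) \<and>
     (\<forall>x. bracket L x x = 0) \<and>
     (\<forall>x y z. bracket L x (bracket L y z) + bracket L y (bracket L z x)
                + bracket L z (bracket L x y) = 0)"

definition finite_dimensional :: "('g::ab_group_add, 'i) lie_data \<Rightarrow> bool"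
  where "finite_dimensional L \<longleftrightarrow> (\<exists>B. finite B \<and> lspan L B = UNIV)"

definition bracket_set :: "('g::ab_group_add, 'i) lie_data \<Rightarrow> 'g set \<Rightarrow> 'g set \<Rightarrow> 'g set"
  where "bracket_set L A B = lspan L {bracket L a b | a b. a \<in> A \<and> b \<in> B}"

definition lie_subalgebra :: "('g::ab_group_add, 'i) lie_data \<Rightarrow> 'g set \<Rightarrow> bool"
  where "lie_subalgebra L A \<longleftrightarrow> lsubspace L A \<and> (\<forall>a\<in>A. \<forall>b\<in>A. bracket L a b \<in> A)"

definition lie_ideal :: "('g::ab_group_add, 'i) lie_data \<Rightarrow> 'g set \<Rightarrow> bool"
  where "lie_ideal L A \<longleftrightarrow> lsubspace L A \<and> (\<forall>x. \<forall>a\<in>A. bracket L x a \<in> A)"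

definition solvable :: "('g::ab_group_add, 'i) lie_data \<Rightarrow> 'g set \<Rightarrow> bool"
  where "solvable L A \<longleftrightarrow> (\<exists>n. ((\<lambda>B. bracket_set L B B) ^^ n) A = {0})"

definition semisimple :: "('g::ab_group_add, 'i) lie_data \<Rightarrow> bool"
  where "semisimple L \<longleftrightarrow> (\<forall>A. lie_ideal L A \<and> solvable L A \<longrightarrow> A = {0})"

definition ad_diagonalizable :: "('g::ab_group_add, 'i) lie_data \<Rightarrow> 'g \<Rightarrow> bool"
  where "ad_diagonalizable L x \<longleftrightarrow> lspan L {y. \<exists>c. bracket L x y = scaling L c y} = UNIV"

definition toral :: "('g::ab_group_add, 'i) lie_data \<Rightarrow> 'g set \<Rightarrow> bool" where
  "toral L K \<longleftrightarrow> lsubspace L K \<and> (\<forall>x\<in>K. \<forall>y\<in>K. bracket L x y = 0) \<and>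
     (\<forall>x\<in>K. ad_diagonalizable L x)"

definition cartan_subalgebra :: "('g::ab_group_add, 'i) lie_data \<Rightarrow> 'g set \<Rightarrow> bool"
  where "cartan_subalgebra L K \<longleftrightarrow> toral L K \<and> (\<forall>K'. toral L K' \<and> K \<subseteq> K' \<longrightarrow> K' = K)"

subsection \<open>Roots, triangular decomposition, Chevalley generators\<close>

(* A linear functional on h is represented by the function on the whole Lie algebra that extends it
   by 0 outside h; equality of functionals is then equality of functions. *)

definition dual_cartan :: "('g::ab_group_add, 'i) lie_data \<Rightarrow> ('g \<Rightarrow> complex) set" where
  "dual_cartan L =
     {f. (\<forall>x\<in>cartan L. \<forall>y\<in>cartan L. f (x + y) = f x + f y) \<and>
         (\<forall>c. \<forall>x\<in>cartan L. f (scaling L c x) = c * f x) \<and>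
         (\<forall>x. x \<notin> cartan L \<longrightarrow> f x = 0)}"

definition root_space :: "('g::ab_group_add, 'i) lie_data \<Rightarrow> ('g \<Rightarrow> complex) \<Rightarrow> 'g set"
  where "root_space L \<beta> = {x. \<forall>h\<in>cartan L. bracket L h x = scaling L (\<beta> h) x}"

definition roots :: "('g::ab_group_add, 'i) lie_data \<Rightarrow> ('g \<Rightarrow> complex) set"
  where "roots L = {\<beta> \<in> dual_cartan L. \<beta> \<noteq> 0 \<and> root_space L \<beta> \<noteq> {0}}"

definition root_lattice :: "('g::ab_group_add, 'i) lie_data \<Rightarrow> ('g \<Rightarrow> complex) set" where
  "root_lattice L = {\<Sum>i\<in>nodes L. fun_scale (of_int (k i)) (simple_root L i) | k :: 'i \<Rightarrow> int. True}"

definition root_cone :: "('g::ab_group_add, 'i) lie_data \<Rightarrow> ('g \<Rightarrow> complex) set" where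
  "root_cone L = {\<Sum>i\<in>nodes L. fun_scale (of_nat (k i)) (simple_root L i) | k :: 'i \<Rightarrow> nat. True}"

definition simple_system :: "('g::ab_group_add, 'i) lie_data \<Rightarrow> bool" where
  "simple_system L \<longleftrightarrow>
     finite (nodes L) \<and> inj_on (simple_root L) (nodes L) \<and>
     simple_root L ` nodes L \<subseteq> roots L \<and>
     \<not> module.dependent fun_scale (simple_root L ` nodes L) \<and>
     (\<forall>\<beta>\<in>roots L. \<beta> \<in> root_cone L \<or> - \<beta> \<in> root_cone L)"

definition n_plus :: "('g::ab_group_add, 'i) lie_data \<Rightarrow> 'g set"
  where "n_plus L = lspan L (\<Union>\<beta>\<in>{\<beta> \<in> roots L. \<beta> \<in> root_cone L}. root_space L \<beta>)"

definition n_minus :: "('g::ab_group_add, 'i) lie_data \<Rightarrow> 'g set"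
  where "n_minus L = lspan L (\<Union>\<beta>\<in>{\<beta> \<in> roots L. - \<beta> \<in> root_cone L}. root_space L \<beta>)"

definition triangular_decomposition :: "('g::ab_group_add, 'i) lie_data \<Rightarrow> bool" where
  "triangular_decomposition L \<longleftrightarrow>
     (\<forall>x. \<exists>a\<in>n_plus L. \<exists>h\<in>cartan L. \<exists>b\<in>n_minus L. x = a + h + b) \<and>
     (\<forall>a\<in>n_plus L. \<forall>h\<in>cartan L. \<forall>b\<in>n_minus L. a + h + b = 0 \<longrightarrow> a = 0 \<and> h = 0 \<and> b = 0)"

(* The simple coroot h_i is the unique element of [g_{alpha_i}, g_{-alpha_i}] on which alpha_i takes
   the value 2; membership follows from the other conditions. *)

definition chevalley_generators :: "('g::ab_group_add, 'i) lie_data \<Rightarrow> bool" where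
  "chevalley_generators L \<longleftrightarrow>
     (\<forall>i\<in>nodes L. x_plus L i \<in> root_space L (simple_root L i) \<and>
                  x_minus L i \<in> root_space L (- simple_root L i) \<and>
                  coroot L i \<in> cartan L \<and> simple_root L i (coroot L i) = 2) \<and>
     (\<forall>i\<in>nodes L. \<forall>j\<in>nodes L.
        bracket L (x_plus L i) (x_minus L j) = (if i = j then coroot L i else 0)) \<and>
     lie_subalgebra L hull (x_plus L ` nodes L) = n_plus L \<and>
     lie_subalgebra L hull (x_minus L ` nodes L) = n_minus L"

definition semisimple_lie_data :: "('g::ab_group_add, 'i) lie_data \<Rightarrow> bool" where
  "semisimple_lie_data L \<longleftrightarrow>
     lie_algebra L \<and> finite_dimensional L \<and> semisimple L \<and> cartan_subalgebra L (cartan L) \<and>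
     simple_system L \<and> triangular_decomposition L \<and> chevalley_generators L"

subsection \<open>Modules and weights\<close>

(* The module is the subspace "space V" of the ambient complex vector space 'v. *)

record ('g, 'v) lie_module =
  vscaling :: "complex \<Rightarrow> 'v \<Rightarrow> 'v"
  space :: "'v set"
  act :: "'g \<Rightarrow> 'v \<Rightarrow> 'v"

definition is_lie_module ::
  "('g::ab_group_add, 'i) lie_data \<Rightarrow> ('g, 'v::ab_group_add) lie_module \<Rightarrow> bool" where
  "is_lie_module L V \<longleftrightarrow>
     vector_space (vscaling V) \<and> module.subspace (vscaling V) (space V) \<and>
     (\<forall>x. \<forall>v\<in>space V. act V x v \<in> space V) \<and>
     (\<forall>x. \<forall>u\<in>space V. \<forall>v\<in>space V. act V x (u + v) = act V x u + act V x v) \<and>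
     (\<forall>c x. \<forall>v\<in>space V. act V x (vscaling V c v) = vscaling V c (act V x v)) \<and>
     (\<forall>x y. \<forall>v\<in>space V. act V (x + y) v = act V x v + act V y v) \<and>
     (\<forall>c x. \<forall>v\<in>space V. act V (scaling L c x) v = vscaling V c (act V x v)) \<and>
     (\<forall>x y. \<forall>v\<in>space V. act V (bracket L x y) v = act V x (act V y v) - act V y (act V x v))"

definition weight_space ::
  "('g::ab_group_add, 'i) lie_data \<Rightarrow> ('g, 'v::ab_group_add) lie_module \<Rightarrow> ('g \<Rightarrow> complex) \<Rightarrow> 'v set"
  where "weight_space L V \<mu> = {v \<in> space V. \<forall>h\<in>cartan L. act V h v = vscaling V (\<mu> h) v}"

definition wt ::
  "('g::ab_group_add, 'i) lie_data \<Rightarrow> ('g, 'v::ab_group_add) lie_module \<Rightarrow> ('g \<Rightarrow> complex) set"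
  where "wt L V = {\<mu> \<in> dual_cartan L. weight_space L V \<mu> \<noteq> {0}}"

subsection \<open>Verma modules and highest weight modules\<close>

(* The free associative algebra on the set g consists of the finitely supported functions on words
   in g.  U(g) is its quotient by the two-sided ideal spanned by "env_relations"
   (linearity of the inclusion of g, and xy - yx = [x,y]).  M(lam) is the quotient of U(g) by the
   left ideal generated by n^+ and all h - lam(h), that is, the quotient of the free algebra by
   "verma_kernel". *)

type_synonym 'g words = "'g list \<Rightarrow>\<^sub>0 complex"

definition word :: "'g list \<Rightarrow> 'g words"
  where "word w = Poly_Mapping.single w 1"

definition words_scale :: "complex \<Rightarrow> 'g words \<Rightarrow> 'g words"
  where "words_scale c p = Poly_Mapping.map ((*) c) p"

lemma vector_space_words_scale: "vector_space words_scale"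
proof
  have lk: "Poly_Mapping.lookup (words_scale c p) w = c * Poly_Mapping.lookup p w" for c p and w :: "'a list"
    by (simp add: words_scale_def Poly_Mapping.map.rep_eq when_def)
  show "words_scale a (x + y) = words_scale a x + words_scale a y"
    "words_scale (a + b) x = words_scale a x + words_scale b x"
    "words_scale a (words_scale b x) = words_scale (a * b) x"
    "words_scale 1 x = x" for a b and x y :: "'a words"
    by (auto intro!: Poly_Mapping.poly_mapping_eqI simp: lk Poly_Mapping.lookup_add algebra_simps)
qed

definition left_mult :: "'g \<Rightarrow> 'g words \<Rightarrow> 'g words"
  where "left_mult x p = (\<Sum>w\<in>Poly_Mapping.keys p. Poly_Mapping.single (x # w) (Poly_Mapping.lookup p w))"

definition env_relations :: "('g::ab_group_add, 'i) lie_data \<Rightarrow> 'g words set" where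
  "env_relations L =
     {word (u @ [x + y] @ w) - word (u @ [x] @ w) - word (u @ [y] @ w) | u w x y. True} \<union>
     {word (u @ [scaling L c x] @ w) - words_scale c (word (u @ [x] @ w)) | u w c x. True} \<union>
     {word (u @ [x, y] @ w) - word (u @ [y, x] @ w) - word (u @ [bracket L x y] @ w) | u w x y. True}"

definition verma_kernel :: "('g::ab_group_add, 'i) lie_data \<Rightarrow> ('g \<Rightarrow> complex) \<Rightarrow> 'g words set" where
  "verma_kernel L lam = module.span words_scale
     (env_relations L \<union>
      {word (u @ [x]) | u x. x \<in> n_plus L} \<union>
      {word (u @ [h]) - words_scale (lam h) (word u) | u h. h \<in> cartan L})"

(* Surjective g-module homomorphisms from M(lam) onto V, described on the free algebra. *)

definition verma_surjection ::
  "('g::ab_group_add, 'i) lie_data \<Rightarrow> ('g \<Rightarrow> complex) \<Rightarrow> ('g, 'v::ab_group_add) lie_module \<Rightarrow>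
     ('g words \<Rightarrow> 'v) \<Rightarrow> bool" where
  "verma_surjection L lam V \<phi> \<longleftrightarrow>
     Vector_Spaces.linear words_scale (vscaling V) \<phi> \<and> range \<phi> = space V \<and>
     (\<forall>x p. \<phi> (left_mult x p) = act V x (\<phi> p)) \<and> (\<forall>p\<in>verma_kernel L lam. \<phi> p = 0)"

(* V is a nonzero quotient of M(lam), and v is the image of the canonical generator. *)

definition highest_weight_module ::
  "('g::ab_group_add, 'i) lie_data \<Rightarrow> ('g \<Rightarrow> complex) \<Rightarrow> ('g, 'v::ab_group_add) lie_module \<Rightarrow> 'v \<Rightarrow> bool"
  where
  "highest_weight_module L lam V v \<longleftrightarrow>
     is_lie_module L V \<and> space V \<noteq> {0} \<and>
     (\<exists>\<phi>. verma_surjection L lam V \<phi> \<and> v = \<phi> (word []))"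

(* A 6-dimensional carrier for the existence assertion about the Lie algebra, which cannot quantify
   over types. *)

type_synonym complex6 = "(complex \<times> complex \<times> complex) \<times> (complex \<times> complex \<times> complex)"

definition J_weight :: "('g::ab_group_add, 'i) lie_data \<Rightarrow> ('g \<Rightarrow> complex) \<Rightarrow> 'i set"
  where "J_weight L lam = {i \<in> nodes L. lam (coroot L i) \<in> \<nat>}"

definition J_module ::
  "('g::ab_group_add, 'i) lie_data \<Rightarrow> ('g \<Rightarrow> complex) \<Rightarrow> ('g, 'v::ab_group_add) lie_module \<Rightarrow> 'v \<Rightarrow> 'i set"
  where
  "J_module L lam V v =
     {i \<in> J_weight L lam. \<exists>n::nat. lam (coroot L i) = of_nat n \<and> (act V (x_minus L i) ^^ (n + 1)) v = 0}"

definition wt_convex ::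
  "('g::ab_group_add, 'i) lie_data \<Rightarrow> ('g \<Rightarrow> complex) \<Rightarrow> ('g, 'v::ab_group_add) lie_module \<Rightarrow> bool"
  where
  "wt_convex L lam V \<longleftrightarrow> wt L V = {lam - \<gamma> | \<gamma>. \<gamma> \<in> root_lattice L} \<inter> convex hull (wt L V)"

end

theory Submission
  imports Defs
begin

text \<open>Write \<open>f\<^sub>i\<close> for the simple lowering operators and \<open>J\<close> for the set of integrable nodes of \<open>V\<close>. If at most one
  node \<open>j\<close> of \<open>J\<^sub>\<lambda>\<close> is missing from \<open>J\<close>, then every \<open>\<lambda> - \<Sum> c\<^sub>i \<alpha>\<^sub>i\<close> with \<open>c\<close> supported outside \<open>J\<close> is a weight: the
  operators \<open>f\<^sub>i\<close> with \<open>i \<notin> J\<^sub>\<lambda>\<close> are injective modulo the largest proper submodule, so some raising operator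
  returns from such a vector to \<open>v\<close>, and this raising operator commutes with the powers of \<open>f\<^sub>j\<close>, none of which
  kills \<open>v\<close>. Positivity of the Cartan matrix then yields every \<open>J\<close>-dominant element of \<open>\<lambda> - \<nat>\<Delta>\<close> as a
  weight, and reflections in \<open>J\<close> move every lattice point of the hull to a \<open>J\<close>-dominant one.
  Conversely, if two orthogonal nodes \<open>i\<close>, \<open>k\<close> are missing, divide the Verma module by \<open>f\<^sub>i\<^sup>a f\<^sub>k\<^sup>b v\<close>, with
  \<open>a = \<lambda>(h\<^sub>i) + 1\<close> and \<open>b = \<lambda>(h\<^sub>k) + 1\<close>: the powers of \<open>f\<^sub>i\<close> and of \<open>f\<^sub>k\<close> survive, but the
  midpoint of \<open>\<lambda> - 2 a \<alpha>\<^sub>i\<close> and \<open>\<lambda> - 2 b \<alpha>\<^sub>k\<close> is not a weight any more. Among three nodes of a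
  Dynkin diagram two are orthogonal.\<close>

section \<open>Strings of sl2\<close>

text \<open>Verma modules are given by generators and relations, so the recurring obstacle is to
  show that a vector is nonzero. For (i) this happens inside \<open>V\<close>: a vector from which
  some raising word leads to a nonzero multiple of \<open>v\<close> cannot vanish. For (ii) and
  (iii) a module has to be built in which prescribed powers survive. On the free algebra over the
  nodes, nonvanishing can be read off from coefficients, and the quotient is taken by the largest
  invariant subspace \<open>K\<close> of elements without any word i^m for i in a chosen set
  \<open>X\<close>. This maximal choice settles all nodes at once: powers of letters in
  \<open>X\<close> survive by construction, while a singular word falls into \<open>K\<close> as
  soon as no extension of it to the left is such a power. The exponent \<lambda>(h_i) + 1 is the one
  positive exponent at which \<open>e i\<close> annihilates a power of \<open>f i\<close> on a
  highest weight vector of the free model. Positivity of the Cartan matrix comes from the finiteness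
  of the root system: a root of maximal height on a set of nodes is dominant there, and it serves as
  a test vector.\<close>

locale sl2_action = vector_space s for s :: "complex \<Rightarrow> 'v::ab_group_add \<Rightarrow> 'v" +
  fixes U :: "'v set" and e f h :: "'v \<Rightarrow> 'v"
  assumes U: "subspace U"
    and closed: "u \<in> U \<Longrightarrow> e u \<in> U" "u \<in> U \<Longrightarrow> f u \<in> U" "u \<in> U \<Longrightarrow> h u \<in> U"
    and add: "u \<in> U \<Longrightarrow> w \<in> U \<Longrightarrow> e (u + w) = e u + e w" "u \<in> U \<Longrightarrow> w \<in> U \<Longrightarrow> f (u + w) = f u + f w"
    and scale: "u \<in> U \<Longrightarrow> e (s c u) = s c (e u)" "u \<in> U \<Longrightarrow> f (s c u) = s c (f u)"
    and ef: "u \<in> U \<Longrightarrow> e (f u) = f (e u) + h u"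
    and hf: "u \<in> U \<Longrightarrow> h (f u) = f (h u) - s 2 (f u)"
    and he: "u \<in> U \<Longrightarrow> h (e u) = e (h u) + s 2 (e u)"
begin

lemma zero [simp]: "e 0 = 0" "f 0 = 0"
  using scale[of 0 0] subspace_0[OF U] by auto

lemma pow_closed: "u \<in> U \<Longrightarrow> (e ^^ k) u \<in> U" "u \<in> U \<Longrightarrow> (f ^^ k) u \<in> U"
  by (induction k) (auto simp: closed)

lemma pow_scale: "u \<in> U \<Longrightarrow> (e ^^ k) (s c u) = s c ((e ^^ k) u)"
  by (induction k) (auto simp: scale pow_closed)

lemma h_f_pow:
  assumes "u \<in> U" "h u = s c u"
  shows "h ((f ^^ k) u) = s (c - 2 * of_nat k) ((f ^^ k) u)"
proof (induction k)
  case (Suc k)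
  have "h ((f ^^ Suc k) u) = f (h ((f ^^ k) u)) - s 2 (f ((f ^^ k) u))"
    using hf pow_closed(2)[OF assms(1)] by simp
  also have "\<dots> = s (c - 2 * of_nat k) ((f ^^ Suc k) u) - s 2 ((f ^^ Suc k) u)"
    unfolding Suc.IH by (simp add: scale pow_closed assms)
  also have "\<dots> = s (c - 2 * of_nat (Suc k)) ((f ^^ Suc k) u)"
    by (simp add: algebra_simps)
  finally show ?case .
qed (use assms in simp)

lemma h_e_pow:
  assumes "u \<in> U" "h u = s c u"
  shows "h ((e ^^ k) u) = s (c + 2 * of_nat k) ((e ^^ k) u)"
proof (induction k)
  case (Suc k)
  have "h ((e ^^ Suc k) u) = e (h ((e ^^ k) u)) + s 2 (e ((e ^^ k) u))"
    using he pow_closed(1)[OF assms(1)] by simp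
  also have "\<dots> = s (c + 2 * of_nat k) ((e ^^ Suc k) u) + s 2 ((e ^^ Suc k) u)"
    unfolding Suc.IH by (simp add: scale pow_closed assms)
  also have "\<dots> = s (c + 2 * of_nat (Suc k)) ((e ^^ Suc k) u)"
    by (simp add: algebra_simps)
  finally show ?case .
qed (use assms in simp)

text \<open>Moving \<open>e\<close> to the right past k + 1 copies of \<open>f\<close> collects the
  weights c, c - 2, ..., c - 2k, whose sum is (k + 1)(c - k).\<close>

lemma e_f_pow:
  assumes u: "u \<in> U" "h u = s c u" "e u = 0"
  shows "e ((f ^^ Suc k) u) = s ((of_nat k + 1) * (c - of_nat k)) ((f ^^ k) u)"
proof (induction k)
  case 0
  then show ?case using u by (simp add: ef)
next
  case (Suc k)
  have "e ((f ^^ Suc (Suc k)) u) = f (e ((f ^^ Suc k) u)) + h ((f ^^ Suc k) u)"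
    using ef pow_closed(2)[OF u(1), of "Suc k"] by simp
  also have "\<dots> = s ((of_nat k + 1) * (c - of_nat k)) ((f ^^ Suc k) u)
      + s (c - 2 * of_nat (Suc k)) ((f ^^ Suc k) u)"
    unfolding Suc.IH h_f_pow[OF u(1,2)] by (simp add: scale pow_closed u)
  also have "\<dots> = s ((of_nat (Suc k) + 1) * (c - of_nat (Suc k))) ((f ^^ Suc k) u)"
    unfolding scale_left_distrib[symmetric] by (simp add: algebra_simps)
  finally show ?case .
qed

text \<open>Applying \<open>e\<close> to a vanishing power f^(k+1) u leaves (k + 1)(c - k) f^k u =
  0, so either c = k or an earlier power vanishes; the descent ends at \<open>u\<close>, which is
  nonzero.\<close>

lemma f_pow_zero_imp_nat:
  assumes u: "u \<in> U" "h u = s c u" "e u = 0" "u \<noteq> 0" and "(f ^^ m) u = 0"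
  shows "\<exists>n<m. c = of_nat n"
  using assms(5)
proof (induction m)
  case 0
  then show ?case using u by simp
next
  case (Suc k)
  have "s ((of_nat k + 1) * (c - of_nat k)) ((f ^^ k) u) = 0"
    using e_f_pow[OF u(1-3), of k] Suc.prems by simp
  moreover have "(of_nat k + 1 :: complex) \<noteq> 0"
    by (metis of_nat_Suc of_nat_neq_0 add.commute)
  ultimately have "c = of_nat k \<or> (f ^^ k) u = 0" by auto
  then show ?case using Suc.IH by (auto intro: less_SucI)
qed

text \<open>The vector f^(n+1) u is singular of weight - n - 2. This is not a natural number, so by
  \<open>f_pow_zero_imp_nat\<close> no power of \<open>f\<close> kills it.\<close>

lemma f_pow_nonzero:
  assumes u: "u \<in> U" "h u = s (of_nat n) u" "e u = 0" and "(f ^^ Suc n) u \<noteq> 0"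
  shows "(f ^^ m) u \<noteq> 0"
proof
  assume z: "(f ^^ m) u = 0"
  define w where "w = (f ^^ Suc n) u"
  have w: "w \<in> U" "h w = s (- of_nat n - 2) w" "e w = 0" "w \<noteq> 0"
    using h_f_pow[OF u(1,2), of "Suc n"] e_f_pow[OF u, of n] assms pow_closed(2)[OF u(1), of "Suc n"]
    by (auto simp: w_def algebra_simps)
  have "(f ^^ m) w = (f ^^ Suc n) ((f ^^ m) u)"
    unfolding w_def by (metis funpow_add add.commute comp_apply)
  also have "\<dots> = 0"
    unfolding z by (induction n) auto
  finally obtain k where "(- of_nat n - 2 :: complex) = of_nat k"
    using f_pow_zero_imp_nat[OF w] by blast
  then have "(of_nat (n + k + 2) :: complex) = 0"
    by (metis (no_types, lifting) add.assoc add.commute add_diff_cancel_left' diff_add_cancel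
        diff_minus_eq_add of_nat_add of_nat_numeral minus_add_cancel right_minus_eq uminus_add_conv_diff)
  then show False
    by (metis of_nat_eq_0_iff add_is_0 zero_neq_numeral)
qed

text \<open>Each application of \<open>e\<close> contributes a factor (k + 1)(c - k) from
  \<open>e_f_pow\<close>, nonzero because \<open>c\<close> is not natural.\<close>

lemma e_pow_f_pow:
  assumes u: "u \<in> U" "h u = s c u" "e u = 0" and "c \<notin> \<nat>"
  shows "\<exists>z. z \<noteq> 0 \<and> (e ^^ m) ((f ^^ m) u) = s z u"
proof (induction m)
  case 0
  show ?case by (rule exI[of _ 1]) simp
next
  case (Suc k)
  then obtain z where z: "z \<noteq> 0" "(e ^^ k) ((f ^^ k) u) = s z u" by blast
  let ?a = "(of_nat k + 1) * (c - of_nat k)"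
  have "(e ^^ Suc k) ((f ^^ Suc k) u) = (e ^^ k) (e ((f ^^ Suc k) u))"
    by (simp add: funpow_swap1)
  also have "\<dots> = s (?a * z) u"
    unfolding e_f_pow[OF u] by (simp add: pow_scale pow_closed u z)
  finally have "(e ^^ Suc k) ((f ^^ Suc k) u) = s (?a * z) u" .
  moreover have "?a * z \<noteq> 0"
  proof -
    have "(of_nat k + 1 :: complex) \<noteq> 0"
      by (metis of_nat_Suc of_nat_neq_0 add.commute)
    moreover have "c - of_nat k \<noteq> 0" using \<open>c \<notin> \<nat>\<close> by auto
    ultimately show ?thesis using z by simp
  qed
  ultimately show ?case by blast
qed

lemma string_top:
  assumes "u \<noteq> 0" "(e ^^ m) u = 0"
  obtains p where "(e ^^ p) u \<noteq> 0" "e ((e ^^ p) u) = 0"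
proof -
  define q where "q = (LEAST q. (e ^^ q) u = 0)"
  have q: "(e ^^ q) u = 0" unfolding q_def using assms(2) by (rule LeastI)
  then have "q \<noteq> 0" using assms by (auto intro: gr0I)
  then obtain p where p: "q = Suc p" using not0_implies_Suc by blast
  have "(e ^^ p) u \<noteq> 0" using not_less_Least[of p "\<lambda>q. (e ^^ q) u = 0"] p by (auto simp: q_def)
  then show ?thesis using that q p by simp
qed

text \<open>A substitute for the Weyl reflection. At the top e^p u of the string the weight is n +
  2p, so \<open>f\<close> can be applied n + 2p times without reaching zero; stopping after n + p
  steps lands in weight - n.\<close>

lemma reflected_weight_vector:
  assumes u: "u \<in> U" "h u = s (of_nat n) u" "u \<noteq> 0" and "(e ^^ m) u = 0"
  shows "\<exists>p. (f ^^ (n + p)) ((e ^^ p) u) \<noteq> 0"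
proof -
  obtain p where p: "(e ^^ p) u \<noteq> 0" "e ((e ^^ p) u) = 0"
    using string_top assms by blast
  have "(f ^^ (n + p)) ((e ^^ p) u) \<noteq> 0"
  proof
    assume "(f ^^ (n + p)) ((e ^^ p) u) = 0"
    moreover have "h ((e ^^ p) u) = s (of_nat (n + 2 * p)) ((e ^^ p) u)"
      using h_e_pow[OF u(1,2)] by simp
    ultimately obtain k where "k < n + p" "(of_nat (n + 2 * p) :: complex) = of_nat k"
      using f_pow_zero_imp_nat[OF pow_closed(1)[OF u(1)]] p by blast
    then show False by (simp only: of_nat_eq_iff)
  qed
  then show ?thesis by blast
qed

text \<open>The assumption \<open>low\<close> abstracts the statement that c - 2 is not a weight.
  The top e^p u of the string has weight c + 2p = n and is killed by f^(p+1), so n \<le> p and c = n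
  - 2p \<le> 0.\<close>

lemma lowest_weight_nonpos:
  assumes u: "u \<in> U" "h u = s c u" "u \<noteq> 0" and "(e ^^ m) u = 0"
    and low: "\<And>p. (f ^^ Suc p) ((e ^^ p) u) = 0"
  shows "\<exists>k. c = - of_nat k"
proof -
  obtain p where p: "(e ^^ p) u \<noteq> 0" "e ((e ^^ p) u) = 0"
    using string_top assms by blast
  obtain n where n: "n < Suc p" "c + 2 * of_nat p = of_nat n"
    using f_pow_zero_imp_nat[OF pow_closed(1)[OF u(1)] h_e_pow[OF u(1,2)] p(2,1) low] by blast
  then have "c = - of_nat (2 * p - n)"
    by (simp add: of_nat_diff eq_diff_eq)
  then show ?thesis by blast
qed

end

section \<open>Modules and weights\<close>

locale lie_rep =
  fixes L :: "('g::ab_group_add, 'i) lie_data" and V :: "('g, 'v::ab_group_add) lie_module"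
  assumes lie: "lie_algebra L" and module: "is_lie_module L V"
begin

sublocale G: vector_space "scaling L"
  using lie by (simp add: lie_algebra_def)

sublocale M: vector_space "vscaling V"
  using module by (simp add: is_lie_module_def)

lemma br_add: "bracket L x (y + z) = bracket L x y + bracket L x z"
    "bracket L (x + y) z = bracket L x z + bracket L y z"
  and br_scale: "bracket L x (scaling L c y) = scaling L c (bracket L x y)"
    "bracket L (scaling L c x) y = scaling L c (bracket L x y)"
  and br_self [simp]: "bracket L x x = 0"
  using lie unfolding lie_algebra_def Vector_Spaces.linear_def module_hom_def module_hom_axioms_def
  by blast+

lemma jacobi: "bracket L x (bracket L y z) + bracket L y (bracket L z x) + bracket L z (bracket L x y) = 0"
  using lie unfolding lie_algebra_def by blast

lemma br_anti: "bracket L x y = - bracket L y x"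
proof -
  have "bracket L (x + y) (x + y) = 0" by simp
  then have "bracket L x y + bracket L y x = 0" unfolding br_add by (simp add: add.commute)
  then show ?thesis by (simp add: eq_neg_iff_add_eq_0)
qed

lemma br_zero [simp]: "bracket L x 0 = 0" "bracket L 0 x = 0"
  using br_scale(1)[of x 0 0] br_scale(2)[of 0 0 x] by auto

lemma br_uminus: "bracket L x (- y) = - bracket L x y" "bracket L (- x) y = - bracket L x y"
  using br_scale(1)[of x "-1" y] br_scale(2)[of "-1" x y] by auto

lemma br_diff: "bracket L x (y - z) = bracket L x y - bracket L x z"
    "bracket L (x - y) z = bracket L x z - bracket L y z"
  using br_add(1)[of x y "- z"] br_add(2)[of x "- y" z] by (auto simp: br_uminus)

lemma jacobi': "bracket L x (bracket L y z) = bracket L (bracket L x y) z + bracket L y (bracket L x z)"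
proof -
  have "bracket L y (bracket L z x) = - bracket L y (bracket L x z)"
    by (metis br_anti br_uminus(1))
  moreover have "bracket L z (bracket L x y) = - bracket L (bracket L x y) z"
    by (rule br_anti)
  ultimately show ?thesis using jacobi[of x y z] by (simp add: algebra_simps)
qed

lemma space: "M.subspace (space V)"
  and act_closed: "u \<in> space V \<Longrightarrow> act V x u \<in> space V"
  and act_add: "u \<in> space V \<Longrightarrow> w \<in> space V \<Longrightarrow> act V x (u + w) = act V x u + act V x w"
  and act_scale: "u \<in> space V \<Longrightarrow> act V x (vscaling V c u) = vscaling V c (act V x u)"
  and act_add_left: "u \<in> space V \<Longrightarrow> act V (x + y) u = act V x u + act V y u"
  and act_scale_left: "u \<in> space V \<Longrightarrow> act V (scaling L c x) u = vscaling V c (act V x u)"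
  and act_br: "u \<in> space V \<Longrightarrow> act V (bracket L x y) u = act V x (act V y u) - act V y (act V x u)"
  using module unfolding is_lie_module_def by blast+

lemma act_comm: "u \<in> space V \<Longrightarrow> act V x (act V y u) = act V y (act V x u) + act V (bracket L x y) u"
  by (simp add: act_br)

lemma act_zero [simp]: "act V x 0 = 0"
  using act_scale[of 0 x 0] M.subspace_0[OF space] by simp

lemma act_zero_left [simp]: "u \<in> space V \<Longrightarrow> act V 0 u = 0"
  using act_scale_left[of u 0 0] by simp

lemma act_sum:
  assumes "\<And>a. a \<in> A \<Longrightarrow> g a \<in> space V"
  shows "act V x (sum g A) = (\<Sum>a\<in>A. act V x (g a))"
  using assms
proof (induction A rule: infinite_finite_induct)
  case (insert a A)
  then have "sum g A \<in> space V" using M.subspace_sum[OF space] by (meson insertCI)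
  then show ?case using insert by (simp add: act_add)
qed auto

lemma act_pow_closed: "u \<in> space V \<Longrightarrow> (act V x ^^ k) u \<in> space V"
  by (induction k) (auto simp: act_closed)

lemma act_pow_zero [simp]: "(act V x ^^ k) 0 = 0"
  by (induction k) auto

lemma act_pow_add: "u \<in> space V \<Longrightarrow> w \<in> space V \<Longrightarrow>
    (act V x ^^ k) (u + w) = (act V x ^^ k) u + (act V x ^^ k) w"
  by (induction k) (auto simp: act_add act_pow_closed)

lemma act_pow_scale: "u \<in> space V \<Longrightarrow> (act V x ^^ k) (vscaling V c u) = vscaling V c ((act V x ^^ k) u)"
  by (induction k) (auto simp: act_scale act_pow_closed)

lemma weight_spaceI: "u \<in> space V \<Longrightarrow> (\<And>h. h \<in> cartan L \<Longrightarrow> act V h u = vscaling V (\<mu> h) u) \<Longrightarrow>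
    u \<in> weight_space L V \<mu>"
  by (simp add: weight_space_def)

lemma weight_spaceD: "u \<in> weight_space L V \<mu> \<Longrightarrow> u \<in> space V"
    "u \<in> weight_space L V \<mu> \<Longrightarrow> h \<in> cartan L \<Longrightarrow> act V h u = vscaling V (\<mu> h) u"
  by (simp_all add: weight_space_def)

lemma weight_space_subspace: "M.subspace (weight_space L V \<mu>)"
  unfolding weight_space_def
  by (rule M.subspaceI)
    (use space in \<open>auto simp: M.subspace_0 M.subspace_add M.subspace_scale act_add act_scale M.scale_right_distrib mult.commute\<close>)

lemma act_weight_space:
  assumes "x \<in> root_space L \<beta>" "u \<in> weight_space L V \<mu>"
  shows "act V x u \<in> weight_space L V (\<mu> + \<beta>)"
proof (rule weight_spaceI)
  note u = weight_spaceD[OF assms(2)]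
  show "act V x u \<in> space V" using u by (simp add: act_closed)
  fix h assume h: "h \<in> cartan L"
  have "act V h (act V x u) = act V x (act V h u) + act V (bracket L h x) u"
    using u act_comm by blast
  also have "bracket L h x = scaling L (\<beta> h) x"
    using assms(1) h by (simp add: root_space_def)
  finally show "act V h (act V x u) = vscaling V ((\<mu> + \<beta>) h) (act V x u)"
    using u(1) u(2)[OF h] by (simp add: act_scale act_scale_left M.scale_left_distrib)
qed

lemma dual_cartan_eqI:
  assumes "\<mu> \<in> dual_cartan L" "\<nu> \<in> dual_cartan L" "\<And>h. h \<in> cartan L \<Longrightarrow> \<mu> h = \<nu> h"
  shows "\<mu> = \<nu>"
proof
  fix x show "\<mu> x = \<nu> x" using assms by (cases "x \<in> cartan L") (auto simp: dual_cartan_def)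
qed

text \<open>For a weight other than the newly inserted \<nu>, choose \<open>h\<close> separating the
  two. The operator h - \<nu>(h) removes the \<nu>-component and rescales the others, so the
  induction hypothesis applies.\<close>

lemma weight_vectors_independent:
  assumes "finite B" "B \<subseteq> dual_cartan L" "\<And>\<mu>. \<mu> \<in> B \<Longrightarrow> u \<mu> \<in> weight_space L V \<mu>"
    and "(\<Sum>\<mu>\<in>B. u \<mu>) = 0" and "\<mu> \<in> B"
  shows "u \<mu> = 0"
  using assms
proof (induction B arbitrary: u \<mu> rule: finite_induct)
  case empty
  then show ?case by simp
next
  case (insert \<nu> B)
  have us: "u \<mu> \<in> space V" if "\<mu> \<in> insert \<nu> B" for \<mu>
    using insert.prems(2)[OF that] weight_spaceD(1) by blast
  have sum: "u \<nu> + sum u B = 0" using insert by simp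
  have B0: "u \<mu> = 0" if \<mu>: "\<mu> \<in> B" for \<mu>
  proof -
    have "\<mu> \<noteq> \<nu>" using insert \<mu> by blast
    then obtain h where h: "h \<in> cartan L" "\<mu> h \<noteq> \<nu> h"
      using dual_cartan_eqI[of \<mu> \<nu>] insert.prems(1) \<mu> by blast
    have "(\<Sum>\<mu>\<in>B. vscaling V (\<mu> h - \<nu> h) (u \<mu>))
        = (\<Sum>\<mu>\<in>insert \<nu> B. act V h (u \<mu>)) - vscaling V (\<nu> h) (\<Sum>\<mu>\<in>insert \<nu> B. u \<mu>)"
    proof -
      have "(\<Sum>\<mu>\<in>B. act V h (u \<mu>)) = (\<Sum>\<mu>\<in>B. vscaling V (\<mu> h) (u \<mu>))"
        by (rule sum.cong) (use insert.prems(2) h in \<open>auto simp: weight_spaceD(2)\<close>)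
      moreover have "act V h (u \<nu>) = vscaling V (\<nu> h) (u \<nu>)"
        using insert.prems(2) h by (auto simp: weight_spaceD(2))
      ultimately show ?thesis
        using insert.hyps by (simp add: M.scale_left_diff_distrib sum_subtractf
            M.scale_sum_right M.scale_right_distrib)
    qed
    also have "\<dots> = 0"
      using act_sum[of "insert \<nu> B" u h, OF us] insert.prems(3) by simp
    finally have "vscaling V (\<mu> h - \<nu> h) (u \<mu>) = 0"
      using insert.prems \<mu> M.subspace_scale[OF weight_space_subspace]
      by (intro insert.IH[of "\<lambda>\<mu>. vscaling V (\<mu> h - \<nu> h) (u \<mu>)" \<mu>]) auto
    then show ?thesis using h by simp
  qed
  then have "sum u B = 0" by simp
  then show ?case using sum B0 insert.prems(4) by auto
qed

text \<open>If \<open>ad x\<close> is locally nilpotent, the Leibniz rule shows that the \<open>x\<close>-torsion modulo a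
  submodule is again a submodule.\<close>

lemma torsion_stable:
  assumes N: "M.subspace N" "N \<subseteq> space V" "\<And>y u. u \<in> N \<Longrightarrow> act V y u \<in> N"
    and nil: "\<And>y. \<exists>k. (bracket L x ^^ k) y = 0"
    and u: "u \<in> space V" "(act V x ^^ m) u \<in> N"
  shows "\<exists>m. (act V x ^^ m) (act V y u) \<in> N"
proof -
  have up: "(act V x ^^ m') u \<in> N" if "m \<le> m'" "(act V x ^^ m) u \<in> N" for m' u m
  proof -
    have "(act V x ^^ m') u = (act V x ^^ (m' - m)) ((act V x ^^ m) u)"
      using \<open>m \<le> m'\<close> by (metis comp_apply funpow_add le_add_diff_inverse2)
    moreover have "(act V x ^^ k) w \<in> N" if "w \<in> N" for k w
      using that by (induction k) (auto simp: N)
    ultimately show ?thesis using that by simp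
  qed
  \<comment> \<open>Induction on k + m: in x y u = [x, y] u + y x u the first term lowers
    \<open>k\<close> and the second lowers \<open>m\<close>.\<close>
  have "\<exists>m. (act V x ^^ m) (act V y u) \<in> N"
    if "(bracket L x ^^ k) y = 0" "u \<in> space V" "(act V x ^^ m) u \<in> N" for k m y u
    using that
  proof (induction "k + m" arbitrary: k m y u)
    case 0
    then show ?case using N(1) M.subspace_0 by (auto intro: exI[of _ 0])
  next
    case (Suc n)
    show ?case
    proof (cases "k = 0 \<or> m = 0")
      case True
      then show ?thesis
        using Suc.prems N(3)[of u y] M.subspace_0[OF N(1)] by (auto intro: exI[of _ 0])
    next
      case False
      then obtain k' m' where km: "k = Suc k'" "m = Suc m'" by (meson not0_implies_Suc)
      have "(bracket L x ^^ k') (bracket L x y) = 0" "(act V x ^^ m') (act V x u) \<in> N"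
        using Suc.prems km by (simp_all add: funpow_swap1)
      then obtain a b where a: "(act V x ^^ a) (act V (bracket L x y) u) \<in> N"
        and b: "(act V x ^^ b) (act V y (act V x u)) \<in> N"
        using Suc.hyps(1)[of k' m "bracket L x y" u] Suc.hyps(1)[of k m' y "act V x u"] Suc km act_closed
        by auto
      have "(act V x ^^ Suc (max a b)) (act V y u) = (act V x ^^ max a b) (act V x (act V y u))"
        by (simp add: funpow_swap1)
      also have "\<dots> = (act V x ^^ max a b) (act V y (act V x u)) + (act V x ^^ max a b) (act V (bracket L x y) u)"
        using Suc.prems by (subst act_comm) (auto simp: act_pow_add act_closed)
      also have "\<dots> \<in> N"
        using up[OF max.cobounded1 a] up[OF max.cobounded2 b] M.subspace_add[OF N(1)]
        by (metis max.commute)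
      finally show ?thesis by blast
    qed
  qed
  then show ?thesis using nil[of y] u by blast
qed

end

text \<open>Regarding \<open>L\<close> as a module over itself turns root spaces into weight spaces,
  so the facts proved in \<open>lie_rep\<close> serve the root system as well.\<close>

definition adjoint :: "('g::ab_group_add, 'i) lie_data \<Rightarrow> ('g, 'g) lie_module"
  where "adjoint L = \<lparr>vscaling = scaling L, space = UNIV, act = bracket L\<rparr>"

lemma adjoint_simps [simp]: "vscaling (adjoint L) = scaling L" "space (adjoint L) = UNIV"
    "act (adjoint L) = bracket L"
  by (simp_all add: adjoint_def)

lemma weight_space_adjoint: "weight_space L (adjoint L) = root_space L"
  by (auto simp: weight_space_def root_space_def fun_eq_iff)

lemma lie_rep_adjoint:
  assumes "lie_algebra L"
  shows "lie_rep L (adjoint L)"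
proof (rule lie_rep.intro[OF assms])
  interpret G: vector_space "scaling L" using assms by (simp add: lie_algebra_def)
  have br: "bracket L x (y + z) = bracket L x y + bracket L x z"
    "bracket L (x + y) z = bracket L x z + bracket L y z"
    "bracket L x (scaling L c y) = scaling L c (bracket L x y)"
    "bracket L (scaling L c x) y = scaling L c (bracket L x y)"
    "bracket L x x = 0"
    "bracket L x (bracket L y z) + bracket L y (bracket L z x) + bracket L z (bracket L x y) = 0" for x y z c
    using assms unfolding lie_algebra_def Vector_Spaces.linear_def module_hom_def module_hom_axioms_def
    by blast+
  have anti: "bracket L x y = - bracket L y x" for x y
  proof -
    have "bracket L (x + y) (x + y) = 0" by (rule br(5))
    then show ?thesis unfolding br(1,2) by (simp add: br(5) eq_neg_iff_add_eq_0 add.commute)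
  qed
  have um: "bracket L x (- y) = - bracket L x y" for x y
    using br(3)[of x "-1" y] by simp
  have jac: "bracket L (bracket L x y) z = bracket L x (bracket L y z) - bracket L y (bracket L x z)" for x y z
  proof -
    have "bracket L y (bracket L z x) = - bracket L y (bracket L x z)"
      by (metis anti um)
    moreover have "bracket L z (bracket L x y) = - bracket L (bracket L x y) z"
      by (rule anti)
    ultimately show ?thesis using br(6)[of x y z] by (simp add: algebra_simps)
  qed
  show "is_lie_module L (adjoint L)"
    unfolding is_lie_module_def adjoint_simps using jac br(1-4) G.subspace_UNIV G.vector_space_axioms
    by blast
qed

section \<open>Roots\<close>

lemma sum_fun_apply: "(\<Sum>i\<in>A. g i) x = (\<Sum>i\<in>A. g i x)" for g :: "'a \<Rightarrow> 'b \<Rightarrow> 'c::comm_monoid_add"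
  by (induction A rule: infinite_finite_induct) auto

locale split_lie =
  fixes L :: "('g::ab_group_add, 'i) lie_data"
  assumes data: "semisimple_lie_data L"
begin

lemma lie_alg: "lie_algebra L"
  using data by (simp add: semisimple_lie_data_def)

sublocale A: lie_rep L "adjoint L"
  rewrites "vscaling (adjoint L) = scaling L" and "space (adjoint L) = UNIV" and "act (adjoint L) = bracket L"
    and "weight_space L (adjoint L) = root_space L"
  using lie_rep_adjoint[OF lie_alg] by (simp_all add: weight_space_adjoint)

abbreviation "e \<equiv> x_plus L"
abbreviation "f \<equiv> x_minus L"
abbreviation "co \<equiv> coroot L"
abbreviation "I \<equiv> nodes L"
abbreviation "\<alpha> \<equiv> simple_root L"

lemma cartan_toral: "toral L (cartan L)"
  using data by (simp add: semisimple_lie_data_def cartan_subalgebra_def)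

lemma cartan_subspace: "A.G.subspace (cartan L)"
  and cartan_comm: "x \<in> cartan L \<Longrightarrow> y \<in> cartan L \<Longrightarrow> bracket L x y = 0"
  using cartan_toral by (auto simp: toral_def)

lemma chevalley:
  assumes "i \<in> I"
  shows "e i \<in> root_space L (\<alpha> i)" "f i \<in> root_space L (- \<alpha> i)" "co i \<in> cartan L" "\<alpha> i (co i) = 2"
  using data assms by (auto simp: semisimple_lie_data_def chevalley_generators_def)

lemma br_e_f: "i \<in> I \<Longrightarrow> j \<in> I \<Longrightarrow> bracket L (e i) (f j) = (if i = j then co i else 0)"
  using data by (auto simp: semisimple_lie_data_def chevalley_generators_def)

lemma n_plus_hull: "n_plus L = lie_subalgebra L hull (e ` I)"
  and n_minus_hull: "n_minus L = lie_subalgebra L hull (f ` I)"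
  using data by (auto simp: semisimple_lie_data_def chevalley_generators_def)

lemma triangular_ex: "\<exists>a\<in>n_plus L. \<exists>h\<in>cartan L. \<exists>b\<in>n_minus L. x = a + h + b"
  using data by (simp add: semisimple_lie_data_def triangular_decomposition_def)

lemma triangular_zero:
  "a \<in> n_plus L \<Longrightarrow> h \<in> cartan L \<Longrightarrow> b \<in> n_minus L \<Longrightarrow> a + h + b = 0 \<Longrightarrow> a = 0 \<and> h = 0 \<and> b = 0"
  using data unfolding semisimple_lie_data_def triangular_decomposition_def by blast

lemma simple_system: "simple_system L"
  using data by (simp add: semisimple_lie_data_def)

lemma finite_nodes: "finite I"
  and inj_simple: "inj_on \<alpha> I"
  and simple_roots: "i \<in> I \<Longrightarrow> \<alpha> i \<in> roots L"
  using simple_system by (auto simp: simple_system_def)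

lemma simple_dual: "i \<in> I \<Longrightarrow> \<alpha> i \<in> dual_cartan L"
  using simple_roots by (auto simp: roots_def)

lemma dual_add: "\<mu> \<in> dual_cartan L \<Longrightarrow> \<nu> \<in> dual_cartan L \<Longrightarrow> \<mu> + \<nu> \<in> dual_cartan L"
  and dual_scale: "\<mu> \<in> dual_cartan L \<Longrightarrow> fun_scale c \<mu> \<in> dual_cartan L"
  and dual_uminus: "\<mu> \<in> dual_cartan L \<Longrightarrow> - \<mu> \<in> dual_cartan L"
  and dual_zero: "0 \<in> dual_cartan L"
  by (auto simp: dual_cartan_def fun_scale_def algebra_simps)

lemma dual_diff: "\<mu> \<in> dual_cartan L \<Longrightarrow> \<nu> \<in> dual_cartan L \<Longrightarrow> \<mu> - \<nu> \<in> dual_cartan L"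
  using dual_add dual_uminus by (metis diff_conv_add_uminus)

lemma dual_at_zero: "\<mu> \<in> dual_cartan L \<Longrightarrow> \<mu> 0 = 0"
proof -
  assume "\<mu> \<in> dual_cartan L"
  then have "\<mu> (scaling L 0 0) = 0 * \<mu> 0"
    using A.G.subspace_0[OF cartan_subspace] unfolding dual_cartan_def by blast
  then show ?thesis by simp
qed

text \<open>Complex coefficients let natural, integral and real combinations live in one space,
  where \<open>lc_inj\<close> compares them.\<close>

definition lc :: "('i \<Rightarrow> complex) \<Rightarrow> 'g \<Rightarrow> complex"
  where "lc c = (\<Sum>i\<in>I. fun_scale (c i) (\<alpha> i))"

lemma lc_apply: "lc c x = (\<Sum>i\<in>I. c i * \<alpha> i x)"
  by (simp add: lc_def sum_fun_apply fun_scale_def)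

lemma lc_add: "lc (\<lambda>i. c i + d i) = lc c + lc d"
  and lc_diff: "lc (\<lambda>i. c i - d i) = lc c - lc d"
  and lc_zero: "lc (\<lambda>i. 0) = 0"
  by (auto simp: fun_eq_iff lc_apply ring_distribs sum.distrib sum_subtractf fun_scale_def
      sum_distrib_left mult.assoc)

lemma lc_cong: "(\<And>i. i \<in> I \<Longrightarrow> c i = d i) \<Longrightarrow> lc c = lc d"
  by (simp add: lc_def)

lemma lc_single: "i \<in> I \<Longrightarrow> lc (\<lambda>j. if j = i then z else 0) = fun_scale z (\<alpha> i)"
  using finite_nodes by (simp add: fun_eq_iff lc_apply fun_scale_def if_distrib[where f = "\<lambda>x. x * _"] cong: if_cong)

lemma lc_dual: "lc c \<in> dual_cartan L"
proof -
  have "(\<Sum>i\<in>J. fun_scale (c i) (\<alpha> i)) \<in> dual_cartan L" if "J \<subseteq> I" for J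
    using that by (induction J rule: infinite_finite_induct)
      (auto intro!: dual_zero dual_add dual_scale simple_dual)
  then show ?thesis by (simp add: lc_def)
qed

lemma lc_zeroD:
  assumes "lc c = 0" "i \<in> I"
  shows "c i = 0"
proof -
  interpret F: vector_space fun_scale by (rule vector_space_fun_scale)
  define d where "d = (\<lambda>\<beta>. c (inv_into I \<alpha> \<beta>))"
  have "(\<Sum>\<beta>\<in>\<alpha> ` I. fun_scale (d \<beta>) \<beta>) = lc c"
    unfolding lc_def by (simp add: sum.reindex[OF inj_simple] d_def inj_simple)
  then have sum0: "(\<Sum>\<beta>\<in>\<alpha> ` I. fun_scale (d \<beta>) \<beta>) = 0" using assms(1) by simp
  have "\<not> F.dependent (\<alpha> ` I)" using simple_system unfolding simple_system_def by blast
  then have "\<nexists>u. (\<exists>v\<in>\<alpha> ` I. u v \<noteq> 0) \<and> (\<Sum>v\<in>\<alpha> ` I. fun_scale (u v) v) = 0"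
    unfolding F.dependent_finite[OF finite_imageI[OF finite_nodes]] .
  with sum0 have "\<forall>\<beta>\<in>\<alpha> ` I. d \<beta> = 0" by blast
  then show ?thesis using assms(2) by (simp add: d_def inj_simple)
qed

lemma lc_inj: "lc c = lc d \<Longrightarrow> i \<in> I \<Longrightarrow> c i = d i"
  using lc_zeroD[of "\<lambda>i. c i - d i" i] by (simp add: lc_diff)

text \<open>Nonzero vectors of distinct weights are linearly independent, so a finite spanning set
  bounds the number of weights. The weight 0 is included because the strings in
  \<open>ad_nilpotent\<close> may pass through it.\<close>

lemma finite_weights: "finite {\<gamma> \<in> dual_cartan L. root_space L \<gamma> \<noteq> {0}}" (is "finite ?W")
proof -
  obtain B where B: "finite B" "A.G.span B = UNIV"
    using data by (auto simp: semisimple_lie_data_def finite_dimensional_def)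
  have "\<exists>x. x \<in> root_space L \<gamma> \<and> x \<noteq> 0" if "\<gamma> \<in> ?W" for \<gamma>
    using that A.G.subspace_0[OF A.weight_space_subspace] by auto
  then have "\<exists>x. \<forall>\<gamma>\<in>?W. x \<gamma> \<in> root_space L \<gamma> \<and> x \<gamma> \<noteq> 0" by (intro bchoice ballI)
  then obtain x where x: "\<And>\<gamma>. \<gamma> \<in> ?W \<Longrightarrow> x \<gamma> \<in> root_space L \<gamma> \<and> x \<gamma> \<noteq> 0" by (elim exE bspec) blast
  have lin: "c \<gamma> = 0" if T: "finite T" "T \<subseteq> ?W" "(\<Sum>\<gamma>\<in>T. scaling L (c \<gamma>) (x \<gamma>)) = 0" "\<gamma> \<in> T" for T c \<gamma>
  proof -
    have W: "\<delta> \<in> ?W" if "\<delta> \<in> T" for \<delta> using T(2) that by (rule subsetD)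
    then have sub: "T \<subseteq> dual_cartan L" by blast
    have mem: "scaling L (c \<delta>) (x \<delta>) \<in> root_space L \<delta>" if "\<delta> \<in> T" for \<delta>
      using x[OF W[OF that]] A.G.subspace_scale[OF A.weight_space_subspace] by simp
    have "scaling L (c \<gamma>) (x \<gamma>) = 0"
      by (rule A.weight_vectors_independent[OF T(1) sub mem T(3,4)])
    moreover have "x \<gamma> \<noteq> 0" using x[OF W[OF T(4)]] by simp
    ultimately show ?thesis by simp
  qed
  have inj: "inj_on x ?W"
  proof (rule inj_onI, rule ccontr)
    fix \<gamma> \<delta> assume *: "\<gamma> \<in> ?W" "\<delta> \<in> ?W" "x \<gamma> = x \<delta>" "\<gamma> \<noteq> \<delta>"
    define c where "c = (\<lambda>\<eta>. if \<eta> = \<gamma> then 1 else -1 :: complex)"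
    have c: "c \<gamma> = 1" "c \<delta> = -1" using *(4) by (auto simp: c_def)
    have "(\<Sum>\<eta>\<in>{\<gamma>, \<delta>}. scaling L (c \<eta>) (x \<eta>)) = 0"
      using *(3,4) c by simp
    then have "c \<gamma> = 0" using lin[of "{\<gamma>, \<delta>}" c \<gamma>] *(1,2) by blast
    then show False using c by simp
  qed
  have "\<not> A.G.dependent (x ` ?W)"
  proof
    assume "A.G.dependent (x ` ?W)"
    then obtain t u v where t: "finite t" "t \<subseteq> x ` ?W" "(\<Sum>v\<in>t. scaling L (u v) v) = 0" "v \<in> t" "u v \<noteq> 0"
      unfolding A.G.dependent_explicit by blast
    obtain T where T: "T \<subseteq> ?W" "t = x ` T" "inj_on x T"
      using t(2) unfolding subset_image_inj by blast
    have "finite T" by (rule finite_imageD[OF _ T(3)]) (use t(1) T(2) in simp)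
    moreover have "(\<Sum>\<gamma>\<in>T. scaling L (u (x \<gamma>)) (x \<gamma>)) = 0"
      using t(3) unfolding T(2) sum.reindex[OF T(3)] by (simp only: comp_def)
    ultimately have "u (x \<gamma>) = 0" if "\<gamma> \<in> T" for \<gamma>
      using lin[of T "\<lambda>\<gamma>. u (x \<gamma>)"] T(1) that by blast
    moreover obtain \<gamma> where "\<gamma> \<in> T" "v = x \<gamma>" using t(4) unfolding T(2) by (rule imageE)
    ultimately show False using t(5) by metis
  qed
  then have "finite (x ` ?W)"
    using A.G.independent_span_bound[OF B(1), of "x ` ?W"] unfolding B(2) by (metis subset_UNIV)
  then show ?thesis using inj by (rule finite_imageD)
qed

lemma finite_roots: "finite (roots L)"
  using finite_weights by (rule rev_finite_subset) (auto simp: roots_def)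

text \<open>On a vector of weight \<gamma> the powers of ad x run through the pairwise distinct
  weights \<gamma> + k \<beta>, of which only finitely many occur. The triangular decomposition
  reduces an arbitrary \<open>y\<close> to such vectors.\<close>

lemma ad_nilpotent:
  assumes x: "x \<in> root_space L \<beta>" and \<beta>: "\<beta> \<in> dual_cartan L" "\<beta> \<noteq> 0"
  shows "\<exists>k. (bracket L x ^^ k) y = 0"
proof -
  have add: "\<exists>k. (bracket L x ^^ k) (y + z) = 0"
    if "(bracket L x ^^ k) y = 0" "(bracket L x ^^ l) z = 0" for y z k l
  proof -
    have "(bracket L x ^^ (k + l)) (y + z) = (bracket L x ^^ (l + k)) y + (bracket L x ^^ (k + l)) z"
      by (simp add: A.act_pow_add add.commute)
    also have "\<dots> = 0" using that by (simp add: funpow_add del: add.commute)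
    finally show ?thesis by blast
  qed
  have root: "\<exists>k. (bracket L x ^^ k) y = 0" if y: "y \<in> root_space L \<gamma>" "\<gamma> \<in> dual_cartan L" for y \<gamma>
  proof (rule ccontr)
    assume nz: "\<nexists>k. (bracket L x ^^ k) y = 0"
    define g where "g = (\<lambda>k::nat. \<gamma> + fun_scale (of_nat k) \<beta>)"
    have g: "(bracket L x ^^ k) y \<in> root_space L (g k)" for k
    proof (induction k)
      case 0
      then show ?case using y by (simp add: g_def fun_scale_def plus_fun_def)
    next
      case (Suc k)
      have "g (Suc k) = g k + \<beta>" by (simp add: g_def fun_eq_iff fun_scale_def algebra_simps)
      then show ?case using A.act_weight_space[OF x Suc] by (simp only: funpow.simps comp_apply)
    qed
    have "g k \<in> {\<gamma> \<in> dual_cartan L. root_space L \<gamma> \<noteq> {0}}" for k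
      using g[of k] nz y(2) \<beta> by (auto simp: g_def dual_add dual_scale)
    then have "range g \<subseteq> {\<gamma> \<in> dual_cartan L. root_space L \<gamma> \<noteq> {0}}" by blast
    then have "finite (range g)" using finite_weights by (rule finite_subset)
    moreover have "inj g"
    proof (rule injI)
      fix k l assume eq: "g k = g l"
      obtain h where "\<beta> h \<noteq> 0" using \<beta>(2) by (auto simp: fun_eq_iff)
      with fun_cong[OF eq, of h] show "k = l" by (simp add: g_def fun_scale_def)
    qed
    ultimately have "finite (UNIV :: nat set)" by (rule finite_imageD)
    then show False by simp
  qed
  have sub: "A.G.subspace {y. \<exists>k. (bracket L x ^^ k) y = 0}"
    by (rule A.G.subspaceI) (auto simp: A.act_pow_scale intro: add)
  have span: "\<exists>k. (bracket L x ^^ k) y = 0" if "y \<in> A.G.span (\<Union>\<beta>\<in>S. root_space L \<beta>)" "S \<subseteq> dual_cartan L" for y S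
    using A.G.span_minimal[OF _ sub, of "\<Union>\<beta>\<in>S. root_space L \<beta>"] root that by blast
  obtain a h b where y: "y = a + h + b" "a \<in> n_plus L" "h \<in> cartan L" "b \<in> n_minus L"
    using triangular_ex by blast
  have "\<exists>k. (bracket L x ^^ k) a = 0" "\<exists>k. (bracket L x ^^ k) b = 0"
    using y span by (auto simp: n_plus_def n_minus_def roots_def)
  moreover have "\<exists>k. (bracket L x ^^ k) h = 0"
    using y cartan_comm by (intro root[of h 0] dual_zero) (auto simp: root_space_def)
  ultimately show ?thesis unfolding y(1) using add by blast
qed

lemma simple_nonzero: "i \<in> I \<Longrightarrow> \<alpha> i \<noteq> 0"
  using simple_roots by (auto simp: roots_def)

lemma ad_e_nilpotent: "i \<in> I \<Longrightarrow> \<exists>k. (bracket L (e i) ^^ k) y = 0"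
  and ad_f_nilpotent: "i \<in> I \<Longrightarrow> \<exists>k. (bracket L (f i) ^^ k) y = 0"
  by (rule ad_nilpotent[OF chevalley(1)] ad_nilpotent[OF chevalley(2)];
      simp add: simple_dual dual_uminus simple_nonzero)+

lemma br_co: "i \<in> I \<Longrightarrow> j \<in> I \<Longrightarrow> bracket L (co i) (e j) = scaling L (\<alpha> j (co i)) (e j)"
    "i \<in> I \<Longrightarrow> j \<in> I \<Longrightarrow> bracket L (co i) (f j) = scaling L (- \<alpha> j (co i)) (f j)"
  using chevalley(1-3) by (auto simp: root_space_def)

lemma f_nonzero: "i \<in> I \<Longrightarrow> f i \<noteq> 0"
  using br_e_f[of i i] chevalley(4)[of i] dual_at_zero[OF simple_dual[of i]] by auto

end

text \<open>The second version exchanges \<open>e\<close> and \<open>f\<close> and negates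
  \<open>h\<close>; it turns every statement on highest weights of strings into one on lowest
  weights.\<close>

lemma (in lie_rep) sl2_actions:
  assumes "split_lie L" "i \<in> nodes L"
  shows "sl2_action (vscaling V) (space V) (act V (x_plus L i)) (act V (x_minus L i)) (act V (coroot L i))"
    and "sl2_action (vscaling V) (space V) (act V (x_minus L i)) (act V (x_plus L i)) (act V (- coroot L i))"
proof -
  interpret S: split_lie L by fact
  have br: "bracket L (x_plus L i) (x_minus L i) = coroot L i"
    "bracket L (x_minus L i) (x_plus L i) = - coroot L i"
    "bracket L (coroot L i) (x_plus L i) = scaling L 2 (x_plus L i)"
    "bracket L (coroot L i) (x_minus L i) = - scaling L 2 (x_minus L i)"
    "bracket L (- coroot L i) (x_plus L i) = - scaling L 2 (x_plus L i)"
    "bracket L (- coroot L i) (x_minus L i) = scaling L 2 (x_minus L i)"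
    using S.br_e_f[of i i] S.br_co[of i i] S.chevalley(4)[of i] assms(2) br_anti[of "x_minus L i" "x_plus L i"]
    by (auto simp: br_uminus)
  have um: "act V (- x) u = - act V x u" "- act V x u \<in> space V"
      "act V y (- act V x u) = - act V y (act V x u)" if "u \<in> space V" for x y u
    using act_scale_left[OF that, of "-1" x] act_scale[OF act_closed[OF that, of x], of y "-1"]
      M.subspace_neg[OF space act_closed[OF that]] by simp_all
  show "sl2_action (vscaling V) (space V) (act V (x_plus L i)) (act V (x_minus L i)) (act V (coroot L i))"
    by unfold_locales
      (use act_comm[of _ "x_plus L i" "x_minus L i"] act_comm[of _ "coroot L i" "x_minus L i"]
        act_comm[of _ "coroot L i" "x_plus L i"] in
       \<open>auto simp: space act_closed act_add act_scale br um act_scale_left\<close>)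
  show "sl2_action (vscaling V) (space V) (act V (x_minus L i)) (act V (x_plus L i)) (act V (- coroot L i))"
    by unfold_locales
      (use act_comm[of _ "x_minus L i" "x_plus L i"] act_comm[of _ "- coroot L i" "x_plus L i"]
        act_comm[of _ "- coroot L i" "x_minus L i"] in
       \<open>auto simp: space act_closed act_add act_scale br um act_scale_left\<close>)
qed

lemma (in lie_rep) pow_weight_space:
  assumes "x \<in> root_space L \<beta>" "u \<in> weight_space L V \<mu>"
  shows "(act V x ^^ k) u \<in> weight_space L V (\<mu> + fun_scale (of_nat k) \<beta>)"
proof (induction k)
  case 0
  then show ?case using assms by (simp add: fun_scale_def plus_fun_def)
next
  case (Suc k)
  have "\<mu> + fun_scale (of_nat (Suc k)) \<beta> = (\<mu> + fun_scale (of_nat k) \<beta>) + \<beta>"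
    by (simp add: fun_eq_iff fun_scale_def algebra_simps)
  then show ?case using act_weight_space[OF assms(1) Suc] by (simp only: funpow.simps comp_apply)
qed

section \<open>The Cartan matrix and its positivity\<close>

context split_lie
begin

text \<open>Under the sl2 of node \<open>i\<close> the vector \<open>f j\<close> is singular of
  weight - \<alpha>_j(h_i), since [e_i, f_j] = 0. As ad f_i is nilpotent, this weight is natural; if
  it is 0, then already the first power of ad f_i kills \<open>f j\<close>.\<close>

lemma cartan_entry:
  assumes "i \<in> I" "j \<in> I" "i \<noteq> j"
  shows "\<exists>n. \<alpha> j (co i) = - of_nat n" and "\<alpha> j (co i) = 0 \<Longrightarrow> bracket L (f i) (f j) = 0"
proof -
  interpret sl: sl2_action "scaling L" UNIV "bracket L (e i)" "bracket L (f i)" "bracket L (co i)"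
    using A.sl2_actions[OF split_lie_axioms assms(1)] by simp
  obtain m where m: "(bracket L (f i) ^^ m) (f j) = 0" using ad_f_nilpotent assms(1) by blast
  have u: "bracket L (co i) (f j) = scaling L (- \<alpha> j (co i)) (f j)" "bracket L (e i) (f j) = 0"
    using br_co br_e_f assms by auto
  obtain n where "- \<alpha> j (co i) = of_nat n"
    using sl.f_pow_zero_imp_nat[OF _ u f_nonzero m] assms by auto
  then show "\<exists>n. \<alpha> j (co i) = - of_nat n" by (metis minus_minus)
  show "bracket L (f i) (f j) = 0" if "\<alpha> j (co i) = 0"
    using sl.f_pow_nonzero[of "f j" 0 m] u that m by auto
qed

text \<open>Bracketing the relation [f_j, f_i] = 0 with \<open>e j\<close> leaves [h_j, f_i] =
  0.\<close>

lemma cartan_entry_zero_sym: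
  assumes "i \<in> I" "j \<in> I" "i \<noteq> j" "\<alpha> j (co i) = 0"
  shows "\<alpha> i (co j) = 0"
proof -
  interpret sl: sl2_action "scaling L" UNIV "bracket L (e j)" "bracket L (f j)" "bracket L (co j)"
    using A.sl2_actions[OF split_lie_axioms assms(2)] by simp
  have "bracket L (f j) (f i) = 0"
    using cartan_entry(2)[OF assms] A.br_anti[of "f j" "f i"] by simp
  moreover have "bracket L (e j) (bracket L (f j) (f i)) = bracket L (f j) (bracket L (e j) (f i)) + bracket L (co j) (f i)"
    by (rule sl.ef) simp
  ultimately have "scaling L (- \<alpha> i (co j)) (f i) = 0"
    using br_e_f br_co assms by simp
  then show ?thesis using f_nonzero assms by simp
qed

text \<open>Cartan integers are needed as integers because the later arguments use their order; the
  values of the roots are complex.\<close>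

definition cm :: "'i \<Rightarrow> 'i \<Rightarrow> int"
  where "cm i j = (SOME c. \<alpha> j (co i) = of_int c)"

lemma cm: "i \<in> I \<Longrightarrow> j \<in> I \<Longrightarrow> \<alpha> j (co i) = of_int (cm i j)"
  unfolding cm_def
proof (rule someI_ex)
  assume "i \<in> I" "j \<in> I"
  then show "\<exists>c. \<alpha> j (co i) = of_int c"
    using chevalley(4)[of i] cartan_entry(1)[of i j]
    by (metis of_int_minus of_int_numeral of_int_of_nat_eq)
qed

lemma cm_diag: "i \<in> I \<Longrightarrow> cm i i = 2"
  using cm[of i i] chevalley(4)[of i] by (metis of_int_eq_numeral_iff)

lemma cm_nonpos: "i \<in> I \<Longrightarrow> j \<in> I \<Longrightarrow> i \<noteq> j \<Longrightarrow> cm i j \<le> 0"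
  using cm[of i j] cartan_entry(1)[of i j]
  by (metis neg_le_0_iff_le of_int_eq_iff of_int_minus of_int_of_nat_eq of_nat_0_le_iff)

lemma cm_zero_sym: "i \<in> I \<Longrightarrow> j \<in> I \<Longrightarrow> cm i j = 0 \<Longrightarrow> cm j i = 0"
  using cm[of i j] cm[of j i] cartan_entry_zero_sym[of i j] cm_diag[of i]
  by (metis of_int_0 of_int_eq_0_iff)

lemma lc_co: "j \<in> I \<Longrightarrow> lc (\<lambda>i. of_int (c i)) (co j) = of_int (\<Sum>i\<in>I. cm j i * c i)"
  by (simp add: lc_apply cm mult.commute)

text \<open>In the sl2 of node \<open>j\<close> with \<open>e\<close> and \<open>f\<close>
  exchanged, a root vector for \<beta> has weight \<open>m\<close>, and
  \<open>reflected_weight_vector\<close> supplies a nonzero vector at the reflected root.\<close>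

lemma root_reflect:
  assumes \<beta>: "\<beta> \<in> roots L" and j: "j \<in> I" and m: "\<beta> (co j) = - of_nat m"
    and nz: "\<beta> + fun_scale (of_nat m) (\<alpha> j) \<noteq> 0"
  shows "\<beta> + fun_scale (of_nat m) (\<alpha> j) \<in> roots L"
proof -
  interpret sl: sl2_action "scaling L" UNIV "bracket L (f j)" "bracket L (e j)" "bracket L (- co j)"
    using A.sl2_actions[OF split_lie_axioms j] by simp
  have \<beta>': "\<beta> \<in> dual_cartan L" "root_space L \<beta> \<noteq> {0}" using \<beta> by (auto simp: roots_def)
  then obtain x where x: "x \<in> root_space L \<beta>" "x \<noteq> 0"
    using A.G.subspace_0[OF A.weight_space_subspace] by blast
  have "bracket L (- co j) x = scaling L (of_nat m) x"
    using x(1) chevalley(3)[OF j] m by (simp add: root_space_def A.br_uminus)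
  moreover obtain k where "(bracket L (f j) ^^ k) x = 0" using ad_f_nilpotent j by blast
  ultimately obtain p where p: "(bracket L (e j) ^^ (m + p)) ((bracket L (f j) ^^ p) x) \<noteq> 0"
    using sl.reflected_weight_vector x by blast
  have "(bracket L (e j) ^^ (m + p)) ((bracket L (f j) ^^ p) x)
      \<in> root_space L ((\<beta> + fun_scale (of_nat p) (- \<alpha> j)) + fun_scale (of_nat (m + p)) (\<alpha> j))"
    using A.pow_weight_space chevalley(1,2)[OF j] x by blast
  also have "(\<beta> + fun_scale (of_nat p) (- \<alpha> j)) + fun_scale (of_nat (m + p)) (\<alpha> j) = \<beta> + fun_scale (of_nat m) (\<alpha> j)"
    by (simp add: fun_eq_iff fun_scale_def algebra_simps)
  finally have "root_space L (\<beta> + fun_scale (of_nat m) (\<alpha> j)) \<noteq> {0}" using p by blast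
  then show ?thesis using nz \<beta>'(1) j unfolding roots_def by (simp add: dual_add dual_scale simple_dual)
qed

text \<open>Take a root supported on \<open>S\<close> of maximal height: a negative pairing with h_j
  would let the reflection at \<open>j\<close> add a positive multiple of \<alpha>_j. The
  requirement that some pairing be nonzero is built into the maximised property; it holds for a
  simple root, which pairs to 2 with its own coroot, and survives reflection.\<close>

lemma ex_dominant_root:
  assumes S: "S \<subseteq> I" "S \<noteq> {}"
  shows "\<exists>t :: 'i \<Rightarrow> nat. (\<forall>j\<in>S. (\<Sum>i\<in>S. cm j i * int (t i)) \<ge> 0) \<and> (\<exists>j\<in>S. (\<Sum>i\<in>S. cm j i * int (t i)) \<noteq> 0)"
proof -
  have finS: "finite S" by (rule finite_subset[OF S(1) finite_nodes])
  define P where "P = (\<lambda>t :: 'i \<Rightarrow> nat. (\<forall>i. i \<notin> S \<longrightarrow> t i = 0) \<and> lc (\<lambda>i. of_nat (t i)) \<in> roots L \<and>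
     (\<exists>j\<in>S. (\<Sum>i\<in>S. cm j i * int (t i)) \<noteq> 0))"
  have P_I: "P t" if "\<And>i. i \<notin> S \<Longrightarrow> t i = 0" "lc (\<lambda>i. of_nat (t i)) \<in> roots L" "j \<in> S"
    "(\<Sum>i\<in>S. cm j i * int (t i)) \<noteq> 0" for t j
    using that unfolding P_def by blast
  have P_out: "t i = 0" if "P t" "i \<notin> S" for t i
    using that unfolding P_def by blast
  have P_root: "lc (\<lambda>i. of_nat (t i)) \<in> roots L" if "P t" for t
    using that unfolding P_def by blast
  have P_nz: "\<exists>j\<in>S. (\<Sum>i\<in>S. cm j i * int (t i)) \<noteq> 0" if "P t" for t
    using that unfolding P_def by blast
  define \<Theta> where "\<Theta> = Collect P"
  have co: "lc (\<lambda>i. of_nat (t i)) (co j) = of_int (\<Sum>i\<in>S. cm j i * int (t i))"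
    if "P t" "j \<in> S" for t j
  proof -
    have "(\<Sum>i\<in>I. cm j i * int (t i)) = (\<Sum>i\<in>S. cm j i * int (t i))"
    proof (rule sum.mono_neutral_right[OF finite_nodes S(1)])
      show "\<forall>i\<in>I - S. cm j i * int (t i) = 0" using P_out[OF that(1)] by simp
    qed
    then show ?thesis using lc_co[of j "\<lambda>i. int (t i)"] S that(2) by auto
  qed
  have "inj_on (\<lambda>t. lc (\<lambda>i. of_nat (t i))) \<Theta>"
  proof (rule inj_onI, rule ext)
    fix t t' i assume "t \<in> \<Theta>" "t' \<in> \<Theta>" "lc (\<lambda>i. of_nat (t i)) = lc (\<lambda>i. of_nat (t' i))"
    then show "t i = t' i"
      using lc_inj[of "\<lambda>i. of_nat (t i)" "\<lambda>i. of_nat (t' i)" i] S(1) P_out[of t i] P_out[of t' i]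
      by (cases "i \<in> S") (auto simp: \<Theta>_def)
  qed
  moreover have "finite ((\<lambda>t. lc (\<lambda>i. of_nat (t i))) ` \<Theta>)"
    by (rule finite_subset[OF _ finite_roots]) (use P_root in \<open>auto simp: \<Theta>_def\<close>)
  ultimately have fin: "finite \<Theta>" by (rule finite_imageD[rotated])
  obtain i where i: "i \<in> S" "i \<in> I" using S by blast
  have "(\<lambda>j. if j = i then 1 else 0) \<in> \<Theta>"
  proof -
    have "lc (\<lambda>j. of_nat (if j = i then 1 else 0)) = \<alpha> i"
      using lc_single[OF i(2), of 1] by (simp add: if_distrib fun_scale_def cong: if_cong)
    moreover have "(\<Sum>k\<in>S. cm i k * int (if k = i then 1 else 0)) = 2"
      using i finS cm_diag by (simp add: if_distrib cong: if_cong)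
    ultimately have "P (\<lambda>j. if j = i then 1 else 0)"
      using i simple_roots by (intro P_I[of _ i]) auto
    then show ?thesis by (simp add: \<Theta>_def)
  qed
  then have "\<Theta> \<noteq> {}" by blast
  define ht where "ht = (\<lambda>t :: 'i \<Rightarrow> nat. \<Sum>i\<in>S. t i)"
  have "Max (ht ` \<Theta>) \<in> ht ` \<Theta>" using fin \<open>\<Theta> \<noteq> {}\<close> by (intro Max_in) auto
  then obtain t where "t \<in> \<Theta>" "Max (ht ` \<Theta>) = ht t" by blast
  then have t: "P t" and max: "\<And>t'. P t' \<Longrightarrow> ht t' \<le> ht t"
    using fin Max_ge[of "ht ` \<Theta>"] by (auto simp: \<Theta>_def)
  have "(\<Sum>i\<in>S. cm j i * int (t i)) \<ge> 0" if j: "j \<in> S" for j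
  proof (rule ccontr)
    assume "\<not> ?thesis"
    then obtain m where m: "(\<Sum>i\<in>S. cm j i * int (t i)) = - int m" "m > 0"
      by (metis neg_int_cases not_le)
    have jI: "j \<in> I" using j S by blast
    define t' where "t' = (\<lambda>i. t i + (if i = j then m else 0))"
    have lct: "lc (\<lambda>i. of_nat (t' i)) = lc (\<lambda>i. of_nat (t i)) + fun_scale (of_nat m) (\<alpha> j)"
      using lc_single[OF jI, of "of_nat m"] lc_add[of "\<lambda>i. of_nat (t i)" "\<lambda>i. if i = j then of_nat m else 0"]
      by (simp add: t'_def if_distrib cong: if_cong)
    have "lc (\<lambda>i. of_nat (t' i)) \<noteq> 0"
    proof
      assume "lc (\<lambda>i. of_nat (t' i)) = 0"
      then have "(of_nat (t' j) :: complex) = 0" by (rule lc_zeroD[OF _ jI])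
      then have "t' j = 0" by (simp only: of_nat_eq_0_iff)
      then show False using m(2) by (simp add: t'_def)
    qed
    then have "lc (\<lambda>i. of_nat (t' i)) \<in> roots L"
      using root_reflect[OF P_root[OF t] jI, of m] co[OF t j] m(1) unfolding lct by simp
    \<comment> \<open>Adding m \<alpha>_j changes the pairing with h_j from - m to - m + 2m, so
      \<open>P\<close> persists with the same witness \<open>j\<close>.\<close>
    moreover have "(\<Sum>i\<in>S. cm j i * int (t' i)) = int m"
    proof -
      have "(\<Sum>i\<in>S. cm j i * int (t' i)) = (\<Sum>i\<in>S. cm j i * int (t i)) + (\<Sum>i\<in>S. if i = j then cm j i * int m else 0)"
        unfolding sum.distrib[symmetric] by (rule sum.cong) (auto simp: t'_def algebra_simps)
      then show ?thesis using m(1) finS j jI cm_diag by simp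
    qed
    moreover have "t' i = 0" if "i \<notin> S" for i using P_out[OF t that] that j by (auto simp: t'_def)
    ultimately have "P t'" using j m(2) by (intro P_I[of t' j]) auto
    moreover have "ht t' = ht t + m"
      using finS j by (simp add: ht_def t'_def sum.distrib)
    ultimately show False using max[of t'] m(2) by simp
  qed
  then show ?thesis using P_nz[OF t] by blast
qed

text \<open>In the inductive step a dominant root \<open>t\<close> is compared
  with \<open>d\<close>: the difference \<open>t - s d\<close>, with \<open>s\<close> as large as possible, vanishes on a set \<open>Z\<close> of nodes
  which is not linked to the other ones.\<close>

lemma cartan_matrix_positive:
  assumes "S \<subseteq> I" "S \<noteq> {}" "\<And>i. i \<in> S \<Longrightarrow> d i > (0 :: real)"
  shows "\<exists>j\<in>S. (\<Sum>i\<in>S. of_int (cm j i) * d i) > 0"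
  using assms
proof (induction "card S" arbitrary: S rule: less_induct)
  case less
  note S = less.prems
  have finS: "finite S" by (rule finite_subset[OF S(1) finite_nodes])
  show ?case
  proof (rule ccontr)
    assume "\<not> ?case"
    then have Ad: "(\<Sum>i\<in>S. of_int (cm j i) * d i) \<le> 0" if "j \<in> S" for j using that by auto
    obtain t0 :: "'i \<Rightarrow> nat" where t0: "\<forall>j\<in>S. (\<Sum>i\<in>S. cm j i * int (t0 i)) \<ge> 0" "\<exists>j\<in>S. (\<Sum>i\<in>S. cm j i * int (t0 i)) \<noteq> 0"
      using ex_dominant_root[OF S(1,2)] by (elim exE conjE)
    define t where "t = (\<lambda>i. real (t0 i))"
    have cast: "(\<Sum>i\<in>S. of_int (cm j i) * t i) = of_int (\<Sum>i\<in>S. cm j i * int (t0 i))" for j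
      by (simp only: t_def of_int_sum of_int_mult of_int_of_nat_eq)
    have At: "(\<Sum>i\<in>S. of_int (cm j i) * t i) \<ge> 0" if "j \<in> S" for j
      unfolding cast of_int_0_le_iff using t0(1) that by blast
    have tpos: "t i \<ge> 0" for i by (simp add: t_def)
    define T where "T = {i \<in> S. t i > 0}"
    have T: "T \<subseteq> S" "finite T" using finS by (auto simp: T_def)
    have sumT: "(\<Sum>i\<in>S. of_int (cm j i) * t i) = (\<Sum>i\<in>T. of_int (cm j i) * t i)" for j
      using finS tpos by (intro sum.mono_neutral_right) (auto simp: T_def order_less_le)
    have "T \<noteq> {}"
    proof
      assume "T = {}"
      then have "(\<Sum>i\<in>S. of_int (cm j i) * t i) = 0" for j using sumT by simp
      then show False using t0(2) unfolding cast of_int_eq_0_iff by blast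
    qed
    \<comment> \<open>The largest scalar with s d \<le> t on the support \<open>T\<close> of
      \<open>t\<close>; equality holds at the node \<open>z\<close> where the minimum is
      attained.\<close>
    define s where "s = Min ((\<lambda>i. t i / d i) ` T)"
    have "s \<in> (\<lambda>i. t i / d i) ` T"
      unfolding s_def using T \<open>T \<noteq> {}\<close> by (intro Min_in) auto
    then obtain z where z: "z \<in> T" "s = t z / d z" by blast
    have s_le: "s * d i \<le> t i" if "i \<in> T" for i
    proof -
      have "s \<le> t i / d i" unfolding s_def using T that by (intro Min_le) auto
      then show ?thesis using S(3)[of i] that T(1) by (simp add: pos_le_divide_eq subset_iff)
    qed
    have "s > 0" using z T S(3) by (auto simp: T_def)
    define Z where "Z = {i \<in> T. t i = s * d i}"
    have Z: "Z \<subseteq> T" "z \<in> Z" "Z \<subseteq> S" using z T S(3)[of z] by (auto simp: Z_def)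
    \<comment> \<open>Outside the support of \<open>t\<close> every term of the row sum is
      nonpositive, while the sum is nonnegative; hence each term vanishes.\<close>
    have out: "cm i k = 0" if "i \<in> S - T" "k \<in> T" for i k
    proof -
      have le: "of_int (cm i k) * t k \<le> 0" if "k \<in> T" for k
        using that \<open>i \<in> S - T\<close> S(1) T(1) cm_nonpos[of i k] tpos[of k]
        by (intro mult_nonpos_nonneg) (auto simp: subset_iff)
      have "(\<Sum>k\<in>T. of_int (cm i k) * t k) \<le> 0" using le by (rule sum_nonpos)
      then have "(\<Sum>k\<in>T. - (of_int (cm i k) * t k)) = 0"
        using At[of i] that(1) unfolding sumT by (simp add: sum_negf)
      then have "- (of_int (cm i k) * t k) = 0"
        using le T(2) that(2) by (subst (asm) sum_nonneg_eq_0_iff) auto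
      then show ?thesis using that(2) by (simp add: T_def)
    qed
    have dT: "(\<Sum>k\<in>S. of_int (cm i k) * d k) = (\<Sum>k\<in>T. of_int (cm i k) * d k)" if "i \<in> T" for i
      using finS T that out cm_zero_sym S(1) by (intro sum.mono_neutral_right) (auto simp: subset_iff)
    \<comment> \<open>The same argument for t - s d on \<open>T\<close>: at a node of
      \<open>Z\<close> the diagonal term is zero, the other terms are nonpositive, and
      \<open>At\<close> and \<open>Ad\<close> make the total nonnegative.\<close>
    have in_T: "cm i k = 0" if "i \<in> Z" "k \<in> T - Z" for i k
    proof -
      have le: "of_int (cm i k) * (t k - s * d k) \<le> 0" if "k \<in> T" for k
      proof (cases "k = i")
        case True
        then show ?thesis using \<open>i \<in> Z\<close> by (simp add: Z_def)
      next
        case False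
        then show ?thesis using that \<open>i \<in> Z\<close> S(1) Z T(1) cm_nonpos[of i k] s_le[of k]
          by (intro mult_nonpos_nonneg) (auto simp: subset_iff)
      qed
      have iS: "i \<in> S" "i \<in> T" using that Z by auto
      have "(\<Sum>k\<in>T. of_int (cm i k) * (t k - s * d k)) = (\<Sum>k\<in>S. of_int (cm i k) * t k) - s * (\<Sum>k\<in>S. of_int (cm i k) * d k)"
        unfolding sumT dT[OF iS(2)] by (simp add: algebra_simps sum_subtractf sum_distrib_left)
      also have "\<dots> \<ge> 0"
        using At[OF iS(1)] mult_nonneg_nonpos[OF less_imp_le[OF \<open>s > 0\<close>] Ad[OF iS(1)]] by linarith
      finally have "(\<Sum>k\<in>T. of_int (cm i k) * (t k - s * d k)) \<ge> 0" .
      moreover have "(\<Sum>k\<in>T. of_int (cm i k) * (t k - s * d k)) \<le> 0" using le by (rule sum_nonpos)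
      ultimately have "(\<Sum>k\<in>T. - (of_int (cm i k) * (t k - s * d k))) = 0"
        by (simp add: sum_negf)
      then have "- (of_int (cm i k) * (t k - s * d k)) = 0"
        using le T(2) that(2) by (subst (asm) sum_nonneg_eq_0_iff) auto
      then show ?thesis using that(2) by (simp add: Z_def)
    qed
    have dZ: "(\<Sum>k\<in>S. of_int (cm i k) * d k) = (\<Sum>k\<in>Z. of_int (cm i k) * d k)" if "i \<in> Z" for i
      using that Z(1) T in_T by (subst dT) (auto intro!: sum.mono_neutral_right)
    \<comment> \<open>On \<open>Z\<close> the row sums of \<open>d\<close> over \<open>S\<close>
      reduce to those over \<open>Z\<close>, so for a proper subset the induction hypothesis
      contradicts \<open>Ad\<close>.\<close>
    have "Z = S"
    proof (rule ccontr)
      assume "Z \<noteq> S"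
      then have "card Z < card S" using Z finS by (intro psubset_card_mono) auto
      then obtain j where "j \<in> Z" "(\<Sum>i\<in>Z. of_int (cm j i) * d i) > 0"
        using less.hyps[of Z] Z S by blast
      then show False using Ad[of j] dZ[of j] Z by auto
    qed
    \<comment> \<open>Now t = s d on all of \<open>S\<close>, so its pairings are at once
      nonnegative and nonpositive, hence all zero, contrary to the choice of
      \<open>t0\<close>.\<close>
    then have ts: "t i = s * d i" if "i \<in> S" for i using that by (auto simp: Z_def)
    have "(\<Sum>i\<in>S. of_int (cm j i) * t i) = s * (\<Sum>i\<in>S. of_int (cm j i) * d i)" for j
      unfolding sum_distrib_left by (rule sum.cong) (auto simp: ts)
    moreover have "s * (\<Sum>i\<in>S. of_int (cm j i) * d i) \<le> 0" if "j \<in> S" for j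
      using Ad[OF that] \<open>s > 0\<close> by (simp add: mult_nonneg_nonpos)
    ultimately have "(\<Sum>i\<in>S. of_int (cm j i) * t i) = 0" if "j \<in> S" for j
      using At[OF that] that by (metis order_antisym)
    then show False using t0(2) unfolding cast of_int_eq_0_iff by blast
  qed
qed

text \<open>If all three pairs were linked, each row sum of the 3 x 3 submatrix would be at most 2 -
  1 - 1 = 0, against positivity for the vector with all entries 1.\<close>

lemma ex_unlinked_pair:
  assumes "{i, j, k} \<subseteq> I" "i \<noteq> j" "j \<noteq> k" "i \<noteq> k"
  shows "\<exists>p\<in>{i, j, k}. \<exists>q\<in>{i, j, k}. p \<noteq> q \<and> cm p q = 0"
proof (rule ccontr)
  assume no: "\<not> ?thesis"
  have le: "cm p q \<le> -1" if "p \<in> {i, j, k}" "q \<in> {i, j, k}" "p \<noteq> q" for p q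
  proof -
    have "cm p q \<noteq> 0" "p \<in> I" "q \<in> I" using that no assms(1) by blast+
    then show ?thesis using cm_nonpos[of p q] that by linarith
  qed
  then have "(\<Sum>q\<in>{i, j, k}. real_of_int (cm p q) * 1) \<le> 0" if "p \<in> {i, j, k}" for p
  proof -
    have "(\<Sum>q\<in>{i, j, k}. cm p q) \<le> 0"
      using that assms cm_diag[of p] le[of p i] le[of p j] le[of p k] by auto
    then have "real_of_int (\<Sum>q\<in>{i, j, k}. cm p q) \<le> 0" by (simp only: of_int_le_0_iff)
    then show ?thesis by simp
  qed
  then show False using cartan_matrix_positive[of "{i, j, k}" "\<lambda>_. 1"] assms(1) by fastforce
qed

end

section \<open>Highest weight modules\<close>

lemma words_scale_lookup: "Poly_Mapping.lookup (words_scale c p) w = c * Poly_Mapping.lookup p w"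
  by (simp add: words_scale_def Poly_Mapping.map.rep_eq when_def)

lemma left_mult_word: "left_mult x (word w) = word (x # w)"
  by (simp add: left_mult_def word_def)

lemma words_expand: "p = (\<Sum>w\<in>Poly_Mapping.keys p. words_scale (Poly_Mapping.lookup p w) (word w))"
proof (rule poly_mapping_eqI)
  fix u
  have "Poly_Mapping.lookup (\<Sum>w\<in>Poly_Mapping.keys p. words_scale (Poly_Mapping.lookup p w) (word w)) u
      = (\<Sum>w\<in>Poly_Mapping.keys p. if w = u then Poly_Mapping.lookup p u else 0)"
    unfolding lookup_sum by (rule sum.cong) (auto simp: words_scale_lookup word_def lookup_single when_def)
  also have "\<dots> = Poly_Mapping.lookup p u" by (simp add: in_keys_iff)
  finally show "Poly_Mapping.lookup p u = Poly_Mapping.lookup (\<Sum>w\<in>Poly_Mapping.keys p. words_scale (Poly_Mapping.lookup p w) (word w)) u"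
    by simp
qed

lemma ex_list_count:
  assumes "finite A"
  shows "\<exists>w. set w \<subseteq> A \<and> (\<forall>i\<in>A. count_list w i = c i)"
  using assms
proof induction
  case (insert a A)
  then obtain w where w: "set w \<subseteq> A" "\<forall>i\<in>A. count_list w i = c i" by blast
  have rep: "count_list (replicate n a) i = (if i = a then n else 0)" for n i
    by (induction n) auto
  have "count_list w a = 0" using w(1) insert.hyps by (meson count_notin subsetD)
  then have "\<forall>i\<in>insert a A. count_list (replicate (c a) a @ w) i = c i"
    using w(2) insert.hyps(2) by (auto simp: rep)
  moreover have "set (replicate (c a) a @ w) \<subseteq> insert a A" using w(1) by auto
  ultimately show ?case by blast
qed simp

context split_lie
begin

text \<open>Since \<open>lc\<close> sums over \<open>I\<close> only, letters outside
  \<open>I\<close> contribute nothing.\<close>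

abbreviation content :: "'i list \<Rightarrow> 'g \<Rightarrow> complex" where "content w \<equiv> lc (\<lambda>i. of_nat (count_list w i))"

lemma content_Nil: "content [] = 0"
  by (simp add: lc_zero)

lemma content_Cons: "i \<in> I \<Longrightarrow> content (i # w) = content w + \<alpha> i"
proof -
  assume i: "i \<in> I"
  have "content (i # w) = lc (\<lambda>j. of_nat (count_list w j) + (if j = i then 1 else 0))"
    by (rule lc_cong) auto
  then show ?thesis using lc_single[OF i, of 1] by (simp add: lc_add fun_scale_def)
qed

lemma content_eq_zeroD:
  assumes "set w \<subseteq> I" "content w = 0"
  shows "w = []"
proof (cases w)
  case (Cons i w')
  then have "i \<in> I" using assms(1) by simp
  then have "(of_nat (count_list w i) :: complex) = 0" using lc_zeroD[OF assms(2)] by blast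
  then have "count_list w i = 0" by (simp only: of_nat_eq_0_iff)
  then show ?thesis using Cons by simp
qed simp

end

locale split_rep = split_lie L + R: lie_rep L V
  for L :: "('g::ab_group_add, 'i) lie_data" and V :: "('g, 'v::ab_group_add) lie_module"
begin

lemma stable_span:
  assumes "S \<subseteq> space V" "R.M.subspace N" "\<And>s. s \<in> S \<Longrightarrow> act V x s \<in> N" "u \<in> R.M.span S"
  shows "act V x u \<in> N"
proof -
  have "R.M.subspace {u \<in> space V. act V x u \<in> N}"
    by (rule R.M.subspaceI)
      (use assms(2) R.space in \<open>auto simp: R.M.subspace_0 R.M.subspace_add R.M.subspace_scale R.act_add R.act_scale\<close>)
  then have "R.M.span S \<subseteq> {u \<in> space V. act V x u \<in> N}"
    using assms by (intro R.M.span_minimal) auto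
  then show ?thesis using assms(4) by blast
qed

text \<open>The elements preserving \<open>N\<close> form a Lie subalgebra, so generators suffice.\<close>

lemma stable_if_generators:
  assumes N: "R.M.subspace N" "N \<subseteq> space V"
    and e: "\<And>i u. i \<in> I \<Longrightarrow> u \<in> N \<Longrightarrow> act V (e i) u \<in> N"
    and f: "\<And>i u. i \<in> I \<Longrightarrow> u \<in> N \<Longrightarrow> act V (f i) u \<in> N"
    and h: "\<And>h u. h \<in> cartan L \<Longrightarrow> u \<in> N \<Longrightarrow> act V h u \<in> N"
    and u: "u \<in> N"
  shows "act V x u \<in> N"
proof -
  let ?S = "{x. \<forall>u\<in>N. act V x u \<in> N}"
  have S: "lie_subalgebra L ?S"
    unfolding lie_subalgebra_def
  proof (intro conjI ballI)
    show "A.G.subspace ?S"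
      by (rule A.G.subspaceI)
        (use N in \<open>auto simp: subset_iff R.M.subspace_0 R.M.subspace_add R.M.subspace_scale R.act_add_left R.act_scale_left\<close>)
    show "bracket L a b \<in> ?S" if "a \<in> ?S" "b \<in> ?S" for a b
      using that N by (auto simp: subset_iff R.act_br R.M.subspace_diff)
  qed
  have "n_plus L \<subseteq> ?S" unfolding n_plus_hull
    by (rule hull_minimal[where S = "lie_subalgebra L" and t = ?S]) (use e S in blast)+
  moreover have "n_minus L \<subseteq> ?S" unfolding n_minus_hull
    by (rule hull_minimal[where S = "lie_subalgebra L" and t = ?S]) (use f S in blast)+
  moreover obtain a k b where x: "x = a + k + b" "a \<in> n_plus L" "k \<in> cartan L" "b \<in> n_minus L"
    using triangular_ex by blast
  ultimately have "act V a u \<in> N" "act V k u \<in> N" "act V b u \<in> N" using u h by blast+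
  then show ?thesis
    unfolding x(1) using u N by (simp add: R.act_add_left R.M.subspace_add subset_iff)
qed

definition fw :: "'i list \<Rightarrow> 'v \<Rightarrow> 'v" where "fw w u = foldr (\<lambda>i. act V (f i)) w u"
definition ew :: "'i list \<Rightarrow> 'v \<Rightarrow> 'v" where "ew w u = foldr (\<lambda>i. act V (e i)) w u"

lemma fw_simps [simp]: "fw [] u = u" "fw (i # w) u = act V (f i) (fw w u)"
  and ew_simps [simp]: "ew [] u = u" "ew (i # w) u = act V (e i) (ew w u)"
  and fw_append: "fw (w @ w') u = fw w (fw w' u)"
  and ew_append: "ew (w @ w') u = ew w (ew w' u)"
  by (simp_all add: fw_def ew_def)

lemma fw_replicate: "fw (replicate n i) u = (act V (f i) ^^ n) u"
  and ew_replicate: "ew (replicate n i) u = (act V (e i) ^^ n) u"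
  by (induction n) auto

lemma fw_closed: "u \<in> space V \<Longrightarrow> fw w u \<in> space V"
  and ew_closed: "u \<in> space V \<Longrightarrow> ew w u \<in> space V"
  by (induction w) (auto simp: R.act_closed)

lemma ew_add: "u \<in> space V \<Longrightarrow> u' \<in> space V \<Longrightarrow> ew w (u + u') = ew w u + ew w u'"
  by (induction w) (auto simp: R.act_add ew_closed)

lemma fw_weight: "set w \<subseteq> I \<Longrightarrow> u \<in> weight_space L V \<mu> \<Longrightarrow> fw w u \<in> weight_space L V (\<mu> - content w)"
proof (induction w)
  case (Cons i w)
  have "\<mu> - content (i # w) = (\<mu> - content w) + - \<alpha> i"
    using Cons.prems content_Cons[of i w] by (simp only: list.set insert_subset) simp
  moreover have "act V (f i) (fw w u) \<in> weight_space L V ((\<mu> - content w) + - \<alpha> i)"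
    using Cons.prems by (intro R.act_weight_space[OF chevalley(2)] Cons.IH) auto
  ultimately show ?case by (simp only: fw_simps)
qed (simp add: lc_zero)

lemma ew_weight: "set w \<subseteq> I \<Longrightarrow> u \<in> weight_space L V \<mu> \<Longrightarrow> ew w u \<in> weight_space L V (\<mu> + content w)"
proof (induction w)
  case (Cons i w)
  have "\<mu> + content (i # w) = (\<mu> + content w) + \<alpha> i"
    using Cons.prems content_Cons[of i w] by (simp only: list.set insert_subset) (simp add: add.assoc)
  moreover have "act V (e i) (ew w u) \<in> weight_space L V ((\<mu> + content w) + \<alpha> i)"
    using Cons.prems by (intro R.act_weight_space[OF chevalley(1)] Cons.IH) auto
  ultimately show ?case by (simp only: ew_simps)
qed (simp add: lc_zero)

text \<open>Each raising letter that \<open>h\<close> passes shifts the eigenvalue by a simple root.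
  Here \<open>u\<close> need not be a weight vector, as is required for the radical.\<close>

lemma act_cartan_ew:
  assumes "set w \<subseteq> I" "u \<in> space V" "h \<in> cartan L"
  shows "ew w (act V h u) = act V h (ew w u) - vscaling V (content w h) (ew w u)"
  using assms(1)
proof (induction w)
  case Nil
  then show ?case by (simp add: lc_apply)
next
  case (Cons i w)
  have i: "i \<in> I" "ew w u \<in> space V" using Cons.prems assms by (auto simp: ew_closed)
  have "bracket L h (e i) = scaling L (\<alpha> i h) (e i)"
    using chevalley(1)[OF i(1)] assms(3) by (simp add: root_space_def)
  then have c: "act V h (act V (e i) (ew w u)) = act V (e i) (act V h (ew w u)) + vscaling V (\<alpha> i h) (act V (e i) (ew w u))"
    using R.act_comm[OF i(2), of h "e i"] i(2) by (simp add: R.act_scale_left)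
  have "ew (i # w) (act V h u) = act V (e i) (act V h (ew w u) + vscaling V (- content w h) (ew w u))"
    using Cons by simp
  also have "\<dots> = act V (e i) (act V h (ew w u)) + vscaling V (- content w h) (act V (e i) (ew w u))"
    using i(2) by (simp only: R.act_add R.act_scale R.act_closed R.M.subspace_scale[OF R.space])
  also have "\<dots> = act V h (ew (i # w) u) - vscaling V (content (i # w) h) (ew (i # w) u)"
    using c by (simp add: content_Cons[OF i(1)] R.M.scale_left_distrib del: count_list.simps)
  finally show ?case .
qed

end

locale hw_module = split_rep L V
  for L :: "('g::ab_group_add, 'i) lie_data" and V :: "('g, 'v::ab_group_add) lie_module" +
  fixes lam :: "'g \<Rightarrow> complex" and v :: 'v
  assumes lam: "lam \<in> dual_cartan L" and hw: "highest_weight_module L lam V v"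
begin

text \<open>\<open>V\<close> is the image of the free algebra, whose words are obtained from the
  empty one by left multiplications; so everything is reached from \<open>v\<close> by the
  action.\<close>

lemma submodule_eq_space:
  assumes N: "R.M.subspace N" "v \<in> N" "\<And>x u. u \<in> N \<Longrightarrow> act V x u \<in> N"
  shows "space V \<subseteq> N"
proof
  fix u assume "u \<in> space V"
  obtain \<phi> where "Vector_Spaces.linear words_scale (vscaling V) \<phi>" and \<phi>: "range \<phi> = space V" "v = \<phi> (word [])"
    "\<And>x p. \<phi> (left_mult x p) = act V x (\<phi> p)"
    using hw unfolding highest_weight_module_def verma_surjection_def by blast
  then interpret \<phi>: Vector_Spaces.linear words_scale "vscaling V" \<phi> by simp
  have w: "\<phi> (word w) \<in> N" for w
  proof (induction w)
    case Nil
    then show ?case using N(2) \<phi>(2) by simp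
  next
    case (Cons x w)
    then show ?case using N(3) \<phi>(3)[of x "word w"] by (simp add: left_mult_word)
  qed
  obtain p where "u = \<phi> p" using \<phi>(1) \<open>u \<in> space V\<close> by blast
  also have "\<phi> p = (\<Sum>w\<in>Poly_Mapping.keys p. vscaling V (Poly_Mapping.lookup p w) (\<phi> (word w)))"
    by (subst words_expand) (simp add: \<phi>.sum \<phi>.scale)
  finally show "u \<in> N" using w N(1) by (auto intro: R.M.subspace_sum R.M.subspace_scale)
qed

lemma v_space: "v \<in> space V"
  and v_n_plus: "x \<in> n_plus L \<Longrightarrow> act V x v = 0"
  and v_cartan: "h \<in> cartan L \<Longrightarrow> act V h v = vscaling V (lam h) v"
proof -
  obtain \<phi> where "Vector_Spaces.linear words_scale (vscaling V) \<phi>" and \<phi>: "range \<phi> = space V" "v = \<phi> (word [])"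
    "\<And>x p. \<phi> (left_mult x p) = act V x (\<phi> p)" "\<And>p. p \<in> verma_kernel L lam \<Longrightarrow> \<phi> p = 0"
    using hw unfolding highest_weight_module_def verma_surjection_def by blast
  then interpret \<phi>: Vector_Spaces.linear words_scale "vscaling V" \<phi> by simp
  show "v \<in> space V" using \<phi>(1,2) by blast
  have act_v: "act V x v = \<phi> (word [x])" for x
    using \<phi>(2,3) left_mult_word by metis
  show "act V x v = 0" if "x \<in> n_plus L"
  proof -
    have "word ([] @ [x]) \<in> verma_kernel L lam"
      unfolding verma_kernel_def by (rule \<phi>.vs1.span_base) (use that in blast)
    then show ?thesis using \<phi>(4) act_v by simp
  qed
  show "act V h v = vscaling V (lam h) v" if "h \<in> cartan L"
  proof -
    have "word ([] @ [h]) - words_scale (lam h) (word []) \<in> verma_kernel L lam"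
      unfolding verma_kernel_def by (rule \<phi>.vs1.span_base) (use that in blast)
    then have "\<phi> (word [h]) - vscaling V (lam h) v = 0"
      using \<phi>(4) by (fastforce simp: \<phi>.diff \<phi>.scale \<phi>(2))
    then show ?thesis using act_v by simp
  qed
qed

lemma v_weight: "v \<in> weight_space L V lam"
  using v_space v_cartan by (rule R.weight_spaceI)

lemma v_e: "i \<in> I \<Longrightarrow> act V (e i) v = 0"
  by (rule v_n_plus) (simp add: n_plus_hull hull_inc)

lemma v_nonzero: "v \<noteq> 0"
proof
  assume "v = 0"
  then have "space V \<subseteq> {0}" by (intro submodule_eq_space) auto
  then show False using hw R.M.subspace_0[OF R.space] unfolding highest_weight_module_def by blast
qed

lemma fw_v_weight: "set w \<subseteq> I \<Longrightarrow> fw w v \<in> weight_space L V (lam - content w)"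
  using fw_weight v_weight by blast

text \<open>The spanning half of the PBW theorem: the span of the lowering words is stable under all
  Chevalley generators and under the Cartan subalgebra, hence is a submodule containing
  \<open>v\<close>.\<close>

lemma space_span: "space V = R.M.span ((\<lambda>w. fw w v) ` {w. set w \<subseteq> I})" (is "_ = R.M.span ?B")
proof
  have B: "?B \<subseteq> space V" using v_space fw_closed by blast
  show "R.M.span ?B \<subseteq> space V" by (rule R.M.span_minimal[OF B R.space])
  have f: "act V (f i) u \<in> R.M.span ?B" if "i \<in> I" "u \<in> R.M.span ?B" for i u
  proof (rule stable_span[OF B R.M.subspace_span _ that(2)])
    fix s assume "s \<in> ?B"
    then obtain w where "set w \<subseteq> I" "s = fw w v" by blast
    then show "act V (f i) s \<in> R.M.span ?B"
      using that(1) by (intro R.M.span_base image_eqI[of _ _ "i # w"]) auto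
  qed
  have h: "act V h u \<in> R.M.span ?B" if "h \<in> cartan L" "u \<in> R.M.span ?B" for h u
  proof (rule stable_span[OF B R.M.subspace_span _ that(2)])
    fix s assume "s \<in> ?B"
    then obtain w where w: "set w \<subseteq> I" "s = fw w v" by blast
    have "act V h (fw w v) = vscaling V ((lam - content w) h) (fw w v)"
      using fw_v_weight[OF w(1)] that(1) by (rule R.weight_spaceD(2))
    then show "act V h s \<in> R.M.span ?B"
      unfolding w(2) using w(1) by (metis (mono_tags, lifting) R.M.span_base R.M.span_scale image_eqI mem_Collect_eq)
  qed
  have e: "act V (e i) u \<in> R.M.span ?B" if "i \<in> I" "u \<in> R.M.span ?B" for i u
  proof (rule stable_span[OF B R.M.subspace_span _ that(2)])
    fix s assume "s \<in> ?B"
    then obtain w where w: "set w \<subseteq> I" "s = fw w v" by blast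
    have "act V (e i) (fw w v) \<in> R.M.span ?B" using w(1)
    proof (induction w)
      case Nil
      then show ?case by (simp add: v_e that(1) R.M.span_zero)
    next
      case (Cons j w)
      have w: "fw w v \<in> R.M.span ?B" using Cons.prems by (auto intro: R.M.span_base)
      \<comment> \<open>Passing \<open>e i\<close> over one letter leaves a Cartan element or 0,
        which acts on the shorter word by a scalar; at the empty word \<open>v_e\<close>
        applies.\<close>
      have "act V (e i) (fw (j # w) v) = act V (f j) (act V (e i) (fw w v)) + act V (bracket L (e i) (f j)) (fw w v)"
        using R.act_comm[OF fw_closed[OF v_space], of "e i" "f j" w] by (simp only: fw_simps)
      also have "\<dots> \<in> R.M.span ?B"
      proof (rule R.M.span_add)
        show "act V (f j) (act V (e i) (fw w v)) \<in> R.M.span ?B"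
          using Cons f by simp
        show "act V (bracket L (e i) (f j)) (fw w v) \<in> R.M.span ?B"
          using h[OF chevalley(3)[OF that(1)] w] Cons.prems that(1) v_space
          by (cases "i = j") (simp_all add: br_e_f fw_closed R.M.span_zero)
      qed
      finally show ?case .
    qed
    then show "act V (e i) s \<in> R.M.span ?B" using w by simp
  qed
  have "v \<in> R.M.span ?B" by (rule R.M.span_base, rule image_eqI[of _ _ "[]"]) auto
  then show "space V \<subseteq> R.M.span ?B"
    using stable_if_generators[OF R.M.subspace_span \<open>R.M.span ?B \<subseteq> space V\<close> e f h]
    by (intro submodule_eq_space R.M.subspace_span) auto
qed

text \<open>Grouping a linear combination by the contents of its words writes \<open>x\<close> as a
  sum of weight vectors. Independence of distinct weights leaves only the group of weight
  \<eta>.\<close>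

lemma weight_vector_in_span:
  assumes W: "\<W> \<subseteq> {w. set w \<subseteq> I}" and x: "x \<in> R.M.span ((\<lambda>w. fw w v) ` \<W>)"
    and \<eta>: "x \<in> weight_space L V \<eta>" "\<eta> \<in> dual_cartan L"
  shows "x \<in> R.M.span ((\<lambda>w. fw w v) ` {w \<in> \<W>. lam - content w = \<eta>})"
proof -
  define D where "D = (\<lambda>\<mu>. R.M.span ((\<lambda>w. fw w v) ` {w \<in> \<W>. lam - content w = \<mu>}))"
  have D_weight: "D \<mu> \<subseteq> weight_space L V \<mu>" for \<mu>
    unfolding D_def
    by (rule R.M.span_minimal[OF _ R.weight_space_subspace]) (use W fw_v_weight in blast)
  have D_zero: "0 \<in> D \<mu>" for \<mu> unfolding D_def by (rule R.M.span_zero)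
  have "\<exists>B g. finite B \<and> B \<subseteq> dual_cartan L \<and> (\<forall>\<mu>. g \<mu> \<in> D \<mu>) \<and> (\<forall>\<mu>. \<mu> \<notin> B \<longrightarrow> g \<mu> = 0) \<and> x = sum g B"
    using x
  proof (induction rule: R.M.span_induct_alt)
    case base
    show ?case by (rule exI[of _ "{}"], rule exI[of _ "\<lambda>_. 0"]) (use D_zero in auto)
  next
    case (step c a y)
    then obtain B g where B: "finite B" "B \<subseteq> dual_cartan L" "\<And>\<mu>. g \<mu> \<in> D \<mu>" "\<And>\<mu>. \<mu> \<notin> B \<Longrightarrow> g \<mu> = 0"
      "y = sum g B" by blast
    obtain w where w: "w \<in> \<W>" "a = fw w v" using step by blast
    define \<nu> where "\<nu> = lam - content w"
    define g' where "g' = g(\<nu> := vscaling V c a + g \<nu>)"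
    have "\<nu> \<in> dual_cartan L" unfolding \<nu>_def by (intro dual_diff lam lc_dual)
    have "a \<in> D \<nu>" unfolding D_def w(2) by (rule R.M.span_base) (use w(1) in \<open>auto simp: \<nu>_def\<close>)
    then have "vscaling V c a + g \<nu> \<in> D \<nu>"
      using B(3)[of \<nu>] unfolding D_def by (intro R.M.span_add R.M.span_scale)
    then have "g' \<mu> \<in> D \<mu>" for \<mu> using B(3) by (simp add: g'_def)
    moreover have "sum g' (insert \<nu> B) = vscaling V c a + y"
    proof -
      have "sum g B = sum g (insert \<nu> B)" using B(1,4) by (cases "\<nu> \<in> B") (auto simp: insert_absorb)
      also have "\<dots> = g \<nu> + sum g (B - {\<nu>})" using B(1) by (simp add: sum.insert_remove)
      finally have y: "y = g \<nu> + sum g (B - {\<nu>})" using B(5) by simp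
      have "sum g' (insert \<nu> B) = g' \<nu> + sum g' (B - {\<nu>})" using B(1) by (simp add: sum.insert_remove)
      also have "sum g' (B - {\<nu>}) = sum g (B - {\<nu>})" by (rule sum.cong) (auto simp: g'_def)
      finally show ?thesis unfolding y by (simp add: g'_def add.assoc)
    qed
    moreover have "g' \<mu> = 0" if "\<mu> \<notin> insert \<nu> B" for \<mu> using that B(4) by (simp add: g'_def)
    ultimately show ?case using B(1,2) \<open>\<nu> \<in> dual_cartan L\<close>
      by (intro exI[of _ "insert \<nu> B"] exI[of _ g']) auto
  qed
  then obtain B g where B: "finite B" "B \<subseteq> dual_cartan L" "\<And>\<mu>. g \<mu> \<in> D \<mu>" "\<And>\<mu>. \<mu> \<notin> B \<Longrightarrow> g \<mu> = 0"
    "x = sum g B" by blast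
  \<comment> \<open>Subtracting \<open>x\<close> from the component at \<eta> gives weight vectors
    of total 0.\<close>
  define u where "u = (\<lambda>\<mu>. g \<mu> - (if \<mu> = \<eta> then x else 0))"
  have sumg: "sum g (insert \<eta> B) = x" using B(1,4,5) by (cases "\<eta> \<in> B") (auto simp: insert_absorb)
  have "g \<mu> \<in> weight_space L V \<mu>" for \<mu> using B(3) D_weight by blast
  then have "u \<mu> \<in> weight_space L V \<mu>" for \<mu>
    using \<eta>(1) by (simp add: u_def R.M.subspace_diff[OF R.weight_space_subspace])
  moreover have "sum u (insert \<eta> B) = 0"
    using sumg B(1) by (simp add: u_def sum_subtractf)
  ultimately have "u \<eta> = 0"
    using B(1,2) \<eta>(2) by (intro R.weight_vectors_independent[of "insert \<eta> B" u \<eta>]) auto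
  then have "x = g \<eta>" by (simp add: u_def)
  then show ?thesis using B(3)[of \<eta>] by (simp add: D_def)
qed

text \<open>By \<open>weight_vector_in_span\<close> each weight space is spanned by lowering words
  of the matching content, so a weight is always witnessed by a single nonvanishing word.\<close>

lemma wt_iff: "\<mu> \<in> wt L V \<longleftrightarrow> (\<exists>w. set w \<subseteq> I \<and> fw w v \<noteq> 0 \<and> \<mu> = lam - content w)"
proof
  assume "\<mu> \<in> wt L V"
  then have \<mu>: "\<mu> \<in> dual_cartan L" "weight_space L V \<mu> \<noteq> {0}" by (auto simp: wt_def)
  then obtain x where x: "x \<in> weight_space L V \<mu>" "x \<noteq> 0"
    using R.M.subspace_0[OF R.weight_space_subspace] by blast
  then have "x \<in> R.M.span ((\<lambda>w. fw w v) ` {w. set w \<subseteq> I})"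
    using R.weight_spaceD(1) space_span by blast
  from weight_vector_in_span[OF _ this x(1) \<mu>(1)]
  have x': "x \<in> R.M.span ((\<lambda>w. fw w v) ` {w \<in> {w. set w \<subseteq> I}. lam - content w = \<mu>})" by simp
  show "\<exists>w. set w \<subseteq> I \<and> fw w v \<noteq> 0 \<and> \<mu> = lam - content w"
  proof (rule ccontr)
    assume "\<not> ?thesis"
    then have "(\<lambda>w. fw w v) ` {w \<in> {w. set w \<subseteq> I}. lam - content w = \<mu>} \<subseteq> {0}" by blast
    then have "x \<in> R.M.span {0}" using x' R.M.span_mono by blast
    then show False using x(2) by simp
  qed
next
  assume "\<exists>w. set w \<subseteq> I \<and> fw w v \<noteq> 0 \<and> \<mu> = lam - content w"
  then obtain w where "set w \<subseteq> I" "fw w v \<noteq> 0" "\<mu> = lam - content w" by blast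
  then show "\<mu> \<in> wt L V"
    unfolding wt_def using fw_v_weight[of w] by (auto intro: dual_diff lam lc_dual)
qed

lemma wtI: "u \<in> weight_space L V \<mu> \<Longrightarrow> u \<noteq> 0 \<Longrightarrow> \<mu> \<in> dual_cartan L \<Longrightarrow> \<mu> \<in> wt L V"
  by (auto simp: wt_def)

lemma wtD:
  assumes "\<mu> \<in> wt L V"
  obtains u where "u \<in> weight_space L V \<mu>" "u \<noteq> 0" "u \<in> space V" "\<mu> \<in> dual_cartan L"
  using assms R.M.subspace_0[OF R.weight_space_subspace] R.weight_spaceD(1) unfolding wt_def by blast

text \<open>By \<open>torsion_stable\<close> the elements that are x-torsion modulo \<open>N\<close>
  form a submodule; it contains \<open>v\<close>, which generates everything.\<close>

lemma torsion:
  assumes N: "R.M.subspace N" "N \<subseteq> space V" "\<And>y u. u \<in> N \<Longrightarrow> act V y u \<in> N"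
    and nil: "\<And>y. \<exists>k. (bracket L x ^^ k) y = 0" and v: "(act V x ^^ m) v \<in> N"
    and u: "u \<in> space V"
  shows "\<exists>m. (act V x ^^ m) u \<in> N"
proof -
  let ?T = "{u \<in> space V. \<exists>m. (act V x ^^ m) u \<in> N}"
  have "space V \<subseteq> ?T"
  proof (rule submodule_eq_space)
    show "R.M.subspace ?T"
    proof (rule R.M.subspaceI)
      fix a b assume "a \<in> ?T" "b \<in> ?T"
      then obtain k l where ab: "a \<in> space V" "b \<in> space V" "(act V x ^^ k) a \<in> N" "(act V x ^^ l) b \<in> N" by blast
      have pow: "(act V x ^^ j) w \<in> N" if "w \<in> N" for j w using that by (induction j) (auto simp: N)
      have "(act V x ^^ (k + l)) (a + b) = (act V x ^^ l) ((act V x ^^ k) a) + (act V x ^^ k) ((act V x ^^ l) b)"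
      proof -
        have "(act V x ^^ (k + l)) a = (act V x ^^ l) ((act V x ^^ k) a)"
          by (metis add.commute comp_apply funpow_add)
        moreover have "(act V x ^^ (k + l)) b = (act V x ^^ k) ((act V x ^^ l) b)"
          by (metis comp_apply funpow_add)
        ultimately show ?thesis using ab(1,2) by (simp only: R.act_pow_add)
      qed
      also have "\<dots> \<in> N" using pow ab(3,4) by (intro R.M.subspace_add[OF N(1)])
      finally show "a + b \<in> ?T"
        using R.M.subspace_add[OF R.space] ab(1,2) by blast
    next
      fix c a assume "a \<in> ?T"
      then show "vscaling V c a \<in> ?T"
        using R.M.subspace_scale[OF R.space] R.M.subspace_scale[OF N(1)] R.act_pow_scale
        by (smt (verit, best) mem_Collect_eq)
    qed (use R.M.subspace_0[OF R.space] R.M.subspace_0[OF N(1)] in auto)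
    show "v \<in> ?T" using v v_space by blast
  next
    fix y u assume "u \<in> ?T"
    then show "act V y u \<in> ?T"
      using R.torsion_stable[OF N nil] R.act_closed by blast
  qed
  then show ?thesis using u by blast
qed

lemma e_nilpotent: "i \<in> I \<Longrightarrow> u \<in> space V \<Longrightarrow> \<exists>m. (act V (e i) ^^ m) u = 0"
  using torsion[of "{0}" "e i" 1 u] ad_e_nilpotent v_e R.M.subspace_0[OF R.space] by auto

lemma f_nilpotent: "i \<in> I \<Longrightarrow> (act V (f i) ^^ m) v = 0 \<Longrightarrow> u \<in> space V \<Longrightarrow> \<exists>m. (act V (f i) ^^ m) u = 0"
  using torsion[of "{0}" "f i" m u] ad_f_nilpotent R.M.subspace_0[OF R.space] by auto

text \<open>Available at every node, because raising operators are locally nilpotent on any highest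
  weight module.\<close>

lemma wt_reflect_down:
  assumes "\<mu> \<in> wt L V" "i \<in> I" "\<mu> (co i) = of_nat n"
  shows "\<mu> - fun_scale (of_nat n) (\<alpha> i) \<in> wt L V"
proof -
  interpret sl: sl2_action "vscaling V" "space V" "act V (e i)" "act V (f i)" "act V (co i)"
    using R.sl2_actions[OF split_lie_axioms assms(2)] by simp
  obtain u where u: "u \<in> weight_space L V \<mu>" "u \<noteq> 0" "u \<in> space V" "\<mu> \<in> dual_cartan L"
    using wtD assms(1) by blast
  obtain m where "(act V (e i) ^^ m) u = 0" using e_nilpotent assms(2) u by blast
  then obtain p where p: "(act V (f i) ^^ (n + p)) ((act V (e i) ^^ p) u) \<noteq> 0"
    using sl.reflected_weight_vector u R.weight_spaceD(2)[OF u(1) chevalley(3)] assms by metis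
  have "(act V (f i) ^^ (n + p)) ((act V (e i) ^^ p) u)
      \<in> weight_space L V ((\<mu> + fun_scale (of_nat p) (\<alpha> i)) + fun_scale (of_nat (n + p)) (- \<alpha> i))"
    using R.pow_weight_space chevalley(1,2)[OF assms(2)] u(1) by blast
  also have "(\<mu> + fun_scale (of_nat p) (\<alpha> i)) + fun_scale (of_nat (n + p)) (- \<alpha> i) = \<mu> - fun_scale (of_nat n) (\<alpha> i)"
    by (simp add: fun_eq_iff fun_scale_def algebra_simps)
  finally show ?thesis by (rule wtI[OF _ p dual_diff[OF u(4) dual_scale[OF simple_dual[OF assms(2)]]]])
qed

text \<open>Here the roles of \<open>e i\<close> and \<open>f i\<close> are exchanged, so local
  nilpotency of \<open>f i\<close> is required; it spreads from \<open>v\<close> by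
  \<open>f_nilpotent\<close>.\<close>

lemma wt_reflect_up:
  assumes "\<mu> \<in> wt L V" "i \<in> I" "\<mu> (co i) = - of_nat n" "(act V (f i) ^^ k) v = 0"
  shows "\<mu> + fun_scale (of_nat n) (\<alpha> i) \<in> wt L V"
proof -
  interpret sl: sl2_action "vscaling V" "space V" "act V (f i)" "act V (e i)" "act V (- co i)"
    using R.sl2_actions[OF split_lie_axioms assms(2)] by simp
  obtain u where u: "u \<in> weight_space L V \<mu>" "u \<noteq> 0" "u \<in> space V" "\<mu> \<in> dual_cartan L"
    using wtD assms(1) by blast
  have "act V (- co i) u = vscaling V (of_nat n) u"
    using R.weight_spaceD(2)[OF u(1) chevalley(3)[OF assms(2)]] R.act_scale_left[OF u(3), of "-1" "co i"] assms(3)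
    by simp
  moreover obtain m where "(act V (f i) ^^ m) u = 0" using f_nilpotent assms(2,4) u by blast
  ultimately obtain p where p: "(act V (e i) ^^ (n + p)) ((act V (f i) ^^ p) u) \<noteq> 0"
    using sl.reflected_weight_vector u by blast
  have "(act V (e i) ^^ (n + p)) ((act V (f i) ^^ p) u)
      \<in> weight_space L V ((\<mu> + fun_scale (of_nat p) (- \<alpha> i)) + fun_scale (of_nat (n + p)) (\<alpha> i))"
    using R.pow_weight_space chevalley(1,2)[OF assms(2)] u(1) by blast
  also have "(\<mu> + fun_scale (of_nat p) (- \<alpha> i)) + fun_scale (of_nat (n + p)) (\<alpha> i) = \<mu> + fun_scale (of_nat n) (\<alpha> i)"
    by (simp add: fun_eq_iff fun_scale_def algebra_simps)
  finally show ?thesis by (rule wtI[OF _ p dual_add[OF u(4) dual_scale[OF simple_dual[OF assms(2)]]]])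
qed

text \<open>For a weight vector \<open>u\<close> every vector f_i^(p+1) e_i^p u has weight \<mu> -
  \<alpha>_i and so vanishes, which is the hypothesis of
  \<open>lowest_weight_nonpos\<close>.\<close>

lemma wt_lowest:
  assumes "\<mu> \<in> wt L V" "i \<in> I" "\<mu> - \<alpha> i \<notin> wt L V"
  shows "\<exists>k. \<mu> (co i) = - of_nat k"
proof -
  interpret sl: sl2_action "vscaling V" "space V" "act V (e i)" "act V (f i)" "act V (co i)"
    using R.sl2_actions[OF split_lie_axioms assms(2)] by simp
  obtain u where u: "u \<in> weight_space L V \<mu>" "u \<noteq> 0" "u \<in> space V" "\<mu> \<in> dual_cartan L"
    using wtD assms(1) by blast
  obtain m where m: "(act V (e i) ^^ m) u = 0" using e_nilpotent assms(2) u by blast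
  have low: "(act V (f i) ^^ Suc p) ((act V (e i) ^^ p) u) = 0" for p
  proof (rule ccontr)
    assume nz: "(act V (f i) ^^ Suc p) ((act V (e i) ^^ p) u) \<noteq> 0"
    have "(act V (f i) ^^ Suc p) ((act V (e i) ^^ p) u)
      \<in> weight_space L V ((\<mu> + fun_scale (of_nat p) (\<alpha> i)) + fun_scale (of_nat (Suc p)) (- \<alpha> i))"
      using R.pow_weight_space chevalley(1,2)[OF assms(2)] u(1) by blast
    also have "(\<mu> + fun_scale (of_nat p) (\<alpha> i)) + fun_scale (of_nat (Suc p)) (- \<alpha> i) = \<mu> - \<alpha> i"
      by (simp add: fun_eq_iff fun_scale_def algebra_simps)
    finally show False using nz wtI u(4) assms(2,3) dual_diff simple_dual by blast
  qed
  show ?thesis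
    by (rule sl.lowest_weight_nonpos[OF u(3) R.weight_spaceD(2)[OF u(1) chevalley(3)[OF assms(2)]] u(2) m low])
qed

end

section \<open>Convexity of the set of weights\<close>

lemma diff_left_injD:
  assumes "a - b = a - (c :: 'b :: ab_group_add)"
  shows "b = c"
proof -
  have "a - (a - b) = a - (a - c)" using assms by simp
  then show ?thesis by simp
qed

context hw_module
begin

section \<open>Returning to the highest weight vector, and the largest proper submodule\<close>

abbreviation "Q \<equiv> I - J_weight L lam"
abbreviation "J \<equiv> J_module L lam V v"

text \<open>A complement of the line through \<open>v\<close>; membership in it replaces the
  vanishing of the projection onto the highest weight space.\<close>

definition lower :: "'v set"
  where "lower = R.M.span ((\<lambda>w. fw w v) ` {w. set w \<subseteq> I \<and> w \<noteq> []})"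

lemma lower_subspace: "R.M.subspace lower"
  unfolding lower_def by (rule R.M.subspace_span)

lemma span_words_Nil: "x \<in> R.M.span ((\<lambda>w. fw w v) ` A) \<Longrightarrow> A \<subseteq> {[]} \<Longrightarrow> \<exists>z. x = vscaling V z v"
proof -
  assume x: "x \<in> R.M.span ((\<lambda>w. fw w v) ` A)" and A: "A \<subseteq> {[]}"
  have "(\<lambda>w. fw w v) ` A \<subseteq> {v}" using A by auto
  then have "x \<in> R.M.span {v}" using x R.M.span_mono by blast
  then show ?thesis unfolding R.M.span_singleton by blast
qed

text \<open>Only the empty word has content 0, so the weight space of \<open>lam\<close> is the line
  through \<open>v\<close>, and all other weights need nonempty words.\<close>

lemma weight_vector_cases:
  assumes "x \<in> weight_space L V \<eta>" "\<eta> \<in> dual_cartan L"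
  shows "\<eta> = lam \<and> (\<exists>z. x = vscaling V z v) \<or> x \<in> lower"
proof (cases "\<eta> = lam")
  case True
  have "x \<in> R.M.span ((\<lambda>w. fw w v) ` {w. set w \<subseteq> I})"
    using R.weight_spaceD(1)[OF assms(1)] space_span by blast
  then have "x \<in> R.M.span ((\<lambda>w. fw w v) ` {w \<in> {w. set w \<subseteq> I}. lam - content w = lam})"
    using weight_vector_in_span[OF subset_refl] assms True by blast
  moreover have "{w \<in> {w. set w \<subseteq> I}. lam - content w = lam} \<subseteq> {[]}"
  proof
    fix w assume "w \<in> {w \<in> {w. set w \<subseteq> I}. lam - content w = lam}"
    then have "set w \<subseteq> I" "content w = 0" by (auto simp: diff_eq_eq)
    then show "w \<in> {[]}" using content_eq_zeroD by blast
  qed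
  ultimately show ?thesis using True span_words_Nil by blast
next
  case False
  have "x \<in> R.M.span ((\<lambda>w. fw w v) ` {w. set w \<subseteq> I})"
    using R.weight_spaceD(1)[OF assms(1)] space_span by blast
  then have x: "x \<in> R.M.span ((\<lambda>w. fw w v) ` {w \<in> {w. set w \<subseteq> I}. lam - content w = \<eta>})"
    using weight_vector_in_span[OF subset_refl] assms by blast
  have "{w \<in> {w. set w \<subseteq> I}. lam - content w = \<eta>} \<subseteq> {w. set w \<subseteq> I \<and> w \<noteq> []}"
  proof
    fix w assume w: "w \<in> {w \<in> {w. set w \<subseteq> I}. lam - content w = \<eta>}"
    have "lam - content [] = lam" unfolding content_Nil by (rule diff_zero)
    then show "w \<in> {w. set w \<subseteq> I \<and> w \<noteq> []}" using w False by blast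
  qed
  then have "x \<in> lower" using x unfolding lower_def by (meson R.M.span_mono image_mono subsetD)
  then show ?thesis by blast
qed

lemma v_notin_lower: "v \<notin> lower"
proof
  assume "v \<in> lower"
  then have "v \<in> R.M.span ((\<lambda>w. fw w v) ` {w \<in> {w. set w \<subseteq> I \<and> w \<noteq> []}. lam - content w = lam})"
    unfolding lower_def by (intro weight_vector_in_span v_weight lam) auto
  moreover have "{w \<in> {w. set w \<subseteq> I \<and> w \<noteq> []}. lam - content w = lam} = {}"
    using content_eq_zeroD by (auto simp: diff_eq_eq)
  ultimately have "v \<in> R.M.span {}" by (metis image_empty)
  then show False using v_nonzero by simp
qed

lemma scaled_v_notin_lower: "z \<noteq> 0 \<Longrightarrow> vscaling V z v \<notin> lower"
proof
  assume "z \<noteq> 0" "vscaling V z v \<in> lower"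
  then have "vscaling V (inverse z) (vscaling V z v) \<in> lower"
    using R.M.subspace_scale[OF lower_subspace] by blast
  then show False using v_notin_lower \<open>z \<noteq> 0\<close> by simp
qed

lemma f_lower: "i \<in> I \<Longrightarrow> u \<in> space V \<Longrightarrow> act V (f i) u \<in> lower"
proof (rule stable_span[OF _ lower_subspace])
  assume i: "i \<in> I" and u: "u \<in> space V"
  show "(\<lambda>w. fw w v) ` {w. set w \<subseteq> I} \<subseteq> space V" using fw_closed v_space by blast
  show "u \<in> R.M.span ((\<lambda>w. fw w v) ` {w. set w \<subseteq> I})" using u space_span by blast
  fix s assume "s \<in> (\<lambda>w. fw w v) ` {w. set w \<subseteq> I}"
  then obtain w where "set w \<subseteq> I" "s = fw w v" by blast
  then show "act V (f i) s \<in> lower"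
    unfolding lower_def using i by (intro R.M.span_base image_eqI[of _ _ "i # w"]) auto
qed

lemma cartan_lower:
  assumes h: "h \<in> cartan L" and u: "u \<in> lower"
  shows "act V h u \<in> lower"
proof (rule stable_span[OF _ lower_subspace _ u[unfolded lower_def]])
  show "(\<lambda>w. fw w v) ` {w. set w \<subseteq> I \<and> w \<noteq> []} \<subseteq> space V" using fw_closed v_space by blast
  fix s assume "s \<in> (\<lambda>w. fw w v) ` {w. set w \<subseteq> I \<and> w \<noteq> []}"
  then obtain w where w: "set w \<subseteq> I" "w \<noteq> []" "s = fw w v" by blast
  have "act V h s = vscaling V ((lam - content w) h) s"
    unfolding w(3) using fw_v_weight[OF w(1)] h by (rule R.weight_spaceD(2))
  moreover have "s \<in> lower"
    unfolding lower_def w(3) by (rule R.M.span_base, rule imageI) (use w in blast)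
  ultimately show "act V h s \<in> lower" using R.M.subspace_scale[OF lower_subspace] by simp
qed

text \<open>The largest proper submodule: no raising word leads from \<open>u\<close> to a vector with a component along \<open>v\<close>.\<close>

definition radical :: "'v set"
  where "radical = {u \<in> space V. \<forall>w. set w \<subseteq> I \<longrightarrow> ew w u \<in> lower}"

lemma ew_scale: "u \<in> space V \<Longrightarrow> ew w (vscaling V c u) = vscaling V c (ew w u)"
  by (induction w) (auto simp: R.act_scale ew_closed)

lemma radical_subspace: "R.M.subspace radical"
proof (rule R.M.subspaceI)
  have "ew w 0 = 0" for w by (induction w) auto
  then show "0 \<in> radical"
    using R.M.subspace_0[OF R.space] R.M.subspace_0[OF lower_subspace] by (simp add: radical_def)
qed (use R.space lower_subspace in
  \<open>auto simp: radical_def ew_add ew_scale R.M.subspace_add R.M.subspace_scale\<close>)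

lemma radical_subset: "radical \<subseteq> space V"
  by (auto simp: radical_def)

lemma radical_e: "i \<in> I \<Longrightarrow> u \<in> radical \<Longrightarrow> act V (e i) u \<in> radical"
proof -
  assume i: "i \<in> I" and u: "u \<in> radical"
  have "ew w (act V (e i) u) \<in> lower" if "set w \<subseteq> I" for w
  proof -
    have "ew (w @ [i]) u \<in> lower" using u that i unfolding radical_def by simp
    then show ?thesis by (simp add: ew_append)
  qed
  then show ?thesis using u by (simp add: radical_def R.act_closed)
qed

lemma radical_cartan:
  assumes "h \<in> cartan L" "u \<in> radical"
  shows "act V h u \<in> radical"
proof -
  have u: "u \<in> space V" "\<And>w. set w \<subseteq> I \<Longrightarrow> ew w u \<in> lower" using assms(2) by (auto simp: radical_def)
  have "ew w (act V h u) \<in> lower" if w: "set w \<subseteq> I" for w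
    unfolding act_cartan_ew[OF w u(1) assms(1)]
    using cartan_lower[OF assms(1)] u(2)[OF w] lower_subspace
    by (intro R.M.subspace_diff R.M.subspace_scale) auto
  then show ?thesis using u(1) by (simp add: radical_def R.act_closed)
qed

text \<open>Induction on the raising word from its right end: e_k f_i u = f_i e_k u + [e_k, f_i] u,
  where e_k u is again in the radical and the bracket is 0 or a Cartan element. The empty word is
  covered by \<open>f_lower\<close>.\<close>

lemma radical_f:
  assumes i: "i \<in> I" and u: "u \<in> radical"
  shows "act V (f i) u \<in> radical"
proof -
  have "ew w (act V (f i) u) \<in> lower" if "set w \<subseteq> I" "u \<in> radical" for w u
    using that
  proof (induction w arbitrary: u rule: rev_induct)
    case Nil
    then show ?case using f_lower[OF i] radical_subset by auto
  next
    case (snoc k w)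
    then have k: "k \<in> I" "set w \<subseteq> I" and us: "u \<in> space V" using radical_subset by auto
    have "act V (e k) (act V (f i) u) = act V (f i) (act V (e k) u) + act V (bracket L (e k) (f i)) u"
      using R.act_comm[OF us] .
    then have "ew (w @ [k]) (act V (f i) u) = ew w (act V (f i) (act V (e k) u)) + ew w (act V (bracket L (e k) (f i)) u)"
      using us by (simp add: ew_append ew_add R.act_closed)
    moreover have "ew w (act V (f i) (act V (e k) u)) \<in> lower"
      by (rule snoc.IH[OF k(2) radical_e[OF k(1) snoc.prems(2)]])
    moreover have "act V (bracket L (e k) (f i)) u \<in> radical"
    proof (cases "k = i")
      case True
      then show ?thesis using radical_cartan[OF chevalley(3)[OF i] snoc.prems(2)] i by (simp add: br_e_f)
    next
      case False
      then show ?thesis using us i k R.M.subspace_0[OF radical_subspace] by (simp add: br_e_f)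
    qed
    then have "ew w (act V (bracket L (e k) (f i)) u) \<in> lower" using k(2) by (simp add: radical_def)
    ultimately show ?case using R.M.subspace_add[OF lower_subspace] by simp
  qed
  then show ?thesis using u by (simp add: radical_def R.act_closed)
qed

lemma radical_stable: "u \<in> radical \<Longrightarrow> act V x u \<in> radical"
  by (rule stable_if_generators[OF radical_subspace radical_subset radical_e radical_f radical_cartan])

text \<open>Some raising word leads outside \<open>lower\<close>; the result is a weight vector, so
  it is a multiple of \<open>v\<close>, and comparing weights shows that both words have the same
  content.\<close>

lemma not_radicalE:
  assumes "set w \<subseteq> I" "fw w v \<notin> radical"
  obtains w' z where "set w' \<subseteq> I" "z \<noteq> 0" "ew w' (fw w v) = vscaling V z v" "content w' = content w"
proof -
  obtain w' where w': "set w' \<subseteq> I" "ew w' (fw w v) \<notin> lower"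
    using assms fw_closed[OF v_space] by (auto simp: radical_def)
  let ?\<eta> = "(lam - content w) + content w'"
  have "ew w' (fw w v) \<in> weight_space L V ?\<eta>" by (rule ew_weight[OF w'(1) fw_v_weight[OF assms(1)]])
  moreover have "?\<eta> \<in> dual_cartan L" by (intro dual_add dual_diff lam lc_dual)
  ultimately obtain z where z: "?\<eta> = lam" "ew w' (fw w v) = vscaling V z v"
    using weight_vector_cases w'(2) by blast
  have "z \<noteq> 0" using z(2) w'(2) R.M.subspace_0[OF lower_subspace] by auto
  moreover have "content w' = content w"
    using z(1) by (metis add_diff_cancel_left' diff_add_cancel)
  ultimately show ?thesis using that w'(1) z(2) by blast
qed

text \<open>If \<open>f i\<close> maps \<open>fw w v\<close> into the radical, this vector is
  torsion for \<open>f i\<close> modulo the radical. A raising word takes it to a nonzero multiple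
  of \<open>v\<close> and preserves torsion, so some f_i^m v lies in the radical. But e_i^m brings
  f_i^m v back to a nonzero multiple of \<open>v\<close>, as \<lambda>(h_i) is not natural.\<close>

lemma fw_Q_notin_radical: "set w \<subseteq> Q \<Longrightarrow> fw w v \<notin> radical"
proof (induction w)
  case Nil
  have "v \<notin> radical"
  proof
    assume "v \<in> radical"
    then have "set [] \<subseteq> I \<longrightarrow> ew [] v \<in> lower" unfolding radical_def by blast
    then show False using v_notin_lower by simp
  qed
  then show ?case by simp
next
  case (Cons i w)
  then have i: "i \<in> I" "lam (co i) \<notin> \<nat>" and w: "set w \<subseteq> I" "fw w v \<notin> radical"
    by (auto simp: J_weight_def)
  interpret sl: sl2_action "vscaling V" "space V" "act V (e i)" "act V (f i)" "act V (co i)"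
    using R.sl2_actions[OF split_lie_axioms i(1)] by simp
  show ?case
  proof
    assume "fw (i # w) v \<in> radical"
    then have tor: "(act V (f i) ^^ 1) (fw w v) \<in> radical" by simp
    obtain w' z where w': "set w' \<subseteq> I" "z \<noteq> 0" "ew w' (fw w v) = vscaling V z v"
      by (rule not_radicalE[OF w])
    have "\<exists>m. (act V (f i) ^^ m) (ew u (fw w v)) \<in> radical" for u
    proof (induction u)
      case Nil
      then show ?case using tor by (metis ew_simps(1))
    next
      case (Cons k u)
      then obtain m where "(act V (f i) ^^ m) (ew u (fw w v)) \<in> radical" by blast
      then show ?case
        using R.torsion_stable[OF radical_subspace radical_subset radical_stable ad_f_nilpotent[OF i(1)]
            ew_closed[OF fw_closed[OF v_space]]] by (simp only: ew_simps)
    qed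
    then obtain m where "(act V (f i) ^^ m) (vscaling V z v) \<in> radical" unfolding w'(3)[symmetric] by blast
    then have "vscaling V z ((act V (f i) ^^ m) v) \<in> radical" by (simp add: R.act_pow_scale v_space)
    then have "vscaling V (inverse z) (vscaling V z ((act V (f i) ^^ m) v)) \<in> radical"
      by (rule R.M.subspace_scale[OF radical_subspace])
    then have "(act V (f i) ^^ m) v \<in> radical" using w'(2) by simp
    then have "ew (replicate m i) ((act V (f i) ^^ m) v) \<in> lower"
      using i(1) unfolding radical_def by (simp add: set_replicate_conv_if)
    moreover obtain z' where "z' \<noteq> 0" "(act V (e i) ^^ m) ((act V (f i) ^^ m) v) = vscaling V z' v"
      using sl.e_pow_f_pow[OF v_space v_cartan[OF chevalley(3)[OF i(1)]] v_e[OF i(1)] i(2)] by blast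
    ultimately show False using scaled_v_notin_lower by (simp add: ew_replicate)
  qed
qed

text \<open>Raising operators for nodes in \<open>Q\<close> commute with \<open>f j\<close> for \<open>j \<notin> Q\<close>; this propagates the
  nonvanishing of the powers of \<open>f j\<close>.\<close>

lemma f_pow_fw_Q_nonzero:
  assumes w: "set w \<subseteq> Q" and j: "j \<in> I" "j \<notin> Q" and nz: "(act V (f j) ^^ a) v \<noteq> 0"
  shows "(act V (f j) ^^ a) (fw w v) \<noteq> 0"
proof
  assume zero: "(act V (f j) ^^ a) (fw w v) = 0"
  have wI: "set w \<subseteq> I" using w by blast
  obtain w' z where w': "set w' \<subseteq> I" "z \<noteq> 0" "ew w' (fw w v) = vscaling V z v" "content w' = content w"
    by (rule not_radicalE[OF wI fw_Q_notin_radical[OF w]])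
  \<comment> \<open>Equal contents mean equal letter counts, so \<open>j\<close> is missing from the
    raising word because it is missing from \<open>w\<close>.\<close>
  have "(of_nat (count_list w' j) :: complex) = of_nat (count_list w j)"
    using w'(4) j(1) by (rule lc_inj)
  then have "count_list w' j = count_list w j" by (simp only: of_nat_eq_iff)
  moreover have "count_list w j = 0" using w j(2) by (meson count_notin subsetD)
  ultimately have jw': "j \<notin> set w'" using count_list_0_iff[of w' j] by simp
  have comm: "act V (e k) ((act V (f j) ^^ a) u) = (act V (f j) ^^ a) (act V (e k) u)"
    if "k \<in> I" "k \<noteq> j" "u \<in> space V" for k u
  proof (induction a)
    case (Suc a)
    have "act V (e k) (act V (f j) ((act V (f j) ^^ a) u)) = act V (f j) (act V (e k) ((act V (f j) ^^ a) u))"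
      using R.act_comm[OF R.act_pow_closed[OF that(3), where x = "f j" and k = a], of "e k" "f j"] that j(1)
      by (simp add: br_e_f R.act_pow_closed)
    then show ?case using Suc by simp
  qed simp
  have "ew u ((act V (f j) ^^ a) (fw w v)) = (act V (f j) ^^ a) (ew u (fw w v))" if "set u \<subseteq> I - {j}" for u
    using that
  proof (induction u)
    case (Cons k u)
    then show ?case using comm[of k "ew u (fw w v)"] by (simp add: ew_closed fw_closed v_space)
  qed simp
  then have "ew w' ((act V (f j) ^^ a) (fw w v)) = vscaling V z ((act V (f j) ^^ a) v)"
  proof -
    assume *: "\<And>u. set u \<subseteq> I - {j} \<Longrightarrow> ew u ((act V (f j) ^^ a) (fw w v)) = (act V (f j) ^^ a) (ew u (fw w v))"
    have "set w' \<subseteq> I - {j}" using w'(1) jw' by blast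
    then show ?thesis by (simp only: * w'(3) R.act_pow_scale[OF v_space])
  qed
  moreover have "ew w' 0 = 0" by (induction w') auto
  ultimately show False using zero nz w'(2) by simp
qed

section \<open>Lattice points of the hull when at most one node is missing\<close>

lemma J_subset: "J \<subseteq> I"
  by (auto simp: J_module_def J_weight_def)

lemma J_D:
  assumes "j \<in> J"
  shows "\<exists>k. (act V (f j) ^^ k) v = 0" "\<exists>n. lam (co j) = of_nat n"
  using assms unfolding J_module_def by blast+

text \<open>Not being in \<open>J\<close> only says that the power \<lambda>(h_j) + 1 survives;
  sl2-theory extends this to all powers.\<close>

lemma f_pow_v_nonzero:
  assumes "j \<in> J_weight L lam" "j \<notin> J"
  shows "(act V (f j) ^^ a) v \<noteq> 0"
proof -
  have j: "j \<in> I" using assms(1) by (simp add: J_weight_def)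
  interpret sl: sl2_action "vscaling V" "space V" "act V (e j)" "act V (f j)" "act V (co j)"
    using R.sl2_actions[OF split_lie_axioms j] by simp
  obtain n where n: "lam (co j) = of_nat n" using assms(1) unfolding J_weight_def Nats_def by blast
  have nz: "(act V (f j) ^^ Suc n) v \<noteq> 0" using assms n unfolding J_module_def by auto
  have "act V (co j) v = vscaling V (of_nat n) v" using v_cartan[OF chevalley(3)[OF j]] n by simp
  from sl.f_pow_nonzero[OF v_space this v_e[OF j] nz] show ?thesis .
qed

text \<open>Start from the part of \<open>c\<close> outside \<open>J\<close> and enlarge the
  coefficients at \<open>J\<close> as far as possible below \<open>c\<close>. If the maximal
  \<open>k\<close> is not \<open>c\<close>, positivity for d = c - k yields \<open>j\<close> in
  \<open>J\<close> at which \<open>d\<close> pairs positively with h_j. Dominance of the target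
  makes the weight at \<open>k\<close> positive on h_j, so \<open>wt_lowest\<close> allows one more
  \<alpha>_j to be subtracted.\<close>

lemma dominant_weight:
  assumes card: "card (J_weight L lam - J) \<le> 1"
    and dom: "\<And>j. j \<in> J \<Longrightarrow> \<exists>n. (lam - lc (\<lambda>i. of_nat (c i))) (co j) = of_nat n"
  shows "lam - lc (\<lambda>i. of_nat (c i)) \<in> wt L V"
proof -
  have JI: "J_weight L lam \<subseteq> I" by (auto simp: J_weight_def)
  have fin: "finite (J_weight L lam - J)" using finite_nodes JI by (meson finite_Diff finite_subset)
  define wtn where "wtn = (\<lambda>k :: 'i \<Rightarrow> nat. lam - lc (\<lambda>i. of_nat (k i)))"
  have base: "wtn (\<lambda>i. if i \<in> I - J then c i else 0) \<in> wt L V"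
  proof -
    obtain w where w: "set w \<subseteq> Q" "\<forall>i\<in>Q. count_list w i = c i"
      using ex_list_count[of Q c] finite_nodes by auto
    have wI: "set w \<subseteq> I" using w(1) by blast
    have cnt0: "count_list w i = 0" if "i \<notin> Q" for i using w(1) that by (meson count_notin subsetD)
    show ?thesis
    proof (cases "J_weight L lam - J = {}")
      case True
      then have Q: "I - J = Q" using JI by (auto simp: J_module_def)
      have "fw w v \<noteq> 0"
        using fw_Q_notin_radical[OF w(1)] R.M.subspace_0[OF radical_subspace] by auto
      moreover have "content w = lc (\<lambda>i. of_nat (if i \<in> I - J then c i else 0))"
        by (rule lc_cong) (use w(2) cnt0 Q in auto)
      ultimately show ?thesis unfolding wtn_def wt_iff using wI by metis
    next
      case False
      then have "card (J_weight L lam - J) = 1" using card fin by (metis One_nat_def card_0_eq le_SucE le_zero_eq)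
      then obtain j where j: "J_weight L lam - J = {j}" by (auto simp: card_1_singleton_iff)
      then have jI: "j \<in> I" "j \<in> J_weight L lam" "j \<notin> J" "j \<notin> Q" using JI by auto
      have IJ: "I - J = insert j Q" using j JI by (auto simp: J_module_def)
      let ?w = "replicate (c j) j @ w"
      \<comment> \<open>The one missing node \<open>j\<close> may be added with any multiplicity.
        With a second missing node the nonvanishing of mixed powers would be needed, and this fails
        in general.\<close>
      have "fw ?w v \<noteq> 0"
        using f_pow_fw_Q_nonzero[OF w(1) jI(1,4) f_pow_v_nonzero[OF jI(2,3)]]
        by (simp add: fw_append fw_replicate)
      moreover have "content ?w = lc (\<lambda>i. of_nat (if i \<in> I - J then c i else 0))"
      proof (rule lc_cong)
        fix i
        have "count_list (replicate n j) i = (if i = j then n else 0)" for n by (induction n) auto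
        then have "count_list ?w i = (if i \<in> I - J then c i else 0)"
          unfolding IJ using w(2) cnt0 jI(4) by auto
        then show "of_nat (count_list ?w i) = (of_nat (if i \<in> I - J then c i else 0) :: complex)" by simp
      qed
      moreover have "set ?w \<subseteq> I" using wI jI(1) by auto
      ultimately show ?thesis unfolding wtn_def wt_iff by metis
    qed
  qed
  define P where "P = (\<lambda>k. (\<forall>i\<in>I. k i \<le> c i) \<and> (\<forall>i\<in>I - J. k i = c i) \<and> wtn k \<in> wt L V)"
  have "P (\<lambda>i. if i \<in> I - J then c i else 0)" using base by (simp add: P_def)
  moreover have "\<forall>k. P k \<longrightarrow> sum k I < Suc (sum c I)"
    by (auto simp: P_def less_Suc_eq_le intro!: sum_mono)
  ultimately obtain k where k: "P k" and max: "\<And>k'. P k' \<Longrightarrow> sum k' I \<le> sum k I"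
    using ex_has_greatest_nat[of P _ "\<lambda>k. sum k I" "Suc (sum c I)"] by blast
  have kle: "k i \<le> c i" if "i \<in> I" for i using k that by (simp add: P_def)
  define S where "S = {i \<in> I. k i < c i}"
  have "k i = c i" if "i \<in> I" "i \<notin> J" for i using k that unfolding P_def by blast
  then have S: "S \<subseteq> I" "S \<subseteq> J" by (auto simp: S_def) (metis less_irrefl)
  have finS: "finite S" using S(1) finite_nodes by (rule finite_subset)
  have "S = {}"
  proof (rule ccontr)
    assume "S \<noteq> {}"
    define d where "d = (\<lambda>i. c i - k i)"
    have dpos: "real (d i) > 0" if "i \<in> S" for i using that by (simp add: S_def d_def)
    have "\<exists>j\<in>S. (\<Sum>i\<in>S. of_int (cm j i) * real (d i)) > 0"
      by (rule cartan_matrix_positive[OF S(1) \<open>S \<noteq> {}\<close> dpos])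
    then obtain j where j: "j \<in> S" and pos: "(\<Sum>i\<in>S. of_int (cm j i) * real (d i)) > 0"
      by (elim bexE)
    have jI: "j \<in> I" "j \<in> J" using j S by auto
    define k' where "k' = (\<lambda>i. k i + (if i = j then 1 else 0))"
    have "sum k' I = sum k I + 1" using jI finite_nodes by (simp add: k'_def sum.distrib)
    then have "\<not> P k'" using max[of k'] by auto
    moreover have "\<forall>i\<in>I. k' i \<le> c i" using kle j by (auto simp: k'_def S_def)
    moreover have "\<forall>i\<in>I - J. k' i = c i" using k jI(2) by (auto simp: k'_def P_def)
    moreover have "wtn k' = wtn k - \<alpha> j"
    proof -
      have "lc (\<lambda>i. of_nat (k' i)) = lc (\<lambda>i. of_nat (k i) + (if i = j then 1 else 0))"
        by (rule lc_cong) (simp add: k'_def)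
      also have "\<dots> = lc (\<lambda>i. of_nat (k i)) + \<alpha> j"
        using lc_single[OF jI(1), of 1] by (simp add: lc_add fun_scale_def)
      finally show ?thesis by (simp only: wtn_def diff_diff_eq)
    qed
    ultimately have "wtn k - \<alpha> j \<notin> wt L V" by (auto simp: P_def)
    moreover have "wtn k \<in> wt L V" using k by (simp add: P_def)
    ultimately obtain a where a: "wtn k (co j) = - of_nat a" using wt_lowest jI(1) by blast
    obtain n where n: "wtn c (co j) = of_nat n" using dom[OF jI(2)] by (auto simp: wtn_def)
    have "lc (\<lambda>i. of_int (int (d i))) = lc (\<lambda>i. of_nat (c i) - of_nat (k i))"
      by (rule lc_cong) (use kle in \<open>simp add: d_def of_nat_diff\<close>)
    then have "lc (\<lambda>i. of_int (int (d i))) (co j) = wtn k (co j) - wtn c (co j)"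
      by (simp add: lc_diff wtn_def)
    \<comment> \<open>The pairing of \<open>d\<close> with h_j is the value at \<open>k\<close>
      minus the value at \<open>c\<close>, that is - a - n \<le> 0, against the choice of
      \<open>j\<close>.\<close>
    then have "of_int (\<Sum>i\<in>I. cm j i * int (d i)) = (of_int (- int a - int n) :: complex)"
      unfolding lc_co[OF jI(1)] a n by simp
    then have "(\<Sum>i\<in>I. cm j i * int (d i)) \<le> 0" unfolding of_int_eq_iff by simp
    moreover have "(\<Sum>i\<in>I. cm j i * int (d i)) = (\<Sum>i\<in>S. cm j i * int (d i))"
    proof (rule sum.mono_neutral_right[OF finite_nodes S(1)])
      have "d i = 0" if "i \<in> I - S" for i using that kle[of i] by (auto simp: S_def d_def)
      then show "\<forall>i\<in>I - S. cm j i * int (d i) = 0" by simp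
    qed
    ultimately have "real_of_int (\<Sum>i\<in>S. cm j i * int (d i)) \<le> 0" by (simp only: of_int_le_0_iff)
    then show False using pos by simp
  qed
  then have "lc (\<lambda>i. of_nat (k i)) = lc (\<lambda>i. of_nat (c i))"
    using kle by (intro lc_cong) (force simp: S_def)
  then show ?thesis using k by (simp add: P_def wtn_def)
qed

text \<open>The cone on the right is convex and contains all weights; it is what keeps coordinates
  nonnegative after a reflection.\<close>

lemma conv_wt_coords:
  assumes "\<mu> \<in> convex hull (wt L V)"
  shows "\<exists>r :: 'i \<Rightarrow> real. (\<forall>i\<in>I. r i \<ge> 0) \<and> \<mu> = lam - lc (\<lambda>i. of_real (r i))"
proof -
  let ?C = "{lam - lc (\<lambda>i. of_real (r i)) | r :: 'i \<Rightarrow> real. \<forall>i\<in>I. r i \<ge> 0}"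
  have "convex ?C"
  proof (rule convexI)
    fix x y u w assume "x \<in> ?C" "y \<in> ?C" and uw: "0 \<le> u" "0 \<le> w" "u + w = (1::real)"
    then obtain r s where rs: "x = lam - lc (\<lambda>i. of_real (r i))" "y = lam - lc (\<lambda>i. of_real (s i))"
      "\<forall>i\<in>I. r i \<ge> 0" "\<forall>i\<in>I. s i \<ge> (0::real)" by blast
    have "u *\<^sub>R x + w *\<^sub>R y = lam - lc (\<lambda>i. of_real (u * r i + w * s i))"
    proof
      fix h
      have "u *\<^sub>R lam h + w *\<^sub>R lam h = lam h" using uw(3) by (metis scaleR_left_distrib scaleR_one)
      then show "(u *\<^sub>R x + w *\<^sub>R y) h = (lam - lc (\<lambda>i. of_real (u * r i + w * s i))) h"
        unfolding rs(1,2)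
        by (simp add: scaleR_fun_def lc_apply scaleR_right_diff_distrib scaleR_sum_right
            sum.distrib ring_distribs scaleR_conv_of_real sum_distrib_left mult.assoc)
    qed
    moreover have "\<forall>i\<in>I. u * r i + w * s i \<ge> 0" using rs(3,4) uw by auto
    ultimately show "u *\<^sub>R x + w *\<^sub>R y \<in> ?C"
      by (intro CollectI exI[of _ "\<lambda>i. u * r i + w * s i"] conjI)
  qed
  moreover have "wt L V \<subseteq> ?C"
  proof
    fix \<mu> assume "\<mu> \<in> wt L V"
    then obtain w where "\<mu> = lam - content w" unfolding wt_iff by blast
    then have "\<mu> = lam - lc (\<lambda>i. of_real (real (count_list w i)))" by simp
    then show "\<mu> \<in> ?C" by (intro CollectI exI[of _ "\<lambda>i. real (count_list w i)"]) simp
  qed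
  ultimately have "convex hull (wt L V) \<subseteq> ?C" by (rule hull_minimal[rotated])
  then show ?thesis using assms by blast
qed

text \<open>The reflection at a node of \<open>J\<close> is real-linear and maps weights to weights,
  downwards by \<open>wt_reflect_down\<close> and upwards by \<open>wt_reflect_up\<close>; hence it
  maps the hull into itself.\<close>

lemma conv_wt_reflect:
  assumes j: "j \<in> J" and \<mu>: "\<mu> \<in> convex hull (wt L V)"
  shows "\<mu> - fun_scale (\<mu> (co j)) (\<alpha> j) \<in> convex hull (wt L V)"
proof -
  define T where "T = (\<lambda>\<mu> :: 'g \<Rightarrow> complex. \<mu> - fun_scale (\<mu> (co j)) (\<alpha> j))"
  have jI: "j \<in> I" using j J_subset by blast
  have "linear T"
    by (rule linearI)
      (auto simp: T_def fun_eq_iff fun_scale_def scaleR_fun_def ring_distribs scaleR_conv_of_real)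
  have "T \<mu> \<in> wt L V" if \<mu>: "\<mu> \<in> wt L V" for \<mu>
  proof -
    obtain w where w: "\<mu> = lam - content w" using \<mu> unfolding wt_iff by blast
    obtain n where n: "lam (co j) = of_nat n" using J_D(2)[OF j] by blast
    have "content w = lc (\<lambda>i. of_int (int (count_list w i)))" by simp
    then have "\<mu> (co j) = of_int (int n - (\<Sum>i\<in>I. cm j i * int (count_list w i)))"
      unfolding w using lc_co[OF jI, of "\<lambda>i. int (count_list w i)"] n by simp
    then obtain z where z: "\<mu> (co j) = of_int z" by blast
    show ?thesis
    proof (cases z rule: int_cases2)
      case (nonneg n)
      then show ?thesis using wt_reflect_down[OF \<mu> jI, of n] z by (simp add: T_def)
    next
      case (nonpos n)
      obtain k where "(act V (f j) ^^ k) v = 0" using J_D(1)[OF j] by blast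
      moreover have "T \<mu> = \<mu> + fun_scale (of_nat n) (\<alpha> j)"
        using z nonpos by (simp add: T_def fun_eq_iff fun_scale_def)
      ultimately show ?thesis using wt_reflect_up[OF \<mu> jI, of n] z nonpos by simp
    qed
  qed
  then have "T ` wt L V \<subseteq> wt L V" by blast
  then have "convex hull (T ` wt L V) \<subseteq> convex hull (wt L V)" by (rule hull_mono)
  then have "T \<mu> \<in> convex hull (wt L V)"
    using \<mu> convex_hull_linear_image[OF \<open>linear T\<close>, of "wt L V"] by blast
  then show ?thesis by (simp add: T_def)
qed

text \<open>Induction on height. A point that is not dominant at some \<open>j\<close> in
  \<open>J\<close> is reflected there, which lowers the coefficient at \<open>j\<close> and stays in
  the hull. The reflected point is a weight by induction, and reflecting back down recovers the
  original one.\<close>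

lemma lattice_conv_in_wt:
  assumes card: "card (J_weight L lam - J) \<le> 1"
    and conv: "lam - lc (\<lambda>i. of_nat (c i)) \<in> convex hull (wt L V)"
  shows "lam - lc (\<lambda>i. of_nat (c i)) \<in> wt L V"
  using conv
proof (induction "sum c I" arbitrary: c rule: less_induct)
  case less
  define \<mu> where "\<mu> = lam - lc (\<lambda>i. of_nat (c i))"
  show ?case
  proof (cases "\<forall>j\<in>J. \<exists>n. \<mu> (co j) = of_nat n")
    case True
    then show ?thesis using dominant_weight[OF card, of c] by (simp add: \<mu>_def)
  next
    case False
    then obtain j where j: "j \<in> J" "\<nexists>n. \<mu> (co j) = of_nat n" by blast
    have jI: "j \<in> I" using j J_subset by blast
    obtain n where n: "lam (co j) = of_nat n" using J_D(2)[OF j(1)] by blast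
    have "lc (\<lambda>i. of_nat (c i)) = lc (\<lambda>i. of_int (int (c i)))" by simp
    then have "\<mu> (co j) = of_int (int n - (\<Sum>i\<in>I. cm j i * int (c i)))"
      unfolding \<mu>_def using lc_co[OF jI, of "\<lambda>i. int (c i)"] n by simp
    then obtain z where z: "\<mu> (co j) = of_int z" by blast
    then obtain m where m: "z = - int m" "m > 0"
      using j(2) by (metis gr0I int_cases2 minus_zero of_int_of_nat_eq of_nat_0)
    define r where "r = (\<lambda>i. int (c i) - (if i = j then int m else 0))"
    have refl: "\<mu> - fun_scale (\<mu> (co j)) (\<alpha> j) = lam - lc (\<lambda>i. of_int (r i))"
    proof -
      have "lc (\<lambda>i. of_int (r i)) = lc (\<lambda>i. of_nat (c i) - (if i = j then of_nat m else 0))"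
        by (rule lc_cong) (simp add: r_def)
      also have "\<dots> = lc (\<lambda>i. of_nat (c i)) - fun_scale (of_nat m) (\<alpha> j)"
        by (simp only: lc_diff lc_single[OF jI])
      finally show ?thesis using z m(1) by (simp add: \<mu>_def fun_eq_iff fun_scale_def)
    qed
    have conv': "lam - lc (\<lambda>i. of_int (r i)) \<in> convex hull (wt L V)"
      using conv_wt_reflect[OF j(1), of \<mu>] less.prems unfolding refl[symmetric] by (simp add: \<mu>_def)
    \<comment> \<open>The reflected coordinate could a priori be negative; lying in the hull
      excludes this, so natural coefficients are available again.\<close>
    then obtain s :: "'i \<Rightarrow> real" where s: "\<forall>i\<in>I. s i \<ge> 0" "lam - lc (\<lambda>i. of_int (r i)) = lam - lc (\<lambda>i. of_real (s i))"
      using conv_wt_coords by blast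
    have "lc (\<lambda>i. of_int (r i)) = lc (\<lambda>i. of_real (s i))"
      using s(2) by (rule diff_left_injD)
    then have "(of_int (r j) :: complex) = of_real (s j)" using jI by (rule lc_inj)
    then have "real_of_int (r j) = s j" by (metis of_real_eq_iff of_real_of_int_eq)
    then have "r j \<ge> 0" using s(1) jI by (metis of_int_0_le_iff)
    then have le: "m \<le> c j" by (simp add: r_def)
    define c' where "c' = c(j := c j - m)"
    have r: "of_int (r i) = (of_nat (c' i) :: complex)" for i using le by (simp add: r_def c'_def of_nat_diff)
    have "sum c' I < sum c I"
      using finite_nodes jI le m(2) by (intro sum_strict_mono_ex1) (auto simp: c'_def intro!: bexI[of _ j])
    then have IH: "lam - lc (\<lambda>i. of_nat (c' i)) \<in> wt L V"
      using less.hyps[of c'] conv' unfolding r by blast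
    have eq: "lam - lc (\<lambda>i. of_nat (c' i)) = \<mu> + fun_scale (of_nat m) (\<alpha> j)"
      using refl unfolding r z m(1) by (simp add: fun_eq_iff fun_scale_def)
    have "(lam - lc (\<lambda>i. of_nat (c' i))) (co j) = of_nat m"
      unfolding eq using z m(1) chevalley(4)[OF jI] by (simp add: fun_scale_def)
    then have "(lam - lc (\<lambda>i. of_nat (c' i))) - fun_scale (of_nat m) (\<alpha> j) \<in> wt L V"
      by (rule wt_reflect_down[OF IH jI])
    then show ?thesis unfolding eq by (simp add: \<mu>_def)
  qed
qed

lemma root_lattice_eq: "root_lattice L = {lc (\<lambda>i. of_int (k i)) | k. True}"
  by (simp add: root_lattice_def lc_def)

lemma wt_convex_if_card_le_1:
  assumes "card (J_weight L lam - J) \<le> 1"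
  shows "wt_convex L lam V"
  unfolding wt_convex_def
proof (intro equalityI subsetI)
  fix \<mu> assume \<mu>: "\<mu> \<in> wt L V"
  then obtain w where w: "\<mu> = lam - content w" unfolding wt_iff by blast
  have "content w = lc (\<lambda>i. of_int (int (count_list w i)))" by simp
  then have "content w \<in> root_lattice L"
    unfolding root_lattice_eq by (intro CollectI exI[of _ "\<lambda>i. int (count_list w i)"] conjI TrueI)
  then show "\<mu> \<in> {lam - \<gamma> |\<gamma>. \<gamma> \<in> root_lattice L} \<inter> convex hull wt L V"
    using w hull_inc[OF \<mu>] by blast
next
  fix \<mu> assume "\<mu> \<in> {lam - \<gamma> |\<gamma>. \<gamma> \<in> root_lattice L} \<inter> convex hull wt L V"
  then obtain k where k: "\<mu> = lam - lc (\<lambda>i. of_int (k i))" and conv: "\<mu> \<in> convex hull wt L V"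
    unfolding root_lattice_eq by blast
  obtain s :: "'i \<Rightarrow> real" where s: "\<forall>i\<in>I. s i \<ge> 0" "\<mu> = lam - lc (\<lambda>i. of_real (s i))"
    using conv_wt_coords[OF conv] by blast
  have "lc (\<lambda>i. of_int (k i)) = lc (\<lambda>i. of_real (s i))"
    using s(2) unfolding k by (rule diff_left_injD)
  then have "(of_int (k i) :: complex) = of_real (s i)" if "i \<in> I" for i using that by (rule lc_inj)
  then have "real_of_int (k i) = s i" if "i \<in> I" for i using that by (metis of_real_eq_iff of_real_of_int_eq)
  then have "k i \<ge> 0" if "i \<in> I" for i using s(1) that by (metis of_int_0_le_iff)
  then have "lc (\<lambda>i. of_int (k i)) = lc (\<lambda>i. of_nat (nat (k i)))"
    by (intro lc_cong) simp
  then show "\<mu> \<in> wt L V" using lattice_conv_in_wt[OF assms, of "\<lambda>i. nat (k i)"] conv k by simp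
qed

end

section \<open>Quotients of Verma modules\<close>

interpretation WS: vector_space words_scale
  by (rule vector_space_words_scale)

interpretation WW: vector_space_pair "words_scale :: complex \<Rightarrow> 'a words \<Rightarrow> 'a words"
    "words_scale :: complex \<Rightarrow> 'b words \<Rightarrow> 'b words" ..

abbreviation lin :: "('a words \<Rightarrow> 'b words) \<Rightarrow> bool"
  where "lin \<equiv> Vector_Spaces.linear words_scale words_scale"

lemma linI: "(\<And>x y. f (x + y) = f x + f y) \<Longrightarrow> (\<And>c x. f (words_scale c x) = words_scale c (f x)) \<Longrightarrow> lin f"
  unfolding Vector_Spaces.linear_iff by (intro conjI allI vector_space_words_scale)

lemma linD:
  assumes "lin f"
  shows "f (x + y) = f x + f y" "f (x - y) = f x - f y" "f (words_scale c x) = words_scale c (f x)" "f 0 = 0"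
    "f (sum g A) = (\<Sum>a\<in>A. f (g a))"
  using assms by (simp_all add: WW.linear_add WW.linear_diff WW.linear_scale WW.linear_0 WW.linear_sum)

definition lin_ext :: "('a list \<Rightarrow> 'b words) \<Rightarrow> 'a words \<Rightarrow> 'b words"
  where "lin_ext g p = (\<Sum>w\<in>Poly_Mapping.keys p. words_scale (Poly_Mapping.lookup p w) (g w))"

lemma lin_ext_superset:
  assumes "finite A" "Poly_Mapping.keys p \<subseteq> A"
  shows "lin_ext g p = (\<Sum>w\<in>A. words_scale (Poly_Mapping.lookup p w) (g w))"
  unfolding lin_ext_def using assms by (intro sum.mono_neutral_left) (auto simp: in_keys_iff)

lemma lin_lin_ext: "lin (lin_ext g)"
proof (rule linI)
  fix x y :: "'a words" and c
  let ?A = "Poly_Mapping.keys x \<union> Poly_Mapping.keys y"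
  have "Poly_Mapping.keys (x + y) \<subseteq> ?A" by (rule keys_add)
  then have "lin_ext g (x + y) = (\<Sum>w\<in>?A. words_scale (Poly_Mapping.lookup (x + y) w) (g w))"
    by (intro lin_ext_superset) auto
  also have "\<dots> = (\<Sum>w\<in>?A. words_scale (Poly_Mapping.lookup x w) (g w)) + (\<Sum>w\<in>?A. words_scale (Poly_Mapping.lookup y w) (g w))"
    by (simp add: lookup_add WS.scale_left_distrib sum.distrib)
  also have "\<dots> = lin_ext g x + lin_ext g y"
    using lin_ext_superset[of ?A x g] lin_ext_superset[of ?A y g] by simp
  finally show "lin_ext g (x + y) = lin_ext g x + lin_ext g y" .
  have "Poly_Mapping.keys (words_scale c x) \<subseteq> Poly_Mapping.keys x"
    by (auto simp: in_keys_iff words_scale_lookup)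
  then have "lin_ext g (words_scale c x) = (\<Sum>w\<in>Poly_Mapping.keys x. words_scale (Poly_Mapping.lookup (words_scale c x) w) (g w))"
    by (intro lin_ext_superset) auto
  then show "lin_ext g (words_scale c x) = words_scale c (lin_ext g x)"
    by (simp add: lin_ext_def words_scale_lookup WS.scale_sum_right)
qed

lemma lin_ext_word [simp]: "lin_ext g (word w) = g w"
  by (simp add: lin_ext_def word_def)

lemma left_mult_eq_lin_ext: "left_mult x = lin_ext (\<lambda>w. word (x # w))"
proof -
  have "Poly_Mapping.single w c = words_scale c (word w)" for w :: "'a list" and c
    by (rule poly_mapping_eqI) (simp add: words_scale_lookup word_def lookup_single when_def)
  then show ?thesis by (simp add: fun_eq_iff left_mult_def lin_ext_def)
qed

lemma lin_left_mult: "lin (left_mult x)"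
  unfolding left_mult_eq_lin_ext by (rule lin_lin_ext)

lemma word_span_induct [consumes 1, case_names word add scale zero]:
  assumes p: "\<And>w. w \<in> Poly_Mapping.keys p \<Longrightarrow> w \<in> A"
    and "\<And>w. w \<in> A \<Longrightarrow> P (word w)" "\<And>x y. P x \<Longrightarrow> P y \<Longrightarrow> P (x + y)" "\<And>c x. P x \<Longrightarrow> P (words_scale c x)" "P 0"
  shows "P p"
proof -
  have "P (\<Sum>w\<in>B. words_scale (Poly_Mapping.lookup p w) (word w))" if "finite B" "B \<subseteq> A" for B
    using that by (induction B) (auto simp: assms)
  then show ?thesis using words_expand[of p] p by (metis finite_keys subsetI)
qed

lemma lin_eqI:
  assumes "lin f" "lin g" "\<And>w. f (word w) = g (word w)"
  shows "f p = g p"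
  by (rule word_span_induct[of p UNIV]) (auto simp: assms linD[OF assms(1)] linD[OF assms(2)])

lemma lookup_left_mult:
  "Poly_Mapping.lookup (left_mult x p) [] = 0"
  "Poly_Mapping.lookup (left_mult x p) (y # w) = (if x = y then Poly_Mapping.lookup p w else 0)"
proof -
  have "Poly_Mapping.lookup (left_mult x p) u = (\<Sum>w\<in>Poly_Mapping.keys p. if x # w = u then Poly_Mapping.lookup p w else 0)" for u
    unfolding left_mult_def lookup_sum by (rule sum.cong) (auto simp: lookup_single when_def)
  note l = this
  show "Poly_Mapping.lookup (left_mult x p) [] = 0" unfolding l by simp
  show "Poly_Mapping.lookup (left_mult x p) (y # w) = (if x = y then Poly_Mapping.lookup p w else 0)"
    unfolding l by (auto simp: in_keys_iff if_distrib cong: if_cong intro!: sum.neutral)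
qed

text \<open>Extend a basis of \<open>N\<close> to the whole space and send its elements in
  \<open>N\<close> to 0. The range of the resulting map represents the quotient by \<open>N\<close>
  inside the same type.\<close>

lemma ex_projection_with_kernel:
  fixes N :: "'a words set"
  assumes N: "WS.subspace N"
  shows "\<exists>\<pi> :: 'a words \<Rightarrow> 'a words. lin \<pi> \<and> (\<forall>p\<in>N. \<pi> p = 0) \<and> (\<forall>p. \<pi> p - p \<in> N)"
proof -
  obtain B where B: "B \<subseteq> N" "\<not> WS.dependent B" "N \<subseteq> WS.span B"
    using WS.maximal_independent_subset[of N] by blast
  define B' where "B' = WS.extend_basis B"
  have B': "B \<subseteq> B'" "\<not> WS.dependent B'" "WS.span B' = UNIV"
    unfolding B'_def
    using WS.extend_basis_superset[OF B(2)] WS.independent_extend_basis[OF B(2)] WS.span_extend_basis[OF B(2)] by auto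
  obtain \<pi> where \<pi>: "\<forall>b\<in>B'. \<pi> b = (if b \<in> B then 0 else b)" "lin \<pi>"
    using WW.linear_independent_extend[OF B'(2), of "\<lambda>b. if b \<in> B then 0 else b"] by blast
  have "WS.subspace {p. \<pi> p = 0}"
    by (rule WS.subspaceI) (auto simp: linD[OF \<pi>(2)])
  then have "WS.span B \<subseteq> {p. \<pi> p = 0}"
    using \<pi>(1) B'(1) by (intro WS.span_minimal) auto
  then have "\<forall>p\<in>N. \<pi> p = 0" using B(3) by blast
  moreover have "WS.subspace {p. \<pi> p - p \<in> N}"
  proof (rule WS.subspaceI)
    show "0 \<in> {p. \<pi> p - p \<in> N}" using WS.subspace_0[OF N] by (simp add: linD[OF \<pi>(2)])
    fix x y c assume "x \<in> {p. \<pi> p - p \<in> N}"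
    then have x: "\<pi> x - x \<in> N" by simp
    show "words_scale c x \<in> {p. \<pi> p - p \<in> N}"
      using WS.subspace_scale[OF N x, of c] by (simp add: linD[OF \<pi>(2)] WS.scale_right_diff_distrib)
    assume "y \<in> {p. \<pi> p - p \<in> N}"
    then show "x + y \<in> {p. \<pi> p - p \<in> N}"
      using WS.subspace_add[OF N x, of "\<pi> y - y"] by (simp add: linD[OF \<pi>(2)] algebra_simps)
  qed
  then have "WS.span B' \<subseteq> {p. \<pi> p - p \<in> N}"
    using \<pi>(1) B(1) WS.subspace_0[OF N] WS.subspace_neg[OF N] by (intro WS.span_minimal) auto
  ultimately show ?thesis using \<pi>(2) B'(3) by blast
qed

text \<open>The quotient is realised on a complement of the ideal.\<close>

lemma ex_quotient_module:
  fixes L :: "('g::ab_group_add, 'i) lie_data"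
  assumes N: "WS.subspace N" "verma_kernel L lam \<subseteq> N" "\<And>x p. p \<in> N \<Longrightarrow> left_mult x p \<in> N" "word [] \<notin> N"
  shows "\<exists>(V :: ('g, 'g words) lie_module) \<phi>. highest_weight_module L lam V (\<phi> (word [])) \<and>
    (\<forall>p. \<phi> p = 0 \<longleftrightarrow> p \<in> N) \<and> (\<forall>x p. act V x (\<phi> p) = \<phi> (left_mult x p))"
proof -
  obtain \<pi> :: "'g words \<Rightarrow> 'g words" where lin: "lin \<pi>" and ker: "\<And>p. p \<in> N \<Longrightarrow> \<pi> p = 0" and diff: "\<And>p. \<pi> p - p \<in> N"
    using ex_projection_with_kernel[OF N(1)] by blast
  have zero_iff: "\<pi> p = 0 \<longleftrightarrow> p \<in> N" for p
    using ker diff[of p] WS.subspace_neg[OF N(1), of "- p"] by auto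
  have eqI: "\<pi> p = \<pi> q" if "p - q \<in> N" for p q
    using ker[OF that] by (simp add: linD[OF lin])
  have idem: "\<pi> (\<pi> p) = \<pi> p" for p by (rule eqI[OF diff])
  define V where "V = \<lparr>vscaling = words_scale, space = range \<pi>, act = (\<lambda>x p. \<pi> (left_mult x p))\<rparr>"
  \<comment> \<open>The action does not depend on the representative, because \<open>N\<close> is
    stable under left multiplication.\<close>
  have act: "act V x (\<pi> p) = \<pi> (left_mult x p)" for x p
    unfolding V_def lie_module.simps using N(3)[OF diff[of p], of x]
    by (intro eqI) (simp add: linD[OF lin_left_mult])
  have V: "vscaling V = words_scale" "space V = range \<pi>" by (simp_all add: V_def)
  have env: "\<pi> a = \<pi> b" if "a - b \<in> env_relations L" for a b
  proof (rule eqI)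
    have "a - b \<in> verma_kernel L lam"
      unfolding verma_kernel_def by (rule WS.span_base) (use that in blast)
    then show "a - b \<in> N" using N(2) by blast
  qed
  \<comment> \<open>Each expression is linear in \<open>p\<close>, so it suffices to take a word;
    there it is, up to sign, an enveloping relation with empty left context.\<close>
  have rel: "left_mult (x + y) p - (left_mult x p + left_mult y p) \<in> N"
    "left_mult (scaling L c x) p - words_scale c (left_mult x p) \<in> N"
    "left_mult (bracket L x y) p - (left_mult x (left_mult y p) - left_mult y (left_mult x p)) \<in> N" for x y p c
  proof -
    have sub: "WS.subspace {p. f p \<in> N}" if "lin f" for f :: "'g words \<Rightarrow> 'g words"
      by (rule WS.subspaceI)
        (use N(1) in \<open>auto simp: linD[OF that] WS.subspace_0 WS.subspace_add WS.subspace_scale\<close>)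
    have all: "f p \<in> N" if f: "lin f" "\<And>w. f (word w) \<in> N" for f :: "'g words \<Rightarrow> 'g words" and p
      by (rule word_span_induct[of p UNIV])
        (use f N(1) in \<open>auto simp: linD[OF f(1)] WS.subspace_0 WS.subspace_add WS.subspace_scale\<close>)
    have kernel: "a \<in> N" if "a \<in> env_relations L" for a
    proof -
      have "a \<in> verma_kernel L lam" unfolding verma_kernel_def by (rule WS.span_base) (use that in blast)
      then show ?thesis using N(2) by blast
    qed
    have lm: "left_mult x (a + b) = left_mult x a + left_mult x b"
      "left_mult x (words_scale c a) = words_scale c (left_mult x a)" for x :: 'g and a b c
      by (simp_all add: linD[OF lin_left_mult])
    have l1: "lin (\<lambda>p. left_mult (x + y) p - (left_mult x p + left_mult y p))"
      by (rule linI) (simp_all add: lm algebra_simps)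
    have l2: "lin (\<lambda>p. left_mult (scaling L c x) p - words_scale c (left_mult x p))"
      by (rule linI) (simp_all add: lm algebra_simps)
    have l3: "lin (\<lambda>p. left_mult (bracket L x y) p - (left_mult x (left_mult y p) - left_mult y (left_mult x p)))"
      by (rule linI) (simp_all add: lm algebra_simps)
    show "left_mult (x + y) p - (left_mult x p + left_mult y p) \<in> N"
    proof (rule all[OF l1], rule kernel)
      fix w
      have "word ([] @ [x + y] @ w) - word ([] @ [x] @ w) - word ([] @ [y] @ w) \<in> env_relations L"
        unfolding env_relations_def by blast
      then show "left_mult (x + y) (word w) - (left_mult x (word w) + left_mult y (word w)) \<in> env_relations L"
        by (simp add: left_mult_word diff_diff_eq)
    qed
    show "left_mult (scaling L c x) p - words_scale c (left_mult x p) \<in> N"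
    proof (rule all[OF l2], rule kernel)
      fix w
      have "word ([] @ [scaling L c x] @ w) - words_scale c (word ([] @ [x] @ w)) \<in> env_relations L"
        unfolding env_relations_def by blast
      then show "left_mult (scaling L c x) (word w) - words_scale c (left_mult x (word w)) \<in> env_relations L"
        by (simp add: left_mult_word)
    qed
    show "left_mult (bracket L x y) p - (left_mult x (left_mult y p) - left_mult y (left_mult x p)) \<in> N"
    proof (rule all[OF l3])
      fix w
      have "word ([] @ [x, y] @ w) - word ([] @ [y, x] @ w) - word ([] @ [bracket L x y] @ w) \<in> env_relations L"
        unfolding env_relations_def by blast
      then have "- (word ([] @ [x, y] @ w) - word ([] @ [y, x] @ w) - word ([] @ [bracket L x y] @ w)) \<in> N"
        by (rule WS.subspace_neg[OF N(1) kernel])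
      then have "word (bracket L x y # w) - (word (x # y # w) - word (y # x # w)) \<in> N"
        by (simp only: minus_diff_eq append.simps)
      then show "left_mult (bracket L x y) (word w) - (left_mult x (left_mult y (word w)) - left_mult y (left_mult x (word w))) \<in> N"
        by (simp add: left_mult_word)
    qed
  qed
  have mod: "is_lie_module L V"
    unfolding is_lie_module_def V
  proof (intro conjI allI ballI)
    show "vector_space words_scale" by (rule vector_space_words_scale)
    show "WS.subspace (range \<pi>)"
    proof (rule WS.subspaceI)
      show "0 \<in> range \<pi>" using rangeI[of \<pi> 0] by (simp only: linD(4)[OF lin])
      fix x y c assume "x \<in> range \<pi>"
      then obtain p where p: "x = \<pi> p" by blast
      show "words_scale c x \<in> range \<pi>" unfolding p linD(3)[OF lin, symmetric] by (rule rangeI)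
      assume "y \<in> range \<pi>"
      then obtain q where q: "y = \<pi> q" by blast
      show "x + y \<in> range \<pi>" unfolding p q linD(1)[OF lin, symmetric] by (rule rangeI)
    qed
  next
    fix x u assume "u \<in> range \<pi>"
    then show "act V x u \<in> range \<pi>" using act by auto
  next
    fix x u w assume "u \<in> range \<pi>" "w \<in> range \<pi>"
    then obtain p q where "u = \<pi> p" "w = \<pi> q" by blast
    then show "act V x (u + w) = act V x u + act V x w"
      by (simp only: act linD(1)[OF lin, symmetric] linD(1)[OF lin_left_mult, symmetric])
  next
    fix c x u assume "u \<in> range \<pi>"
    then obtain p where "u = \<pi> p" by blast
    then show "act V x (words_scale c u) = words_scale c (act V x u)"
      by (simp only: act linD(3)[OF lin, symmetric] linD(3)[OF lin_left_mult, symmetric])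
  next
    fix x y u assume "u \<in> range \<pi>"
    then obtain p where "u = \<pi> p" by blast
    then show "act V (x + y) u = act V x u + act V y u"
      using eqI[OF rel(1)] by (simp add: act linD[OF lin])
  next
    fix c x u assume "u \<in> range \<pi>"
    then obtain p where "u = \<pi> p" by blast
    then show "act V (scaling L c x) u = words_scale c (act V x u)"
      using eqI[OF rel(2)] by (simp add: act linD[OF lin])
  next
    fix x y u assume "u \<in> range \<pi>"
    then obtain p where "u = \<pi> p" by blast
    then show "act V (bracket L x y) u = act V x (act V y u) - act V y (act V x u)"
      using eqI[OF rel(3)] by (simp add: act linD[OF lin])
  qed
  have "\<pi> (word []) \<noteq> 0" using N(4) zero_iff by blast
  then have "range \<pi> \<noteq> {0}" by blast
  moreover have "verma_surjection L lam V \<pi>"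
    unfolding verma_surjection_def V using lin act N(2) ker by auto
  ultimately have "highest_weight_module L lam V (\<pi> (word []))"
    unfolding highest_weight_module_def V(2) using mod by blast
  then show ?thesis using zero_iff act by blast
qed

section \<open>Operators on the free module\<close>

text \<open>\<open>T\<close>, the free algebra on the nodes, is the Verma module of the Lie algebra obtained from \<open>L\<close>
  by dropping the Serre relations. Inside \<open>L \<times> End T\<close> the pairs \<open>(e i, E i)\<close>, \<open>(f i, F i)\<close>, \<open>(h, H h)\<close>
  generate a Lie algebra that projects onto \<open>L\<close>; elements \<open>(0, P)\<close> of it measure the failure of \<open>T\<close> to be an
  \<open>L\<close>-module, and the triangular decomposition shows that they do not affect the coefficients of the
  words \<open>i\<^sup>m\<close>.\<close>

locale free_verma = split_lie L
  for L :: "('g::ab_group_add, 'i) lie_data" +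
  fixes lam :: "'g \<Rightarrow> complex" and X :: "'i set"
  assumes lam: "lam \<in> dual_cartan L" and X: "X \<subseteq> I" "X \<noteq> {}"
begin

definition wgt :: "'i list \<Rightarrow> 'g \<Rightarrow> complex" where "wgt w = lam - content w"

definition H :: "'g \<Rightarrow> 'i words \<Rightarrow> 'i words"
  where "H h = lin_ext (\<lambda>w. words_scale (wgt w h) (word w))"

abbreviation F :: "'i \<Rightarrow> 'i words \<Rightarrow> 'i words" where "F \<equiv> left_mult"

text \<open>The commutation rule [e_i, f_j] = \<delta>_ij h_i read as a recursion, starting from a
  highest weight vector, the empty word.\<close>

primrec Ew :: "'i \<Rightarrow> 'i list \<Rightarrow> 'i words" where
  "Ew i [] = 0"
| "Ew i (j # w) = F j (Ew i w) + (if i = j then H (co i) (word w) else 0)"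

definition E :: "'i \<Rightarrow> 'i words \<Rightarrow> 'i words" where "E i = lin_ext (Ew i)"

lemma lin_ops: "lin (H h)" "lin (F i)" "lin (E i)"
  by (simp_all add: H_def E_def lin_lin_ext lin_left_mult)

lemmas H_lin = linD[OF lin_ops(1)] and F_lin = linD[OF lin_ops(2)] and E_lin = linD[OF lin_ops(3)]

lemma H_word: "H h (word w) = words_scale (wgt w h) (word w)"
  and E_word: "E i (word w) = Ew i w"
  by (simp_all add: H_def E_def)

lemma wgt_dual: "wgt w \<in> dual_cartan L"
  unfolding wgt_def by (intro dual_diff lam lc_dual)

lemma wgt_Nil: "wgt [] = lam"
  unfolding wgt_def content_Nil by (rule diff_zero)

lemma wgt_Cons: "wgt (j # w) = wgt w - (if j \<in> I then \<alpha> j else 0)"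
proof (cases "j \<in> I")
  case True
  then show ?thesis unfolding wgt_def content_Cons[OF True] by (simp only: if_True diff_diff_eq)
next
  case False
  then have "content (j # w) = content w" by (intro lc_cong) auto
  then show ?thesis using False by (simp only: wgt_def if_False diff_zero)
qed

lemma E_F: "E i (F j t) = F j (E i t) + (if i = j then H (co i) t else 0)"
proof (rule lin_eqI[where f = "\<lambda>t. E i (F j t)" and g = "\<lambda>t. F j (E i t) + (if i = j then H (co i) t else 0)" and p = t])
  show "lin (\<lambda>t. E i (F j t))" "lin (\<lambda>t. F j (E i t) + (if i = j then H (co i) t else 0))"
    by (rule linI; simp add: E_lin F_lin H_lin algebra_simps WS.scale_right_distrib)+
qed (simp add: left_mult_word E_word)

lemma H_F: "H h (F j t) = F j (H h t) - words_scale (if j \<in> I then \<alpha> j h else 0) (F j t)"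
proof (rule lin_eqI[where f = "\<lambda>t. H h (F j t)" and g = "\<lambda>t. F j (H h t) - words_scale (if j \<in> I then \<alpha> j h else 0) (F j t)" and p = t])
  show "lin (\<lambda>t. H h (F j t))" "lin (\<lambda>t. F j (H h t) - words_scale (if j \<in> I then \<alpha> j h else 0) (F j t))"
    by (rule linI; simp add: H_lin F_lin algebra_simps WS.scale_right_diff_distrib)+
  fix w
  show "H h (F j (word w)) = F j (H h (word w)) - words_scale (if j \<in> I then \<alpha> j h else 0) (F j (word w))"
    by (simp add: left_mult_word H_word wgt_Cons F_lin WS.scale_left_diff_distrib)
qed

lemma H_Ew: "i \<in> I \<Longrightarrow> H h (Ew i w) = words_scale (wgt w h + \<alpha> i h) (Ew i w)"
proof (induction w)
  case Nil
  then show ?case by (simp add: H_lin)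
next
  case (Cons j w)
  have 1: "H h (F j (Ew i w)) = words_scale (wgt (j # w) h + \<alpha> i h) (F j (Ew i w))"
    unfolding H_F Cons.IH[OF Cons.prems] F_lin WS.scale_left_diff_distrib[symmetric]
    by (simp add: wgt_Cons algebra_simps)
  have 2: "H h (H (co i) (word w)) = words_scale (wgt (i # w) h + \<alpha> i h) (H (co i) (word w))"
    using Cons.prems by (simp add: H_word H_lin wgt_Cons mult.commute)
  show ?case using 1 2 by (cases "i = j") (simp_all only: Ew.simps simp_thms if_True if_False H_lin WS.scale_right_distrib WS.scale_zero_right)
qed

lemma H_E:
  assumes "i \<in> I"
  shows "H h (E i t) = E i (H h t) + words_scale (\<alpha> i h) (E i t)"
proof (rule lin_eqI[where f = "\<lambda>t. H h (E i t)" and g = "\<lambda>t. E i (H h t) + words_scale (\<alpha> i h) (E i t)" and p = t])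
  show "lin (\<lambda>t. H h (E i t))" "lin (\<lambda>t. E i (H h t) + words_scale (\<alpha> i h) (E i t))"
    by (rule linI; simp add: H_lin E_lin algebra_simps WS.scale_right_distrib)+
  fix w
  show "H h (E i (word w)) = E i (H h (word w)) + words_scale (\<alpha> i h) (E i (word w))"
    using assms by (simp add: E_word H_word H_Ew E_lin WS.scale_left_distrib)
qed

lemma H_H: "H h (H h' t) = H h' (H h t)"
proof (rule lin_eqI[where f = "\<lambda>t. H h (H h' t)" and g = "\<lambda>t. H h' (H h t)" and p = t])
  show "lin (\<lambda>t. H h (H h' t))" "lin (\<lambda>t. H h' (H h t))" by (rule linI; simp add: H_lin)+
qed (simp add: H_word H_lin mult.commute)

lemma H_add:
  assumes "h \<in> cartan L" "h' \<in> cartan L"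
  shows "H (h + h') t = H h t + H h' t"
proof (rule lin_eqI[where f = "H (h + h')" and g = "\<lambda>t. H h t + H h' t" and p = t])
  show "lin (H (h + h'))" by (rule lin_ops(1))
  show "lin (\<lambda>t. H h t + H h' t)" by (rule linI; simp add: H_lin algebra_simps)
  fix w
  have "wgt w (h + h') = wgt w h + wgt w h'" using assms wgt_dual unfolding dual_cartan_def by blast
  then show "H (h + h') (word w) = H h (word w) + H h' (word w)"
    by (simp add: H_word WS.scale_left_distrib)
qed

lemma H_scale:
  assumes "h \<in> cartan L"
  shows "H (scaling L c h) t = words_scale c (H h t)"
proof (rule lin_eqI[where f = "H (scaling L c h)" and g = "\<lambda>t. words_scale c (H h t)" and p = t])
  show "lin (H (scaling L c h))" by (rule lin_ops(1))
  show "lin (\<lambda>t. words_scale c (H h t))" by (rule linI; simp add: H_lin algebra_simps)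
  fix w
  have "wgt w (scaling L c h) = c * wgt w h" using assms wgt_dual unfolding dual_cartan_def by blast
  then show "H (scaling L c h) (word w) = words_scale c (H h (word w))"
    by (simp add: H_word)
qed

lemma H_zero: "H 0 t = 0"
  using H_scale[OF A.G.subspace_0[OF cartan_subspace], of 0 t] by simp

subsection \<open>A Lie algebra of pairs\<close>

definition ps :: "complex \<Rightarrow> 'g \<times> ('i words \<Rightarrow> 'i words) \<Rightarrow> 'g \<times> ('i words \<Rightarrow> 'i words)"
  where "ps c p = (scaling L c (fst p), \<lambda>t. words_scale c (snd p t))"

text \<open>The bracket of \<open>L\<close> paired with the commutator of operators. It is bilinear
  only where the operators are linear, hence the \<open>lin\<close> premises below.\<close>

definition pb :: "'g \<times> ('i words \<Rightarrow> 'i words) \<Rightarrow> 'g \<times> ('i words \<Rightarrow> 'i words) \<Rightarrow> 'g \<times> ('i words \<Rightarrow> 'i words)"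
  where "pb p q = (bracket L (fst p) (fst q), \<lambda>t. snd p (snd q t) - snd q (snd p t))"

lemma pair_eqI: "fst p = fst q \<Longrightarrow> (\<And>t. snd p t = snd q t) \<Longrightarrow> p = q"
  by (simp add: prod_eq_iff fun_eq_iff)

lemma pair_simps [simp]: "fst (ps c p) = scaling L c (fst p)" "snd (ps c p) t = words_scale c (snd p t)"
    "fst (pb p q) = bracket L (fst p) (fst q)" "snd (pb p q) t = snd p (snd q t) - snd q (snd p t)"
  by (simp_all add: ps_def pb_def)

lemma pb_add_left: "lin (snd r) \<Longrightarrow> pb (p + q) r = pb p r + pb q r"
  by (rule pair_eqI) (simp_all add: A.br_add linD)

lemma pb_add_right: "lin (snd p) \<Longrightarrow> pb p (q + r) = pb p q + pb p r"
  by (rule pair_eqI) (simp_all add: A.br_add linD)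

lemma pb_scale_left: "lin (snd r) \<Longrightarrow> pb (ps c p) r = ps c (pb p r)"
  by (rule pair_eqI) (simp_all add: A.br_scale linD WS.scale_right_diff_distrib)

lemma pb_scale_right: "lin (snd p) \<Longrightarrow> pb p (ps c q) = ps c (pb p q)"
  by (rule pair_eqI) (simp_all add: A.br_scale linD WS.scale_right_diff_distrib)

lemma pb_anti: "pb p q = ps (-1) (pb q p)"
  by (rule pair_eqI) (use A.br_anti[of "fst p" "fst q"] in simp_all)

lemma pb_jacobi: "lin (snd p) \<Longrightarrow> lin (snd q) \<Longrightarrow> lin (snd r) \<Longrightarrow> pb p (pb q r) = pb (pb p q) r + pb q (pb p r)"
  by (rule pair_eqI) (use A.jacobi'[of "fst p" "fst q" "fst r"] in \<open>simp_all add: linD\<close>)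

lemma pb_zero: "lin (snd p) \<Longrightarrow> pb p 0 = 0" "lin (snd p) \<Longrightarrow> pb 0 p = 0"
  by (rule pair_eqI; simp add: linD)+

lemma lin_pair: "lin (snd p) \<Longrightarrow> lin (snd q) \<Longrightarrow> lin (snd (p + q))" "lin (snd p) \<Longrightarrow> lin (snd (ps c p))"
    "lin (snd p) \<Longrightarrow> lin (snd q) \<Longrightarrow> lin (snd (pb p q))" "lin (snd 0)"
  by (rule linI; simp add: linD algebra_simps WS.scale_right_distrib)+

inductive_set gen :: "('g \<times> ('i words \<Rightarrow> 'i words)) set \<Rightarrow> ('g \<times> ('i words \<Rightarrow> 'i words)) set" for S where
  base: "s \<in> S \<Longrightarrow> s \<in> gen S"
| zero: "0 \<in> gen S"
| add: "p \<in> gen S \<Longrightarrow> q \<in> gen S \<Longrightarrow> p + q \<in> gen S"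
| scale: "p \<in> gen S \<Longrightarrow> ps c p \<in> gen S"
| br: "p \<in> gen S \<Longrightarrow> q \<in> gen S \<Longrightarrow> pb p q \<in> gen S"

lemma gen_lin: "p \<in> gen S \<Longrightarrow> (\<And>s. s \<in> S \<Longrightarrow> lin (snd s)) \<Longrightarrow> lin (snd p)"
  by (induction rule: gen.induct) (blast intro: lin_pair)+

text \<open>By the Jacobi identity the bracket with \<open>x\<close> is a derivation, so it suffices
  to check generators.\<close>

lemma gen_normalize:
  assumes S: "\<And>s. s \<in> S \<Longrightarrow> lin (snd s)" and x: "lin (snd x)" and b: "\<And>s. s \<in> S \<Longrightarrow> pb x s \<in> gen S"
    and p: "p \<in> gen S"
  shows "pb x p \<in> gen S"
  using p
proof (induction rule: gen.induct)
  case (br p q)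
  then have "pb x (pb p q) = pb (pb x p) q + pb p (pb x q)"
    using pb_jacobi x gen_lin S by blast
  then show ?case using br by (auto intro: gen.intros)
qed (auto intro: gen.intros b simp: pb_zero[OF x] pb_add_right[OF x] pb_scale_right[OF x])

definition Sp where "Sp = (\<lambda>i. (e i, E i)) ` I"
definition Sm where "Sm = (\<lambda>i. (f i, F i)) ` I"
definition S0 where "S0 = (\<lambda>h. (h, H h)) ` cartan L"

lemma S_lin: "s \<in> Sp \<Longrightarrow> lin (snd s)" "s \<in> Sm \<Longrightarrow> lin (snd s)" "s \<in> S0 \<Longrightarrow> lin (snd s)"
  by (auto simp: Sp_def Sm_def S0_def lin_ops)

lemmas gen_Sp_lin = gen_lin[OF _ S_lin(1)] and gen_Sm_lin = gen_lin[OF _ S_lin(2)]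

lemma S0_closed: "z \<in> S0 \<Longrightarrow> z' \<in> S0 \<Longrightarrow> z + z' \<in> S0" "z \<in> S0 \<Longrightarrow> ps c z \<in> S0" "0 \<in> S0"
proof -
  show "z + z' \<in> S0" if zz: "z \<in> S0" "z' \<in> S0"
  proof -
    obtain h h' where hh: "h \<in> cartan L" "h' \<in> cartan L" "z = (h, H h)" "z' = (h', H h')"
      using zz unfolding S0_def by blast
    then have "z + z' = (h + h', H (h + h'))" by (auto simp: fun_eq_iff H_add)
    then show ?thesis unfolding S0_def using A.G.subspace_add[OF cartan_subspace hh(1,2)] by blast
  qed
  show "ps c z \<in> S0" if z: "z \<in> S0"
  proof -
    obtain h where h: "h \<in> cartan L" "z = (h, H h)" using z unfolding S0_def by blast
    then have "ps c z = (scaling L c h, H (scaling L c h))" by (auto simp: ps_def fun_eq_iff H_scale)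
    then show ?thesis unfolding S0_def using A.G.subspace_scale[OF cartan_subspace h(1)] by blast
  qed
  have "(0, H 0) = 0" by (rule pair_eqI) (simp_all add: H_zero)
  then show "0 \<in> S0" unfolding S0_def by (rule image_eqI[OF sym A.G.subspace_0[OF cartan_subspace]])
qed

lemma pb_S0:
  assumes z: "z \<in> S0"
  shows "p \<in> gen Sp \<Longrightarrow> pb z p \<in> gen Sp" "p \<in> gen Sm \<Longrightarrow> pb z p \<in> gen Sm" "z' \<in> S0 \<Longrightarrow> pb z z' = 0"
proof -
  obtain h where h: "h \<in> cartan L" "z = (h, H h)" using z unfolding S0_def by blast
  have "pb z (e i, E i) = ps (\<alpha> i h) (e i, E i)" if "i \<in> I" for i
    unfolding h(2) using chevalley(1)[OF that] h(1) that
    by (intro pair_eqI) (simp_all add: root_space_def H_E)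
  then have gp: "pb z s \<in> gen Sp" if "s \<in> Sp" for s
    using that gen.scale[OF gen.base[OF that]] unfolding Sp_def by (elim imageE) simp
  show "pb z p \<in> gen Sp" if "p \<in> gen Sp"
    by (rule gen_normalize[OF S_lin(1) S_lin(3)[OF z] gp that])
  have "pb z (f i, F i) = ps (- \<alpha> i h) (f i, F i)" if "i \<in> I" for i
    unfolding h(2) using chevalley(2)[OF that] h(1) that
    by (intro pair_eqI) (simp_all add: root_space_def H_F)
  then have gm: "pb z s \<in> gen Sm" if "s \<in> Sm" for s
    using that gen.scale[OF gen.base[OF that]] unfolding Sm_def by (elim imageE) simp
  show "pb z p \<in> gen Sm" if "p \<in> gen Sm"
    by (rule gen_normalize[OF S_lin(2) S_lin(3)[OF z] gm that])
  show "pb z z' = 0" if "z' \<in> S0"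
    using that h cartan_comm by (auto simp: S0_def H_H intro!: pair_eqI)
qed

text \<open>Brackets with a generator of opposite sign produce Cartan terms only on single
  generators. On a proper bracket [p, q] the Cartan parts act on \<open>q\<close> and
  \<open>p\<close> again, and they normalise \<open>gen S\<close>, so the result is in
  \<open>gen S\<close>.\<close>

lemma pb_gen_opposite:
  assumes S: "\<And>s. s \<in> S \<Longrightarrow> lin (snd s)" and x: "lin (snd x)" and b: "\<And>s. s \<in> S \<Longrightarrow> pb x s \<in> S0"
    and n: "\<And>z p. z \<in> S0 \<Longrightarrow> p \<in> gen S \<Longrightarrow> pb z p \<in> gen S" and p: "p \<in> gen S"
  shows "\<exists>z\<in>S0. \<exists>m\<in>gen S. pb x p = z + m"
  using p
proof (induction rule: gen.induct)
  case (base s)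
  then show ?case using b gen.zero by (metis add.right_neutral)
next
  case zero
  have "pb x 0 = 0 + 0" using pb_zero(1)[OF x] by simp
  then show ?case using S0_closed(3) gen.zero by blast
next
  case (add p q)
  then obtain z m z' m' where "z \<in> S0" "m \<in> gen S" "z' \<in> S0" "m' \<in> gen S" "pb x p = z + m" "pb x q = z' + m'" by blast
  moreover from this have "pb x (p + q) = (z + z') + (m + m')" by (simp add: pb_add_right[OF x])
  ultimately show ?case using S0_closed(1) gen.add by blast
next
  case (scale p c)
  then obtain z m where "z \<in> S0" "m \<in> gen S" "pb x p = z + m" by blast
  moreover from this have "pb x (ps c p) = ps c z + ps c m"
    by (simp add: pb_scale_right[OF x]) (rule pair_eqI; simp add: A.G.scale_right_distrib WS.scale_right_distrib)
  ultimately show ?case using S0_closed(2) gen.scale by blast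
next
  case (br p q)
  then obtain z m z' m' where zm: "z \<in> S0" "m \<in> gen S" "z' \<in> S0" "m' \<in> gen S" "pb x p = z + m" "pb x q = z' + m'" by blast
  have l: "lin (snd p)" "lin (snd q)" using br gen_lin S by blast+
  have "pb x (pb p q) = pb (z + m) q + pb p (z' + m')"
    unfolding zm(5,6)[symmetric] by (rule pb_jacobi[OF x l])
  also have "\<dots> = (pb z q + pb m q) + (ps (-1) (pb z' p) + pb p m')"
    using pb_anti[of p z'] by (simp only: pb_add_left[OF l(2)] pb_add_right[OF l(1)])
  also have "\<dots> \<in> gen S"
    by (intro gen.add gen.scale gen.br n zm(1-4) br.hyps)
  finally have "pb x (pb p q) \<in> gen S" .
  then show ?case using S0_closed(3) by (metis add.left_neutral)
qed

text \<open>Candidate triangular form of the algebra of pairs. The sum is not claimed to be direct;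
  directness enters through the first components in \<open>L\<close>.\<close>

definition D where "D = {a + z + b | a z b. a \<in> gen Sp \<and> z \<in> S0 \<and> b \<in> gen Sm}"

lemma D_I: "a \<in> gen Sp \<Longrightarrow> z \<in> S0 \<Longrightarrow> b \<in> gen Sm \<Longrightarrow> a + z + b \<in> D"
  unfolding D_def by blast

lemma D_subsets: "gen Sp \<subseteq> D" "S0 \<subseteq> D" "gen Sm \<subseteq> D"
proof -
  show "gen Sp \<subseteq> D" using D_I[OF _ S0_closed(3) gen.zero] by force
  show "S0 \<subseteq> D" using D_I[OF gen.zero _ gen.zero] by force
  show "gen Sm \<subseteq> D" using D_I[OF gen.zero S0_closed(3)] by force
qed

lemma D_add: "p \<in> D \<Longrightarrow> q \<in> D \<Longrightarrow> p + q \<in> D"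
proof -
  assume "p \<in> D" "q \<in> D"
  then obtain a z b a' z' b' where *: "a \<in> gen Sp" "z \<in> S0" "b \<in> gen Sm" "p = a + z + b"
    "a' \<in> gen Sp" "z' \<in> S0" "b' \<in> gen Sm" "q = a' + z' + b'" unfolding D_def by blast
  have "p + q = (a + a') + (z + z') + (b + b')" unfolding * by (simp only: ac_simps)
  then show ?thesis using * by (metis D_I S0_closed(1) gen.add)
qed

lemma ps_add: "ps c (p + q) = ps c p + ps c q"
  by (rule pair_eqI) (simp_all add: A.G.scale_right_distrib WS.scale_right_distrib)

lemma D_scale: "p \<in> D \<Longrightarrow> ps c p \<in> D"
proof -
  assume "p \<in> D"
  then obtain a z b where *: "a \<in> gen Sp" "z \<in> S0" "b \<in> gen Sm" "p = a + z + b" unfolding D_def by blast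
  then show ?thesis unfolding *(4) ps_add by (intro D_I gen.scale S0_closed(2))
qed

lemma D_lin: "p \<in> D \<Longrightarrow> lin (snd p)"
  using lin_pair(1) gen_Sp_lin gen_Sm_lin S_lin(3) unfolding D_def by blast

lemma pb_generator_D:
  assumes s: "s \<in> Sp \<union> Sm \<union> S0" and d: "d \<in> D"
  shows "pb s d \<in> D"
proof -
  obtain a z b where *: "a \<in> gen Sp" "z \<in> S0" "b \<in> gen Sm" "d = a + z + b" using d unfolding D_def by blast
  have ls: "lin (snd s)" using s S_lin by blast
  have eq: "pb s d = pb s a + pb s z + pb s b" unfolding *(4) by (simp only: pb_add_right[OF ls])
  consider "s \<in> Sp" | "s \<in> Sm" | "s \<in> S0" using s by blast
  then show ?thesis
  proof cases
    case 1
    have gs: "s \<in> gen Sp" using 1 by (rule gen.base)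
    have "pb s a \<in> D" using gen.br[OF gs *(1)] D_subsets by blast
    moreover have "pb s z \<in> D"
      unfolding pb_anti[of s z] using pb_S0(1)[OF *(2) gs] D_subsets D_scale by blast
    moreover have "\<exists>z\<in>S0. \<exists>m\<in>gen Sm. pb s b = z + m"
    proof (rule pb_gen_opposite[OF S_lin(2) ls _ pb_S0(2) *(3)])
      fix t assume "t \<in> Sm"
      then obtain i j where ij: "i \<in> I" "j \<in> I" "s = (e i, E i)" "t = (f j, F j)"
        using 1 unfolding Sp_def Sm_def by blast
      have "pb s t = (if i = j then (co i, H (co i)) else 0)"
        unfolding ij(3,4) by (rule pair_eqI) (use ij(1,2) in \<open>auto simp: br_e_f E_F\<close>)
      then show "pb s t \<in> S0" using ij(1) chevalley(3) S0_closed(3) by (auto simp: S0_def)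
    qed
    then have "pb s b \<in> D" using D_subsets D_add by (metis subsetD)
    ultimately show ?thesis unfolding eq by (intro D_add)
  next
    case 2
    have gs: "s \<in> gen Sm" using 2 by (rule gen.base)
    have "pb s b \<in> D" using gen.br[OF gs *(3)] D_subsets by blast
    moreover have "pb s z \<in> D"
      unfolding pb_anti[of s z] using pb_S0(2)[OF *(2) gs] D_subsets D_scale by blast
    moreover have "\<exists>z\<in>S0. \<exists>m\<in>gen Sp. pb s a = z + m"
    proof (rule pb_gen_opposite[OF S_lin(1) ls _ pb_S0(1) *(1)])
      fix t assume "t \<in> Sp"
      then obtain i j where ij: "i \<in> I" "j \<in> I" "s = (f j, F j)" "t = (e i, E i)"
        using 2 unfolding Sp_def Sm_def by blast
      have "pb t s = (if i = j then (co i, H (co i)) else 0)"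
        unfolding ij(3,4) by (rule pair_eqI) (use ij(1,2) in \<open>auto simp: br_e_f E_F\<close>)
      then have "pb t s \<in> S0" using ij(1) chevalley(3) S0_closed(3) by (auto simp: S0_def)
      then show "pb s t \<in> S0" unfolding pb_anti[of s t] by (rule S0_closed(2))
    qed
    then have "pb s a \<in> D" using D_subsets D_add by (metis subsetD)
    ultimately show ?thesis unfolding eq by (intro D_add)
  next
    case 3
    have "pb s a \<in> D" "pb s z \<in> D" "pb s b \<in> D"
      using pb_S0(1)[OF 3 *(1)] pb_S0(2)[OF 3 *(3)] pb_S0(3)[OF 3 *(2)] D_subsets S0_closed(3) by auto
    then show ?thesis unfolding eq by (intro D_add)
  qed
qed

definition LL where "LL = gen (Sp \<union> Sm \<union> S0)"

lemma LL_lin: "p \<in> LL \<Longrightarrow> lin (snd p)"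
  unfolding LL_def by (erule gen_lin) (use S_lin in blast)

text \<open>\<open>D\<close> is not shown to be closed under brackets. The induction instead carries
  along that the bracket with \<open>p\<close> preserves \<open>D\<close>, a property inherited from
  the generators by the Jacobi identity.\<close>

lemma LL_subset_D: "LL \<subseteq> D"
proof -
  have "p \<in> D \<and> (\<forall>d\<in>D. pb p d \<in> D)" if "p \<in> gen (Sp \<union> Sm \<union> S0)" for p
    using that
  proof (induction rule: gen.induct)
    case (base s)
    have "s \<in> D" using base D_subsets gen.base by blast
    then show ?case using pb_generator_D[OF base] by blast
  next
    case zero
    have "0 \<in> D" using D_subsets S0_closed(3) by blast
    then show ?case using pb_zero(2) D_lin by metis
  next
    case (add p q)
    then show ?case using D_add pb_add_left D_lin by metis
  next
    case (scale p c)
    then show ?case using D_scale pb_scale_left D_lin by metis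
  next
    case (br p q)
    have "pb (pb p q) d \<in> D" if d: "d \<in> D" for d
    proof -
      have "pb p (pb q d) = pb (pb p q) d + pb q (pb p d)"
        using br d D_lin by (intro pb_jacobi) auto
      then have "pb (pb p q) d = pb p (pb q d) + ps (-1) (pb q (pb p d))"
        by (intro pair_eqI) (simp_all add: prod_eq_iff fun_eq_iff)
      then show ?thesis using br d D_add D_scale by metis
    qed
    then show ?case using br by blast
  qed
  then show ?thesis unfolding LL_def by blast
qed

end

section \<open>Prescribing the powers that survive\<close>

context free_verma
begin

lemma fst_gen_hull:
  assumes "(fst ` S) \<subseteq> N" "lie_subalgebra L N" "p \<in> gen S"
  shows "fst p \<in> N"
  using assms(3)
proof (induction rule: gen.induct)
  case (base s)
  then show ?case using assms(1) by blast
qed (use assms(2) A.G.subspace_0 A.G.subspace_add A.G.subspace_scale in \<open>auto simp: lie_subalgebra_def\<close>)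

lemma hull_subalgebra: "lie_subalgebra L (lie_subalgebra L hull M)"
proof (rule hull_in)
  fix T assume T: "\<forall>s\<in>T. lie_subalgebra L s"
  have "A.G.subspace (\<Inter>T)" using T by (intro A.G.subspace_Inter) (auto simp: lie_subalgebra_def)
  then show "lie_subalgebra L (\<Inter>T)" using T by (auto simp: lie_subalgebra_def)
qed

lemma n_subalgebra: "lie_subalgebra L (n_plus L)" "lie_subalgebra L (n_minus L)"
  unfolding n_plus_hull n_minus_hull by (rule hull_subalgebra)+

lemma n_subspace: "A.G.subspace (n_plus L)" "A.G.subspace (n_minus L)"
  using n_subalgebra by (auto simp: lie_subalgebra_def)

lemma fst_Sp: "p \<in> gen Sp \<Longrightarrow> fst p \<in> n_plus L"
  by (rule fst_gen_hull[OF _ n_subalgebra(1)]) (auto simp: Sp_def n_plus_hull hull_inc)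

lemma fst_Sm: "p \<in> gen Sm \<Longrightarrow> fst p \<in> n_minus L"
  by (rule fst_gen_hull[OF _ n_subalgebra(2)]) (auto simp: Sm_def n_minus_hull hull_inc)

lemma lie_subalgebra_fst_gen:
  assumes "\<And>s. s \<in> S \<Longrightarrow> lin (snd s)"
  shows "lie_subalgebra L (fst ` gen S)"
  unfolding lie_subalgebra_def
proof (intro conjI ballI)
  show "A.G.subspace (fst ` gen S)"
  proof (rule A.G.subspaceI)
    show "0 \<in> fst ` gen S" by (rule image_eqI[OF _ gen.zero]) simp
    fix x y c assume "x \<in> fst ` gen S"
    then obtain p where p: "p \<in> gen S" "x = fst p" by blast
    show "scaling L c x \<in> fst ` gen S" by (rule image_eqI[OF _ gen.scale[OF p(1), of c]]) (simp add: p)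
    assume "y \<in> fst ` gen S"
    then obtain q where q: "q \<in> gen S" "y = fst q" by blast
    show "x + y \<in> fst ` gen S" by (rule image_eqI[OF _ gen.add[OF p(1) q(1)]]) (simp add: p q)
  qed
  fix x y assume "x \<in> fst ` gen S" "y \<in> fst ` gen S"
  then obtain p q where pq: "p \<in> gen S" "x = fst p" "q \<in> gen S" "y = fst q" by blast
  show "bracket L x y \<in> fst ` gen S" by (rule image_eqI[OF _ gen.br[OF pq(1,3)]]) (simp add: pq)
qed

lemma n_plus_subset: "n_plus L \<subseteq> fst ` gen Sp"
  unfolding n_plus_hull
proof (rule hull_minimal[where S = "lie_subalgebra L" and t = "fst ` gen Sp"])
  show "e ` I \<subseteq> fst ` gen Sp" unfolding Sp_def by (force intro: gen.base)
qed (rule lie_subalgebra_fst_gen[OF S_lin(1)])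

lemma n_minus_subset: "n_minus L \<subseteq> fst ` gen Sm"
  unfolding n_minus_hull
proof (rule hull_minimal[where S = "lie_subalgebra L" and t = "fst ` gen Sm"])
  show "f ` I \<subseteq> fst ` gen Sm" unfolding Sm_def by (force intro: gen.base)
qed (rule lie_subalgebra_fst_gen[OF S_lin(2)])

lemma gen_mono: "p \<in> gen S \<Longrightarrow> S \<subseteq> S' \<Longrightarrow> p \<in> gen S'"
  by (induction rule: gen.induct) (auto intro: gen.intros)

lemma gens_subset_LL: "gen Sp \<subseteq> LL" "gen Sm \<subseteq> LL" "S0 \<subseteq> LL"
proof -
  show "gen Sp \<subseteq> LL" "gen Sm \<subseteq> LL"
    unfolding LL_def by (rule subsetI, erule gen_mono, blast)+
  show "S0 \<subseteq> LL" unfolding LL_def by (rule subsetI, rule gen.base, blast)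
qed

lemma LL_surj: "\<exists>P. (x, P) \<in> LL"
proof -
  obtain a h b where x: "x = a + h + b" "a \<in> n_plus L" "h \<in> cartan L" "b \<in> n_minus L"
    using triangular_ex by blast
  obtain p q where pq: "p \<in> gen Sp" "a = fst p" "q \<in> gen Sm" "b = fst q"
    using x n_plus_subset n_minus_subset by blast
  have "(h, H h) \<in> LL" using gens_subset_LL(3) x(3) unfolding S0_def by blast
  then have "p + (h, H h) + q \<in> LL"
    using pq gens_subset_LL unfolding LL_def by (blast intro: gen.add)
  moreover have "p + (h, H h) + q = (x, snd (p + (h, H h) + q))"
    by (rule prod_eqI) (simp_all add: x(1) pq)
  ultimately show ?thesis by metis
qed

text \<open>A submodule inside this subspace can be divided out without destroying any power of a
  letter of \<open>X\<close>.\<close>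

definition Z :: "'i words set"
  where "Z = {t. \<forall>i\<in>X. \<forall>m. Poly_Mapping.lookup t (replicate m i) = 0}"

lemma Z_subspace: "WS.subspace Z"
  by (rule WS.subspaceI) (auto simp: Z_def lookup_add words_scale_lookup)

lemma F_Z: "t \<in> Z \<Longrightarrow> F j t \<in> Z"
proof -
  assume "t \<in> Z"
  then have "Poly_Mapping.lookup (F j t) (replicate m i) = 0" if "i \<in> X" for i m
    using that by (cases m) (auto simp: lookup_left_mult Z_def)
  then show ?thesis by (simp add: Z_def)
qed

lemma gen_Sp_Nil: "p \<in> gen Sp \<Longrightarrow> snd p (word []) = 0"
proof (induction rule: gen.induct)
  case (br p q)
  then show ?case using linD(4)[OF gen_Sp_lin] by simp
qed (auto simp: Sp_def E_word)

lemma n_minus_cartan: "h \<in> cartan L \<Longrightarrow> b \<in> n_minus L \<Longrightarrow> bracket L h b \<in> n_minus L"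
proof -
  assume h: "h \<in> cartan L" and b: "b \<in> n_minus L"
  let ?R = "\<Union>\<beta>\<in>{\<beta> \<in> roots L. - \<beta> \<in> root_cone L}. root_space L \<beta>"
  have "A.G.subspace {b. bracket L h b \<in> A.G.span ?R}"
    by (rule A.G.subspaceI)
      (auto simp: A.br_add A.br_scale intro: A.G.span_zero A.G.span_add A.G.span_scale)
  moreover have "?R \<subseteq> {b. bracket L h b \<in> A.G.span ?R}"
  proof
    fix x assume x: "x \<in> ?R"
    then obtain \<beta> where "x \<in> root_space L \<beta>" by blast
    then have "bracket L h x = scaling L (\<beta> h) x" using h by (simp add: root_space_def)
    then show "x \<in> {b. bracket L h b \<in> A.G.span ?R}"
      using A.G.span_scale[OF A.G.span_base[OF x]] by simp
  qed
  ultimately have "A.G.span ?R \<subseteq> {b. bracket L h b \<in> A.G.span ?R}" by (rule A.G.span_minimal[rotated])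
  then show ?thesis using b unfolding n_minus_def by blast
qed

text \<open>The number \<open>c\<close> is the coefficient of \<open>f i\<close> modulo brackets; it is visible both in \<open>L\<close>, through
  \<open>ad (e i)\<close>, and in the action on powers of \<open>i\<close>.\<close>

lemma gen_Sm_coeff:
  assumes i: "i \<in> I"
  shows "p \<in> gen Sm \<Longrightarrow> \<exists>c. bracket L (e i) (fst p) - scaling L c (co i) \<in> n_minus L \<and>
    (\<forall>t m. Poly_Mapping.lookup (snd p t) (replicate m i) =
      (if m = 0 then 0 else c * Poly_Mapping.lookup t (replicate (m - 1) i)))"
proof (induction rule: gen.induct)
  case (base s)
  then obtain j where j: "j \<in> I" "s = (f j, F j)" unfolding Sm_def by blast
  have "Poly_Mapping.lookup (F j t) (replicate m i) =
      (if m = 0 then 0 else (if j = i then 1 else 0) * Poly_Mapping.lookup t (replicate (m - 1) i))" for t m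
    by (cases m) (auto simp: lookup_left_mult)
  moreover have "bracket L (e i) (f j) - scaling L (if j = i then 1 else 0) (co i) = 0"
    using i j by (auto simp: br_e_f)
  ultimately show ?case
    unfolding j(2) fst_conv snd_conv using A.G.subspace_0[OF n_subspace(2)] by metis
next
  case zero
  show ?case by (rule exI[of _ 0]) (use A.G.subspace_0[OF n_subspace(2)] in simp)
next
  case (add p q)
  then obtain c d where *: "bracket L (e i) (fst p) - scaling L c (co i) \<in> n_minus L"
    "\<And>t m. Poly_Mapping.lookup (snd p t) (replicate m i) = (if m = 0 then 0 else c * Poly_Mapping.lookup t (replicate (m - 1) i))"
    "bracket L (e i) (fst q) - scaling L d (co i) \<in> n_minus L"
    "\<And>t m. Poly_Mapping.lookup (snd q t) (replicate m i) = (if m = 0 then 0 else d * Poly_Mapping.lookup t (replicate (m - 1) i))"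
    by blast
  have "bracket L (e i) (fst (p + q)) - scaling L (c + d) (co i)
      = (bracket L (e i) (fst p) - scaling L c (co i)) + (bracket L (e i) (fst q) - scaling L d (co i))"
    by (simp add: A.br_add A.G.scale_left_distrib)
  then have "bracket L (e i) (fst (p + q)) - scaling L (c + d) (co i) \<in> n_minus L"
    using A.G.subspace_add[OF n_subspace(2) *(1,3)] by simp
  moreover have "Poly_Mapping.lookup (snd (p + q) t) (replicate m i) =
      (if m = 0 then 0 else (c + d) * Poly_Mapping.lookup t (replicate (m - 1) i))" for t m
    by (simp add: lookup_add *(2,4) ring_distribs)
  ultimately show ?case by blast
next
  case (scale p k)
  then obtain c where *: "bracket L (e i) (fst p) - scaling L c (co i) \<in> n_minus L"
    "\<And>t m. Poly_Mapping.lookup (snd p t) (replicate m i) = (if m = 0 then 0 else c * Poly_Mapping.lookup t (replicate (m - 1) i))"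
    by blast
  have "bracket L (e i) (fst (ps k p)) - scaling L (k * c) (co i) = scaling L k (bracket L (e i) (fst p) - scaling L c (co i))"
    by (simp add: A.br_scale A.G.scale_right_diff_distrib)
  then have "bracket L (e i) (fst (ps k p)) - scaling L (k * c) (co i) \<in> n_minus L"
    using A.G.subspace_scale[OF n_subspace(2) *(1), of k] by simp
  moreover have "Poly_Mapping.lookup (snd (ps k p) t) (replicate m i) =
      (if m = 0 then 0 else (k * c) * Poly_Mapping.lookup t (replicate (m - 1) i))" for t m
    by (simp add: words_scale_lookup *(2))
  ultimately show ?case by blast
next
  case (br p q)
  then obtain c d where *: "bracket L (e i) (fst p) - scaling L c (co i) \<in> n_minus L"
    "\<And>t m. Poly_Mapping.lookup (snd p t) (replicate m i) = (if m = 0 then 0 else c * Poly_Mapping.lookup t (replicate (m - 1) i))"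
    "bracket L (e i) (fst q) - scaling L d (co i) \<in> n_minus L"
    "\<And>t m. Poly_Mapping.lookup (snd q t) (replicate m i) = (if m = 0 then 0 else d * Poly_Mapping.lookup t (replicate (m - 1) i))"
    by blast
  have pq: "fst p \<in> n_minus L" "fst q \<in> n_minus L" using br fst_Sm by blast+
  have sub: "bracket L a b \<in> n_minus L" if "a \<in> n_minus L" "b \<in> n_minus L" for a b
    using n_subalgebra(2) that by (auto simp: lie_subalgebra_def)
  have co: "bracket L (scaling L k (co i)) a \<in> n_minus L" if "a \<in> n_minus L" for a k
    using n_minus_cartan[OF chevalley(3)[OF i] that] A.G.subspace_scale[OF n_subspace(2)] by (simp add: A.br_scale)
  have "bracket L (bracket L (e i) (fst p)) (fst q) \<in> n_minus L"
    using A.G.subspace_add[OF n_subspace(2) sub[OF *(1) pq(2)] co[OF pq(2), of c]] by (simp add: A.br_diff)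
  moreover have "bracket L (fst p) (bracket L (e i) (fst q)) \<in> n_minus L"
  proof -
    have "bracket L (bracket L (e i) (fst q)) (fst p) \<in> n_minus L"
      using A.G.subspace_add[OF n_subspace(2) sub[OF *(3) pq(1)] co[OF pq(1), of d]] by (simp add: A.br_diff)
    then show ?thesis
      using A.G.subspace_neg[OF n_subspace(2)] A.br_anti[of "fst p" "bracket L (e i) (fst q)"] by simp
  qed
  ultimately have "bracket L (e i) (fst (pb p q)) - scaling L 0 (co i) \<in> n_minus L"
    using A.jacobi'[of "e i" "fst p" "fst q"] A.G.subspace_add[OF n_subspace(2)] by simp
  \<comment> \<open>Both orders of composition give c d times the coefficient two steps down, so the
    commutator contributes 0.\<close>
  moreover have "Poly_Mapping.lookup (snd (pb p q) t) (replicate m i) =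
      (if m = 0 then 0 else 0 * Poly_Mapping.lookup t (replicate (m - 1) i))" for t m
    by (simp add: lookup_minus *(2,4))
  ultimately show ?case by blast
qed

text \<open>Decompose (0, P) in \<open>D\<close>: directness in \<open>L\<close> makes the Cartan
  part 0 and places \<open>b\<close> over 0. The raising part kills the empty word, so only
  \<open>b\<close> matters. If c is its coefficient at \<open>f i\<close>, then c h_i lies in both
  \<open>n_minus\<close> and the Cartan subalgebra, whence c = 0.\<close>

lemma LL_kernel_Nil:
  assumes "(0, P) \<in> LL"
  shows "P (word []) \<in> Z"
proof -
  obtain a z b where *: "a \<in> gen Sp" "z \<in> S0" "b \<in> gen Sm" "(0, P) = a + z + b"
    using assms LL_subset_D unfolding D_def by blast
  obtain h where h: "h \<in> cartan L" "z = (h, H h)" using *(2) unfolding S0_def by blast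
  have "fst a + h + fst b = 0" using arg_cong[OF *(4), of fst] by (simp add: h(2))
  then have 0: "h = 0" "fst b = 0" using triangular_zero fst_Sp[OF *(1)] h(1) fst_Sm[OF *(3)] by blast+
  have "P (word []) = snd a (word []) + H h (word []) + snd b (word [])"
    using arg_cong[OF *(4), of snd] by (simp add: h(2))
  also have "\<dots> = snd b (word [])" using gen_Sp_Nil[OF *(1)] 0(1) by (simp add: H_zero)
  finally have P: "P (word []) = snd b (word [])" .
  show ?thesis
    unfolding Z_def P
  proof (intro CollectI ballI allI)
    fix i m assume "i \<in> X"
    then have i: "i \<in> I" using X by blast
    obtain c where c: "bracket L (e i) (fst b) - scaling L c (co i) \<in> n_minus L"
      "\<And>t m. Poly_Mapping.lookup (snd b t) (replicate m i) = (if m = 0 then 0 else c * Poly_Mapping.lookup t (replicate (m - 1) i))"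
      using gen_Sm_coeff[OF i *(3)] by blast
    have "- scaling L c (co i) \<in> n_minus L" using c(1) 0(2) by simp
    moreover have "scaling L c (co i) \<in> cartan L"
      by (rule A.G.subspace_scale[OF cartan_subspace chevalley(3)[OF i]])
    ultimately have "scaling L c (co i) = 0"
      using triangular_zero[OF A.G.subspace_0[OF n_subspace(1)], of "scaling L c (co i)" "- scaling L c (co i)"] by simp
    moreover have "co i \<noteq> 0" using chevalley(4)[OF i] dual_at_zero[OF simple_dual[OF i]] by auto
    ultimately have "c = 0" by simp
    then show "Poly_Mapping.lookup (snd b (word [])) (replicate m i) = 0" using c(2) by simp
  qed
qed

text \<open>The type of letters may be larger than \<open>I\<close>. Letters outside
  \<open>I\<close> have no counterpart in \<open>L\<close>, so the module is built on words in
  \<open>I\<close> only.\<close>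

definition TI :: "'i words set" where "TI = {t. \<forall>w\<in>Poly_Mapping.keys t. set w \<subseteq> I}"

lemma TI_iff: "t \<in> TI \<longleftrightarrow> (\<forall>w. \<not> set w \<subseteq> I \<longrightarrow> Poly_Mapping.lookup t w = 0)"
  by (auto simp: TI_def in_keys_iff)

lemma TI_subspace: "WS.subspace TI"
  by (rule WS.subspaceI) (auto simp: TI_iff lookup_add words_scale_lookup)

lemma TI_word: "set w \<subseteq> I \<Longrightarrow> word w \<in> TI"
  by (simp add: TI_def word_def)

lemma TI_induct [consumes 1, case_names word add scale zero]:
  assumes "t \<in> TI" "\<And>w. set w \<subseteq> I \<Longrightarrow> P (word w)" "\<And>x y. P x \<Longrightarrow> P y \<Longrightarrow> P (x + y)"
    "\<And>c x. P x \<Longrightarrow> P (words_scale c x)" "P 0"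
  shows "P t"
  by (rule word_span_induct[of t "{w. set w \<subseteq> I}"]) (use assms in \<open>auto simp: TI_def\<close>)

lemma TI_preserved:
  assumes "lin P" "\<And>w. set w \<subseteq> I \<Longrightarrow> P (word w) \<in> TI" "t \<in> TI"
  shows "P t \<in> TI"
  using assms(3)
  by (induction rule: TI_induct)
    (use assms(1,2) TI_subspace in \<open>auto simp: linD WS.subspace_0 WS.subspace_add WS.subspace_scale\<close>)

lemma F_TI: "j \<in> I \<Longrightarrow> t \<in> TI \<Longrightarrow> F j t \<in> TI"
  by (rule TI_preserved[OF lin_ops(2)]) (simp_all add: left_mult_word TI_word)

lemma H_TI: "t \<in> TI \<Longrightarrow> H h t \<in> TI"
  by (rule TI_preserved[OF lin_ops(1)]) (auto simp: H_word intro: WS.subspace_scale[OF TI_subspace] TI_word)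

lemma Ew_TI: "set w \<subseteq> I \<Longrightarrow> Ew i w \<in> TI"
  by (induction w)
    (auto simp: WS.subspace_0[OF TI_subspace] intro!: WS.subspace_add[OF TI_subspace] F_TI H_TI TI_word)

lemma E_TI: "t \<in> TI \<Longrightarrow> E i t \<in> TI"
  by (rule TI_preserved[OF lin_ops(3)]) (auto simp: E_word Ew_TI)

definition gens :: "('i words \<Rightarrow> 'i words) set"
  where "gens = snd ` (Sp \<union> Sm \<union> S0)"

lemma gens_lin: "g \<in> gens \<Longrightarrow> lin g"
  unfolding gens_def using S_lin by blast

lemma gens_TI: "g \<in> gens \<Longrightarrow> t \<in> TI \<Longrightarrow> g t \<in> TI"
  unfolding gens_def Sp_def Sm_def S0_def using E_TI F_TI H_TI by auto

text \<open>The largest subspace of \<open>Z\<close> stable under the generators, described by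
  testing all products of generators; \<open>K_largest\<close> gives maximality.\<close>

definition K :: "'i words set"
  where "K = {t. \<forall>gs. set gs \<subseteq> gens \<longrightarrow> foldr (\<lambda>g. g) gs t \<in> Z}"

lemma foldr_lin: "set gs \<subseteq> gens \<Longrightarrow> lin (foldr (\<lambda>g. g) gs)"
proof (induction gs)
  case Nil
  show ?case by (rule linI) auto
next
  case (Cons g gs)
  then have "lin g" "lin (foldr (\<lambda>g. g) gs)" using gens_lin by auto
  then show ?case by (intro linI) (simp_all add: linD)
qed

lemma K_subspace: "WS.subspace K"
proof (rule WS.subspaceI)
  show "0 \<in> K" using WS.subspace_0[OF Z_subspace] linD(4)[OF foldr_lin] by (simp add: K_def)
  show "x + y \<in> K" if "x \<in> K" "y \<in> K" for x y
    using that WS.subspace_add[OF Z_subspace] linD(1)[OF foldr_lin] by (simp add: K_def)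
  show "words_scale c x \<in> K" if "x \<in> K" for x c
    using that WS.subspace_scale[OF Z_subspace] linD(3)[OF foldr_lin] by (simp add: K_def)
qed

lemma K_subset_Z: "K \<subseteq> Z"
proof
  fix t assume "t \<in> K"
  then have "set [] \<subseteq> gens \<longrightarrow> foldr (\<lambda>g. g) [] t \<in> Z" unfolding K_def by blast
  then show "t \<in> Z" by simp
qed

lemma K_gens: "g \<in> gens \<Longrightarrow> t \<in> K \<Longrightarrow> g t \<in> K"
proof -
  assume g: "g \<in> gens" and t: "t \<in> K"
  have "foldr (\<lambda>g. g) gs (g t) \<in> Z" if "set gs \<subseteq> gens" for gs
  proof -
    have "set (gs @ [g]) \<subseteq> gens" using that g by simp
    then have "foldr (\<lambda>g. g) (gs @ [g]) t \<in> Z" using t unfolding K_def by blast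
    then show ?thesis by simp
  qed
  then show ?thesis by (simp add: K_def)
qed

lemma K_largest:
  assumes "M \<subseteq> Z" "\<And>g t. g \<in> gens \<Longrightarrow> t \<in> M \<Longrightarrow> g t \<in> M"
  shows "M \<subseteq> K"
proof
  fix t assume t: "t \<in> M"
  have "foldr (\<lambda>g. g) gs t \<in> M" if "set gs \<subseteq> gens" for gs
    using that by (induction gs) (auto simp: t assms(2))
  then show "t \<in> K" using assms(1) by (auto simp: K_def)
qed

lemma LL_stable:
  assumes N: "WS.subspace N" "\<And>g t. g \<in> gens \<Longrightarrow> t \<in> N \<Longrightarrow> g t \<in> N" and p: "p \<in> LL"
  shows "t \<in> N \<Longrightarrow> snd p t \<in> N"
  using p unfolding LL_def
proof (induction arbitrary: t rule: gen.induct)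
  case (base s)
  then show ?case using N(2) unfolding gens_def by blast
qed (use N(1) in \<open>auto simp: WS.subspace_0 WS.subspace_add WS.subspace_scale WS.subspace_diff\<close>)

text \<open>Elements over 0 form an ideal of \<open>LL\<close>, so the commutator of
  \<open>P\<close> with \<open>F j\<close> is again such an operator. By induction P(j w) and F_j
  P(w) agree modulo \<open>Z\<close>, which \<open>F j\<close> preserves.\<close>

lemma LL_kernel_Z:
  assumes "(0, P) \<in> LL" "t \<in> TI"
  shows "P t \<in> Z"
proof -
  have w: "P (word w) \<in> Z" if "set w \<subseteq> I" "(0, P) \<in> LL" for w P
    using that
  proof (induction w arbitrary: P)
    case Nil
    then show ?case using LL_kernel_Nil by blast
  next
    case (Cons j w)
    then have j: "j \<in> I" "set w \<subseteq> I" by auto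
    have "(f j, F j) \<in> LL" using gens_subset_LL(2) gen.base j(1) unfolding Sm_def by blast
    then have "pb (0, P) (f j, F j) \<in> LL" using Cons.prems(2) unfolding LL_def by (intro gen.br)
    then have "(0, \<lambda>t. P (F j t) - F j (P t)) \<in> LL" by (simp add: pb_def)
    from Cons.IH[OF j(2) this] have "P (word (j # w)) - F j (P (word w)) \<in> Z" by (simp add: left_mult_word)
    moreover have "F j (P (word w)) \<in> Z" by (rule F_Z[OF Cons.IH[OF j(2) Cons.prems(2)]])
    ultimately have "(P (word (j # w)) - F j (P (word w))) + F j (P (word w)) \<in> Z"
      by (rule WS.subspace_add[OF Z_subspace])
    then show ?case by simp
  qed
  have lP: "lin P" using LL_lin[OF assms(1)] by simp
  show ?thesis using assms(2)
    by (induction rule: TI_induct)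
      (use w assms(1) Z_subspace in \<open>auto simp: linD[OF lP] WS.subspace_0 WS.subspace_add WS.subspace_scale\<close>)
qed

text \<open>For a generator g the commutator of g with \<open>P\<close> again lies over 0; moving
  \<open>P\<close> to the left through a product of generators keeps every term in
  \<open>Z\<close>.\<close>

lemma LL_kernel_K:
  assumes "(0, P) \<in> LL" "t \<in> TI"
  shows "P t \<in> K"
proof -
  have "foldr (\<lambda>g. g) gs (P t) \<in> Z" if "set gs \<subseteq> gens" "(0, P) \<in> LL" "t \<in> TI" for gs P t
    using that
  proof (induction gs arbitrary: P t rule: rev_induct)
    case Nil
    then show ?case using LL_kernel_Z by simp
  next
    case (snoc g gs)
    then have g: "g \<in> gens" "set gs \<subseteq> gens" by auto
    then obtain x where x: "(x, g) \<in> Sp \<union> Sm \<union> S0" unfolding gens_def by force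
    have "pb (x, g) (0, P) \<in> LL"
      using gen.br[OF gen.base[OF x]] snoc.prems(2) unfolding LL_def by blast
    then have "(0, \<lambda>t. g (P t) - P (g t)) \<in> LL" by (simp add: pb_def)
    from snoc.IH[OF g(2) this snoc.prems(3)] have "foldr (\<lambda>g. g) gs (g (P t)) - foldr (\<lambda>g. g) gs (P (g t)) \<in> Z"
      by (simp add: linD(2)[OF foldr_lin[OF g(2)]])
    moreover have "foldr (\<lambda>g. g) gs (P (g t)) \<in> Z"
      by (rule snoc.IH[OF g(2) snoc.prems(2) gens_TI[OF g(1) snoc.prems(3)]])
    ultimately have "(foldr (\<lambda>g. g) gs (g (P t)) - foldr (\<lambda>g. g) gs (P (g t))) + foldr (\<lambda>g. g) gs (P (g t)) \<in> Z"
      by (rule WS.subspace_add[OF Z_subspace])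
    then show ?case by simp
  qed
  then show ?thesis using assms unfolding K_def by blast
qed

subsection \<open>Singular words\<close>

text \<open>The words ending in \<open>s\<close> span a subspace stable under all generators: when
  \<open>E i\<close> is moved through to \<open>s\<close>, nothing remains there. The premise
  \<open>out\<close> puts this subspace into \<open>Z\<close>.\<close>

lemma singular_in_K:
  assumes s: "set s \<subseteq> I" "\<And>i. i \<in> I \<Longrightarrow> Ew i s = 0" and out: "\<And>w i m. i \<in> X \<Longrightarrow> w @ s \<noteq> replicate m i"
  shows "word s \<in> K"
proof -
  define M where "M = WS.span ((\<lambda>w. word (w @ s)) ` {w. set w \<subseteq> I})"
  have base: "word (w @ s) \<in> M" if "set w \<subseteq> I" for w
    unfolding M_def using that by (intro WS.span_base imageI) simp
  have M: "WS.subspace M" unfolding M_def by simp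
  have stable: "P t \<in> M" if P: "lin P" "\<And>w. set w \<subseteq> I \<Longrightarrow> P (word (w @ s)) \<in> M" and t: "t \<in> M" for P t
  proof -
    have "WS.subspace {t. P t \<in> M}"
      by (rule WS.subspaceI) (use M P(1) in \<open>auto simp: linD WS.subspace_0 WS.subspace_add WS.subspace_scale\<close>)
    then have "M \<subseteq> {t. P t \<in> M}" using P(2) by (subst M_def, intro WS.span_minimal) auto
    then show ?thesis using t by blast
  qed
  have FM: "F j t \<in> M" if "j \<in> I" "t \<in> M" for j t
  proof (rule stable[OF lin_ops(2) _ that(2)])
    fix w assume "set w \<subseteq> I"
    then show "F j (word (w @ s)) \<in> M" using base[of "j # w"] that(1) by (simp add: left_mult_word)
  qed
  have HM: "H h t \<in> M" if "t \<in> M" for h t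
    by (rule stable[OF lin_ops(1) _ that]) (simp add: H_word base WS.subspace_scale[OF M])
  have Ews: "Ew i (w @ s) \<in> M" if "i \<in> I" "set w \<subseteq> I" for i w
    using that(2)
  proof (induction w)
    case Nil
    then show ?case using s(2)[OF that(1)] WS.subspace_0[OF M] by simp
  next
    case (Cons j w)
    then show ?case
      using FM HM base[of w] WS.subspace_0[OF M] by (auto intro!: WS.subspace_add[OF M])
  qed
  have EM: "E i t \<in> M" if "i \<in> I" "t \<in> M" for i t
    by (rule stable[OF lin_ops(3) _ that(2)]) (simp add: E_word Ews that(1))
  have "M \<subseteq> Z" unfolding M_def
    by (rule WS.span_minimal[OF _ Z_subspace]) (use out in \<open>auto simp: Z_def word_def lookup_single when_def\<close>)
  then have "M \<subseteq> K"
    by (rule K_largest) (use FM HM EM in \<open>auto simp: gens_def Sp_def Sm_def S0_def\<close>)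
  then show ?thesis using base[of "[]"] by auto
qed

lemma Ew_replicate_append_other: "i \<noteq> j \<Longrightarrow> Ew i s = 0 \<Longrightarrow> Ew i (replicate m j @ s) = 0"
  by (induction m) (auto simp: F_lin)

text \<open>The sl2 identity on the free algebra; its factor m (n - m + 1) vanishes at m = n + 1,
  which is what \<open>Ew_singular\<close> uses. The truncated \<open>m - 1\<close> at m = 0 is
  harmless, as the factor is 0 there.\<close>

lemma Ew_replicate_append:
  assumes j: "j \<in> I" and s: "Ew j s = 0" "wgt s (co j) = of_nat n"
  shows "Ew j (replicate m j @ s) = words_scale (of_nat m * (of_nat n - of_nat m + 1)) (word (replicate (m - 1) j @ s))"
proof (induction m)
  case 0
  then show ?case using s(1) by simp
next
  case (Suc m)
  have wgt: "wgt (replicate m j @ s) (co j) = of_nat n - 2 * of_nat m"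
    by (induction m) (use j s(2) chevalley(4)[OF j] in \<open>simp_all add: wgt_Cons\<close>)
  have F: "F j (Ew j (replicate m j @ s)) = words_scale (of_nat m * (of_nat n - of_nat m + 1)) (word (replicate m j @ s))"
  proof (cases m)
    case 0
    then show ?thesis using s(1) by (simp add: F_lin)
  next
    case (Suc k)
    then show ?thesis unfolding Suc.IH by (simp add: \<open>Ew j (replicate m j @ s) = _\<close> F_lin left_mult_word)
  qed
  have "Ew j (replicate (Suc m) j @ s) = F j (Ew j (replicate m j @ s)) + H (co j) (word (replicate m j @ s))"
    by simp
  also have "\<dots> = words_scale (of_nat m * (of_nat n - of_nat m + 1) + (of_nat n - 2 * of_nat m)) (word (replicate m j @ s))"
    unfolding F H_word wgt by (rule WS.scale_left_distrib[symmetric])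
  also have "of_nat m * (of_nat n - of_nat m + 1) + (of_nat n - 2 * of_nat m)
      = (of_nat (Suc m) * (of_nat n - of_nat (Suc m) + 1) :: complex)"
    by (simp add: algebra_simps)
  finally show ?case by simp
qed

lemma Ew_singular:
  assumes j: "j \<in> I" and s: "\<And>i. i \<in> I \<Longrightarrow> Ew i s = 0" "wgt s (co j) = of_nat n" and i: "i \<in> I"
  shows "Ew i (replicate (Suc n) j @ s) = 0"
proof (cases "i = j")
  case True
  then show ?thesis using Ew_replicate_append[OF j s(1)[OF j] s(2), of "Suc n"] by simp
next
  case False
  then show ?thesis using Ew_replicate_append_other s(1)[OF i] by blast
qed

end

section \<open>The highest weight module with prescribed integrable nodes\<close>

context free_verma
begin

text \<open>An arbitrary lift of \<open>x\<close> to \<open>LL\<close>. By \<open>Xop_cong\<close>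
  two lifts agree on \<open>TI\<close> modulo \<open>K\<close>, so \<open>L\<close> acts on the
  quotient of \<open>TI\<close> by \<open>K\<close>.\<close>

definition Xop :: "'g \<Rightarrow> 'i words \<Rightarrow> 'i words" where "Xop x = (SOME P. (x, P) \<in> LL)"

lemma Xop: "(x, Xop x) \<in> LL"
  unfolding Xop_def using LL_surj by (rule someI_ex)

lemma Xop_lin: "lin (Xop x)"
  using LL_lin[OF Xop] by simp

lemma Xop_TI: "t \<in> TI \<Longrightarrow> Xop x t \<in> TI"
  using LL_stable[where N = TI and p = "(x, Xop x)"] TI_subspace gens_TI Xop by simp

lemma Xop_K: "t \<in> K \<Longrightarrow> Xop x t \<in> K"
  using LL_stable[where N = K and p = "(x, Xop x)"] K_subspace K_gens Xop by simp

lemma Xop_cong: "(x, P) \<in> LL \<Longrightarrow> t \<in> TI \<Longrightarrow> Xop x t - P t \<in> K"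
proof -
  assume P: "(x, P) \<in> LL" and t: "t \<in> TI"
  have "(x, Xop x) + ps (-1) (x, P) \<in> LL" using Xop P unfolding LL_def by (intro gen.add gen.scale)
  moreover have "(x, Xop x) + ps (-1) (x, P) = (0, \<lambda>t. Xop x t - P t)"
    by (rule pair_eqI) simp_all
  ultimately show ?thesis using LL_kernel_K[of "\<lambda>t. Xop x t - P t"] t by simp
qed

primrec Phi_word :: "'g list \<Rightarrow> 'i words" where
  "Phi_word [] = word []"
| "Phi_word (x # w) = Xop x (Phi_word w)"

lemma Phi_word_TI: "Phi_word w \<in> TI"
  by (induction w) (auto intro: Xop_TI TI_word)

lemma Phi_word_append: "Phi_word (u @ w) = foldr Xop u (Phi_word w)"
  by (induction u) auto

lemma foldr_Xop_lin: "lin (foldr Xop u)"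
proof (induction u)
  case Nil
  show ?case by (rule linI) auto
next
  case (Cons x u)
  then show ?case by (intro linI) (simp_all add: linD Xop_lin)
qed

lemma foldr_Xop_K: "t \<in> K \<Longrightarrow> foldr Xop u t \<in> K"
  by (induction u) (auto intro: Xop_K)

text \<open>Sums, multiples and brackets of lifts are themselves lifts, so \<open>Xop_cong\<close>
  compares them with the chosen ones.\<close>

lemma Xop_relations:
  assumes "t \<in> TI"
  shows "Xop (x + y) t - (Xop x t + Xop y t) \<in> K"
    and "Xop (scaling L c x) t - words_scale c (Xop x t) \<in> K"
    and "Xop (bracket L x y) t - (Xop x (Xop y t) - Xop y (Xop x t)) \<in> K"
proof -
  have "(x, Xop x) + (y, Xop y) \<in> LL" "ps c (x, Xop x) \<in> LL" "pb (x, Xop x) (y, Xop y) \<in> LL"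
    using Xop unfolding LL_def by (blast intro: gen.intros)+
  then have "(x + y, \<lambda>t. Xop x t + Xop y t) \<in> LL" "(scaling L c x, \<lambda>t. words_scale c (Xop x t)) \<in> LL"
    "(bracket L x y, \<lambda>t. Xop x (Xop y t) - Xop y (Xop x t)) \<in> LL"
    by (simp_all add: ps_def pb_def plus_fun_def)
  from this[THEN Xop_cong, OF assms] show
    "Xop (x + y) t - (Xop x t + Xop y t) \<in> K"
    "Xop (scaling L c x) t - words_scale c (Xop x t) \<in> K"
    "Xop (bracket L x y) t - (Xop x (Xop y t) - Xop y (Xop x t)) \<in> K" .
qed

lemma Xop_highest_weight:
  shows "x \<in> n_plus L \<Longrightarrow> Xop x (word []) \<in> K"
    and "h \<in> cartan L \<Longrightarrow> Xop h (word []) - words_scale (lam h) (word []) \<in> K"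
proof -
  have Nil: "word [] \<in> TI" by (rule TI_word) simp
  show "Xop x (word []) \<in> K" if "x \<in> n_plus L"
  proof -
    have "x \<in> fst ` gen Sp" using that n_plus_subset by blast
    then obtain p where p: "p \<in> gen Sp" "x = fst p" by blast
    then have "(x, snd p) \<in> LL" using gens_subset_LL(1) by auto
    from Xop_cong[OF this Nil] show ?thesis by (simp add: gen_Sp_Nil[OF p(1)])
  qed
  show "Xop h (word []) - words_scale (lam h) (word []) \<in> K" if "h \<in> cartan L"
  proof -
    have "(h, H h) \<in> LL" using that gens_subset_LL(3) unfolding S0_def by blast
    from Xop_cong[OF this Nil] show ?thesis by (simp add: H_word wgt_Nil)
  qed
qed

text \<open>Kernel of the map that lets a word in \<open>L\<close> act on the empty node word modulo
  \<open>K\<close>: the left ideal defining the quotient module.\<close>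

definition N :: "'g words set" where "N = {p. lin_ext Phi_word p \<in> K}"

lemmas Phi_lin = linD[OF lin_lin_ext[of Phi_word]]

lemma N_subspace: "WS.subspace N"
  by (rule WS.subspaceI)
    (use K_subspace in \<open>auto simp: N_def Phi_lin WS.subspace_0 WS.subspace_add WS.subspace_scale\<close>)

lemma Phi_left_mult: "lin_ext Phi_word (left_mult x p) = Xop x (lin_ext Phi_word p)"
proof (rule lin_eqI[where f = "\<lambda>p. lin_ext Phi_word (left_mult x p)" and g = "\<lambda>p. Xop x (lin_ext Phi_word p)" and p = p])
  show "lin (\<lambda>p. lin_ext Phi_word (left_mult x p))" "lin (\<lambda>p. Xop x (lin_ext Phi_word p))"
    by (rule linI; simp add: Phi_lin linD[OF lin_left_mult] linD[OF Xop_lin])+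
qed (simp add: left_mult_word)

text \<open>Each relation acts by 0 modulo \<open>K\<close> at its place in the word, and the
  letters to its left preserve \<open>K\<close>.\<close>

lemma verma_kernel_subset_N: "verma_kernel L lam \<subseteq> N"
  unfolding verma_kernel_def
proof (rule WS.span_minimal[OF _ N_subspace], intro Un_least)
  show "env_relations L \<subseteq> N"
    unfolding env_relations_def
  proof (intro Un_least subsetI)
    fix p :: "'g words" assume "p \<in> {word (u @ [x + y] @ w) - word (u @ [x] @ w) - word (u @ [y] @ w) |u w x y. True}"
    then obtain u w x y where p: "p = word (u @ [x + y] @ w) - word (u @ [x] @ w) - word (u @ [y] @ w)" by blast
    have "lin_ext Phi_word p = foldr Xop u (Xop (x + y) (Phi_word w) - (Xop x (Phi_word w) + Xop y (Phi_word w)))"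
      unfolding p by (simp add: Phi_lin Phi_word_append linD[OF foldr_Xop_lin])
    then show "p \<in> N" using foldr_Xop_K[OF Xop_relations(1)[OF Phi_word_TI]] by (simp add: N_def)
  next
    fix p :: "'g words" assume "p \<in> {word (u @ [scaling L c x] @ w) - words_scale c (word (u @ [x] @ w)) |u w c x. True}"
    then obtain u w c x where p: "p = word (u @ [scaling L c x] @ w) - words_scale c (word (u @ [x] @ w))" by blast
    have "lin_ext Phi_word p = foldr Xop u (Xop (scaling L c x) (Phi_word w) - words_scale c (Xop x (Phi_word w)))"
      unfolding p by (simp add: Phi_lin Phi_word_append linD[OF foldr_Xop_lin])
    then show "p \<in> N" using foldr_Xop_K[OF Xop_relations(2)[OF Phi_word_TI]] by (simp add: N_def)
  next
    fix p :: "'g words" assume "p \<in> {word (u @ [x, y] @ w) - word (u @ [y, x] @ w) - word (u @ [bracket L x y] @ w) |u w x y. True}"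
    then obtain u w x y where p: "p = word (u @ [x, y] @ w) - word (u @ [y, x] @ w) - word (u @ [bracket L x y] @ w)" by blast
    \<comment> \<open>The enveloping relation and \<open>Xop_relations\<close> list the bracket with
      opposite signs, hence - p.\<close>
    have "lin_ext Phi_word (- p) = foldr Xop u (Xop (bracket L x y) (Phi_word w) - (Xop x (Xop y (Phi_word w)) - Xop y (Xop x (Phi_word w))))"
      unfolding p by (simp add: Phi_lin Phi_word_append linD[OF foldr_Xop_lin])
    then have "- p \<in> N" using foldr_Xop_K[OF Xop_relations(3)[OF Phi_word_TI]] by (simp add: N_def)
    then show "p \<in> N" using WS.subspace_neg[OF N_subspace, of "- p"] by simp
  qed
  show "{word (u @ [x]) |u x. x \<in> n_plus L} \<subseteq> N"
  proof
    fix p :: "'g words" assume "p \<in> {word (u @ [x]) |u x. x \<in> n_plus L}"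
    then obtain u x where p: "p = word (u @ [x])" "x \<in> n_plus L" by blast
    then show "p \<in> N" using foldr_Xop_K[OF Xop_highest_weight(1)] by (simp add: N_def Phi_word_append)
  qed
  show "{word (u @ [h]) - words_scale (lam h) (word u) |u h. h \<in> cartan L} \<subseteq> N"
  proof
    fix p :: "'g words" assume "p \<in> {word (u @ [h]) - words_scale (lam h) (word u) |u h. h \<in> cartan L}"
    then obtain u h where p: "p = word (u @ [h]) - words_scale (lam h) (word u)" "h \<in> cartan L" by blast
    have "lin_ext Phi_word p = foldr Xop u (Xop h (word []) - words_scale (lam h) (word []))"
      unfolding p(1) using Phi_word_append[of u "[]"] by (simp add: Phi_lin Phi_word_append linD[OF foldr_Xop_lin])
    then show "p \<in> N" using foldr_Xop_K[OF Xop_highest_weight(2)[OF p(2)]] by (simp add: N_def)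
  qed
qed

lemma replicate_notin_K: "i \<in> X \<Longrightarrow> word (replicate m i) \<notin> K"
  using K_subset_Z by (force simp: Z_def word_def)

lemma Nil_notin_N: "word [] \<notin> N"
  using X(2) replicate_notin_K[of _ 0] by (auto simp: N_def)

text \<open>\<open>F j\<close> is a lift of \<open>f j\<close>, so lowering words act on the empty
  word as concatenation, modulo \<open>K\<close>.\<close>

lemma Phi_map_f: "set w \<subseteq> I \<Longrightarrow> lin_ext Phi_word (word (map f w)) - word w \<in> K"
proof (induction w)
  case Nil
  show ?case using WS.subspace_0[OF K_subspace] by simp
next
  case (Cons j w)
  then have j: "j \<in> I" "set w \<subseteq> I" by auto
  have "(f j, F j) \<in> LL" using gens_subset_LL(2) gen.base j(1) unfolding Sm_def by blast
  from Xop_cong[OF this TI_word[OF j(2)]] have "Xop (f j) (word w) - word (j # w) \<in> K"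
    by (simp add: left_mult_word)
  from WS.subspace_add[OF K_subspace Xop_K[OF Cons.IH[OF j(2)], of "f j"] this]
  show ?case by (simp add: linD[OF Xop_lin])
qed

lemma map_f_in_N_iff: "set w \<subseteq> I \<Longrightarrow> word (map f w) \<in> N \<longleftrightarrow> word w \<in> K"
proof -
  assume w: "set w \<subseteq> I"
  have "lin_ext Phi_word (word (map f w)) = (lin_ext Phi_word (word (map f w)) - word w) + word w"
    "word w = lin_ext Phi_word (word (map f w)) - (lin_ext Phi_word (word (map f w)) - word w)" by simp_all
  then show ?thesis
    unfolding N_def using Phi_map_f[OF w] WS.subspace_add[OF K_subspace] WS.subspace_diff[OF K_subspace]
    by (metis mem_Collect_eq)
qed

lemma append_replicate_Suc_neq: "i \<noteq> j \<Longrightarrow> w @ replicate (Suc n) j @ s \<noteq> replicate m i"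
proof
  assume "i \<noteq> j" "w @ replicate (Suc n) j @ s = replicate m i"
  then have "j \<in> set (replicate m i)" by (metis in_set_conv_decomp replicate_Suc append_Cons)
  then show False using \<open>i \<noteq> j\<close> by (simp split: if_splits)
qed

text \<open>This power is singular, and any word ending in it contains the letter \<open>j\<close>,
  which is not in \<open>X\<close>.\<close>

lemma replicate_in_K:
  assumes "j \<in> I - X" "lam (co j) = of_nat n"
  shows "word (replicate (Suc n) j) \<in> K"
proof -
  have sing: "Ew i (replicate (Suc n) j @ []) = 0" if "i \<in> I" for i
    using Ew_singular[of j "[]" n i] assms that by (simp only: wgt_Nil Ew.simps) blast
  have out: "w @ replicate (Suc n) j \<noteq> replicate m i" if "i \<in> X" for w i m
  proof -
    have "i \<noteq> j" using that assms(1) by blast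
    from append_replicate_Suc_neq[OF this, of w n "[]" m] show ?thesis by simp
  qed
  have "set (replicate (Suc n) j) \<subseteq> I" using assms(1) by auto
  from singular_in_K[OF this sing[unfolded append_Nil2] out] show ?thesis .
qed

text \<open>The power of \<open>k\<close> is singular and, by orthogonality, has the same value
  \<open>m\<close> at h_j as the empty word, so the power of \<open>j\<close> on top of it is
  singular too. Two distinct letters occur, so no extension is a power of one letter, even if both
  lie in \<open>X\<close>.\<close>

lemma replicate_pair_in_K:
  assumes "j \<in> I" "k \<in> I" "j \<noteq> k" "\<alpha> k (co j) = 0" "lam (co j) = of_nat m" "lam (co k) = of_nat n"
  shows "word (replicate (Suc m) j @ replicate (Suc n) k) \<in> K"
proof (rule singular_in_K)
  show "set (replicate (Suc m) j @ replicate (Suc n) k) \<subseteq> I" using assms(1,2) by auto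
  have s: "Ew i (replicate (Suc n) k) = 0" if "i \<in> I" for i
    using Ew_singular[of k "[]" n i] assms that by (simp add: wgt_Nil)
  have wgt: "wgt (replicate l k) (co j) = of_nat m" for l
    by (induction l) (use assms in \<open>simp_all add: wgt_Cons wgt_Nil\<close>)
  show "Ew i (replicate (Suc m) j @ replicate (Suc n) k) = 0" if "i \<in> I" for i
    using Ew_singular[OF assms(1) s wgt that] .
  fix w i l
  show "w @ replicate (Suc m) j @ replicate (Suc n) k \<noteq> replicate l i"
  proof (cases "i = j")
    case True
    then have "i \<noteq> k" using assms(3) by simp
    from append_replicate_Suc_neq[OF this, of "w @ replicate (Suc m) j" n "[]" l] show ?thesis by simp
  qed (rule append_replicate_Suc_neq)
qed

lemma ex_highest_weight_module:
  assumes XJ: "X \<subseteq> J_weight L lam"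
  shows "\<exists>(V :: ('g, 'g words) lie_module) v. highest_weight_module L lam V v \<and>
    J_module L lam V v = J_weight L lam - X \<and>
    (\<forall>j\<in>X. \<forall>k\<in>X. \<forall>m n. j \<noteq> k \<and> \<alpha> k (co j) = 0 \<and> lam (co j) = of_nat m \<and> lam (co k) = of_nat n \<longrightarrow>
      (act V (f j) ^^ Suc m) ((act V (f k) ^^ Suc n) v) = 0)"
proof -
  have "left_mult x p \<in> N" if "p \<in> N" for x p
    using that Xop_K by (simp add: N_def Phi_left_mult)
  from ex_quotient_module[OF N_subspace verma_kernel_subset_N this Nil_notin_N]
  obtain V :: "('g, 'g words) lie_module" and \<phi> where V: "highest_weight_module L lam V (\<phi> (word []))"
    and zero: "\<And>p. \<phi> p = 0 \<longleftrightarrow> p \<in> N" and act: "\<And>x p. act V x (\<phi> p) = \<phi> (left_mult x p)" by blast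
  let ?v = "\<phi> (word [])"
  have pow: "(act V (f j) ^^ m) (\<phi> (word (map f w))) = \<phi> (word (map f (replicate m j @ w)))" for j m w
    by (induction m) (simp_all add: act left_mult_word)
  have fw: "(act V (f j) ^^ m) ((act V (f k) ^^ n) ?v) = 0 \<longleftrightarrow> word (replicate m j @ replicate n k) \<in> K"
    if "j \<in> I" "k \<in> I" for j k m n
  proof -
    have "set (replicate m j @ replicate n k) \<subseteq> I" using that by auto
    from map_f_in_N_iff[OF this] show ?thesis
      using pow[of n k "[]"] pow[of m j "replicate n k"] zero by simp
  qed
  have fw1: "(act V (f j) ^^ m) ?v = 0 \<longleftrightarrow> word (replicate m j) \<in> K" if "j \<in> I" for j m
    using fw[OF that that, of m 0] by simp
  have JI: "J_weight L lam \<subseteq> I" by (auto simp: J_weight_def)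
  have "J_module L lam V ?v = J_weight L lam - X"
  proof (intro equalityI subsetI)
    fix j assume "j \<in> J_module L lam V ?v"
    then obtain n where j: "j \<in> J_weight L lam" "(act V (f j) ^^ (n + 1)) ?v = 0" unfolding J_module_def by blast
    then have "word (replicate (n + 1) j) \<in> K" using fw1 JI by blast
    then show "j \<in> J_weight L lam - X" using j(1) replicate_notin_K by blast
  next
    fix j assume j: "j \<in> J_weight L lam - X"
    then obtain n where n: "lam (co j) = of_nat n" unfolding J_weight_def Nats_def by blast
    have "word (replicate (Suc n) j) \<in> K" using j JI n by (intro replicate_in_K) auto
    then have "(act V (f j) ^^ (n + 1)) ?v = 0" using fw1[of j "n + 1"] j JI by (simp only: Suc_eq_plus1) blast
    then show "j \<in> J_module L lam V ?v" using j n unfolding J_module_def by blast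
  qed
  moreover have "(act V (f j) ^^ Suc m) ((act V (f k) ^^ Suc n) ?v) = 0"
    if "j \<in> X" "k \<in> X" "j \<noteq> k" "\<alpha> k (co j) = 0" "lam (co j) = of_nat m" "lam (co k) = of_nat n" for j k m n
  proof -
    have "j \<in> I" "k \<in> I" using that(1,2) X by auto
    then show ?thesis using fw[of j k "Suc m" "Suc n"] replicate_pair_in_K[of j k m n] that by blast
  qed
  ultimately show ?thesis using V by blast
qed

end

section \<open>Failure of convexity for two orthogonal missing nodes\<close>

lemma (in split_lie) content_append: "content (w @ w') = content w + content w'"
  by (simp flip: lc_add)

text \<open>The two lowering operators commute, so a word in \<open>i\<close> and \<open>k\<close>
  acts according to its letter counts alone.\<close>

lemma (in split_rep) fw_sort:
  assumes ik: "i \<noteq> k" and comm: "bracket L (f i) (f k) = 0" and u: "u \<in> space V" and w: "set w \<subseteq> {i, k}"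
  shows "fw w u = fw (replicate (count_list w i) i @ replicate (count_list w k) k) u"
  using w
proof (induction w)
  case (Cons j w)
  have swap: "act V (f k) ((act V (f i) ^^ m) x) = (act V (f i) ^^ m) (act V (f k) x)" if "x \<in> space V" for m x
  proof (induction m)
    case (Suc m)
    have "act V (bracket L (f i) (f k)) ((act V (f i) ^^ m) x) = 0"
      unfolding comm using that by (simp add: R.act_pow_closed)
    then show ?case
      using Suc R.act_br[OF R.act_pow_closed[OF that, where x = "f i" and k = m], of "f i" "f k"] by simp
  qed simp
  show ?case
  proof (cases "j = i")
    case True
    then show ?thesis using Cons ik by simp
  next
    case False
    then have "j = k" using Cons.prems by auto
    then show ?thesis
      using Cons ik swap[OF R.act_pow_closed[OF u]] by (simp add: fw_append fw_replicate)
  qed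
qed simp

text \<open>A word with the content of \<open>?w\<close> can use only the letters \<open>i\<close>
  and \<open>k\<close>, so after sorting it acts on \<open>v\<close> exactly as the vanishing
  product in \<open>zero\<close>; that weight is therefore lost.\<close>

lemma (in hw_module) not_wt_convex:
  assumes i: "i \<in> J_weight L lam - J" and k: "k \<in> J_weight L lam - J" and ik: "i \<noteq> k"
    and orth: "\<alpha> k (co i) = 0" and zero: "(act V (f i) ^^ a) ((act V (f k) ^^ b) v) = 0"
  shows "\<not> wt_convex L lam V"
proof
  assume "wt_convex L lam V"
  then have conv: "wt L V = {lam - \<gamma> |\<gamma>. \<gamma> \<in> root_lattice L} \<inter> convex hull (wt L V)"
    by (simp add: wt_convex_def)
  have I: "i \<in> I" "k \<in> I" using i k by (auto simp: J_weight_def)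
  have comm: "bracket L (f i) (f k) = 0" by (rule cartan_entry(2)[OF I ik orth])
  let ?w = "replicate a i @ replicate b k"
  have wI: "set ?w \<subseteq> I" using I by auto
  have ray: "lam - content (replicate n j) \<in> wt L V" if "j \<in> J_weight L lam - J" for j n
  proof -
    have "set (replicate n j) \<subseteq> I" using that by (auto simp: J_weight_def)
    moreover have "fw (replicate n j) v \<noteq> 0" using f_pow_v_nonzero that by (simp add: fw_replicate)
    ultimately show ?thesis unfolding wt_iff by blast
  qed
  have "lam - content ?w \<in> convex hull (wt L V)"
  proof -
    have "(1/2) *\<^sub>R (lam - content (replicate (a + a) i)) + (1/2) *\<^sub>R (lam - content (replicate (b + b) k))
        \<in> convex hull (wt L V)"
      using convex_convex_hull hull_inc[OF ray[OF i]] hull_inc[OF ray[OF k]] by (rule convexD) auto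
    also have "(1/2) *\<^sub>R (lam - content (replicate (a + a) i)) + (1/2) *\<^sub>R (lam - content (replicate (b + b) k))
        = lam - content ?w"
    proof
      fix x
      show "((1/2) *\<^sub>R (lam - content (replicate (a + a) i)) + (1/2) *\<^sub>R (lam - content (replicate (b + b) k))) x
          = (lam - content ?w) x"
        unfolding replicate_add content_append
        by (simp add: scaleR_fun_def scaleR_conv_of_real field_simps)
    qed
    finally show ?thesis .
  qed
  moreover have "lam - content ?w \<in> {lam - \<gamma> |\<gamma>. \<gamma> \<in> root_lattice L}"
  proof -
    have "content ?w = lc (\<lambda>i. of_int (int (count_list ?w i)))" by simp
    then have "content ?w \<in> root_lattice L"
      unfolding root_lattice_eq by (intro CollectI exI[of _ "\<lambda>i. int (count_list ?w i)"] conjI TrueI)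
    then show ?thesis by blast
  qed
  ultimately have "lam - content ?w \<in> wt L V" using conv by blast
  then obtain w where w: "set w \<subseteq> I" "fw w v \<noteq> 0" "lam - content ?w = lam - content w" unfolding wt_iff by blast
  have cnt: "count_list w j = count_list ?w j" if "j \<in> I" for j
  proof -
    have "(of_nat (count_list ?w j) :: complex) = of_nat (count_list w j)"
      using diff_left_injD[OF w(3)] that by (rule lc_inj)
    then show ?thesis by (simp only: of_nat_eq_iff)
  qed
  have rep: "count_list (replicate n j) l = (if j = l then n else 0)" for n and j l :: 'i
    by (induction n) auto
  have "set w \<subseteq> {i, k}"
  proof
    fix j assume j: "j \<in> set w"
    then have "count_list w j \<noteq> 0" by (simp add: count_list_0_iff)
    then have "count_list ?w j \<noteq> 0" using cnt w(1) j by auto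
    then show "j \<in> {i, k}" by (auto simp: rep split: if_splits)
  qed
  from fw_sort[OF ik comm v_space this] have "fw w v = fw ?w v"
    using cnt[OF I(1)] cnt[OF I(2)] ik by (simp add: rep)
  also have "\<dots> = 0" using zero by (simp add: fw_append fw_replicate)
  finally show False using w(2) by blast
qed

lemma hw_moduleI:
  assumes "semisimple_lie_data L" "lam \<in> dual_cartan L" "highest_weight_module L lam V v"
  shows "hw_module L V lam v"
proof -
  interpret split_lie L by unfold_locales fact
  interpret R: lie_rep L V
    using assms(3) by unfold_locales (auto simp: highest_weight_module_def lie_alg)
  show ?thesis using assms by unfold_locales
qed

lemma ex_nonconvex_module:
  fixes L :: "('g::ab_group_add, 'i) lie_data"
  assumes L: "semisimple_lie_data L" and lam: "lam \<in> dual_cartan L" and X: "X \<subseteq> J_weight L lam"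
    and ik: "i \<in> X" "k \<in> X" "i \<noteq> k" "simple_root L k (coroot L i) = 0"
  shows "\<exists>(V :: ('g, 'g words) lie_module) v. highest_weight_module L lam V v \<and>
    J_module L lam V v = J_weight L lam - X \<and> \<not> wt_convex L lam V"
proof -
  interpret FV: free_verma L lam X
    using L lam X ik(1) by unfold_locales (auto simp: J_weight_def)
  obtain m n where mn: "lam (coroot L i) = of_nat m" "lam (coroot L k) = of_nat n"
    using X ik(1,2) unfolding J_weight_def Nats_def by blast
  obtain V :: "('g, 'g words) lie_module" and v where V: "highest_weight_module L lam V v"
    "J_module L lam V v = J_weight L lam - X"
    "(act V (x_minus L i) ^^ Suc m) ((act V (x_minus L k) ^^ Suc n) v) = 0"
    using FV.ex_highest_weight_module[OF X] ik mn by blast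
  interpret hw_module L V lam v using L lam V(1) by (rule hw_moduleI)
  have "\<not> wt_convex L lam V"
    by (rule not_wt_convex[OF _ _ ik(3,4) V(3)]) (use V(2) X ik in auto)
  then show ?thesis using V by blast
qed

section \<open>The Lie algebra sl2 x sl2\<close>

text \<open>Each triple holds the coordinates with respect to the standard basis e, h, f of one sl2
  factor.\<close>

fun br6 :: "complex6 \<Rightarrow> complex6 \<Rightarrow> complex6" where
  "br6 ((a, b, c), (p, q, r)) ((a', b', c'), (p', q', r')) =
    ((2 * (b * a' - a * b'), a * c' - c * a', 2 * (c * b' - b * c')),
     (2 * (q * p' - p * q'), p * r' - r * p', 2 * (r * q' - q * r')))"

fun scale6 :: "complex \<Rightarrow> complex6 \<Rightarrow> complex6" where
  "scale6 z ((a, b, c), (p, q, r)) = ((z * a, z * b, z * c), (z * p, z * q, z * r))"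

definition hh :: "complex \<Rightarrow> complex \<Rightarrow> complex6" where "hh s t = ((0, s, 0), (0, t, 0))"

text \<open>Index 0 means the first factor and every other index the second. The value 0 outside the
  Cartan subalgebra is the convention of \<open>dual_cartan\<close>.\<close>

definition root6 :: "nat \<Rightarrow> complex6 \<Rightarrow> complex" where
  "root6 i x = (if x \<in> range (case_prod hh) then 2 * (if i = 0 then fst (snd (fst x)) else fst (snd (snd x))) else 0)"

definition sl2_sl2 :: "(complex6, nat) lie_data" where
  "sl2_sl2 = \<lparr>scaling = scale6, bracket = br6, cartan = range (case_prod hh), nodes = {0, 1},
     simple_root = root6,
     x_plus = (\<lambda>i. if i = 0 then ((1, 0, 0), (0, 0, 0)) else ((0, 0, 0), (1, 0, 0))),
     x_minus = (\<lambda>i. if i = 0 then ((0, 0, 1), (0, 0, 0)) else ((0, 0, 0), (0, 0, 1))),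
     coroot = (\<lambda>i. if i = 0 then hh 1 0 else hh 0 1)\<rparr>"

lemma sl2_sl2_simps [simp]:
  "scaling sl2_sl2 = scale6" "bracket sl2_sl2 = br6" "cartan sl2_sl2 = range (case_prod hh)" "nodes sl2_sl2 = {0, 1}"
  "simple_root sl2_sl2 = root6"
  "x_plus sl2_sl2 0 = ((1, 0, 0), (0, 0, 0))" "x_plus sl2_sl2 (Suc 0) = ((0, 0, 0), (1, 0, 0))"
  "x_minus sl2_sl2 0 = ((0, 0, 1), (0, 0, 0))" "x_minus sl2_sl2 (Suc 0) = ((0, 0, 0), (0, 0, 1))"
  "coroot sl2_sl2 0 = hh 1 0" "coroot sl2_sl2 (Suc 0) = hh 0 1"
  by (simp_all add: sl2_sl2_def)

lemma root6_hh [simp]: "root6 i (hh s t) = 2 * (if i = 0 then s else t)"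
  using rangeI[of "case_prod hh" "(s, t)"] by (simp add: root6_def hh_def)

lemma ball_cartan [simp]: "(\<forall>h\<in>range (case_prod hh). P h) \<longleftrightarrow> (\<forall>s t. P (hh s t))"
  by auto

interpretation S6: vector_space scale6
  by standard (auto simp: algebra_simps)

lemma lie_algebra_sl2_sl2: "lie_algebra sl2_sl2"
proof -
  have lin: "Vector_Spaces.linear scale6 scale6 g \<longleftrightarrow> (\<forall>x y. g (x + y) = g x + g y) \<and> (\<forall>c x. g (scale6 c x) = scale6 c (g x))" for g
    unfolding Vector_Spaces.linear_iff using S6.vector_space_axioms by blast
  show ?thesis
    unfolding lie_algebra_def sl2_sl2_simps lin
    by (intro conjI S6.vector_space_axioms allI) (auto simp: algebra_simps split_paired_all zero_prod_def)
qed

lemma span6: "((a, b, c), (p, q, r)) \<in> S6.span B"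
  if "((1, 0, 0), (0, 0, 0)) \<in> S6.span B" "((0, 1, 0), (0, 0, 0)) \<in> S6.span B" "((0, 0, 1), (0, 0, 0)) \<in> S6.span B"
    "((0, 0, 0), (1, 0, 0)) \<in> S6.span B" "((0, 0, 0), (0, 1, 0)) \<in> S6.span B" "((0, 0, 0), (0, 0, 1)) \<in> S6.span B"
proof -
  have "scale6 a ((1, 0, 0), (0, 0, 0)) + scale6 b ((0, 1, 0), (0, 0, 0)) + scale6 c ((0, 0, 1), (0, 0, 0))
      + scale6 p ((0, 0, 0), (1, 0, 0)) + scale6 q ((0, 0, 0), (0, 1, 0)) + scale6 r ((0, 0, 0), (0, 0, 1)) \<in> S6.span B"
    by (intro S6.span_add S6.span_scale that)
  then show ?thesis by simp
qed

lemma span6_UNIV: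
  assumes "{((1, 0, 0), (0, 0, 0)), ((0, 1, 0), (0, 0, 0)), ((0, 0, 1), (0, 0, 0)),
    ((0, 0, 0), (1, 0, 0)), ((0, 0, 0), (0, 1, 0)), ((0, 0, 0), (0, 0, 1))} \<subseteq> B"
  shows "S6.span B = UNIV"
proof -
  have "x \<in> S6.span B" for x
    using span6[of B] S6.span_base[of _ B] assms by (cases x) auto
  then show ?thesis by blast
qed

lemma finite_dimensional_sl2_sl2: "finite_dimensional sl2_sl2"
  unfolding finite_dimensional_def sl2_sl2_simps using span6_UNIV[OF subset_refl] by (meson finite.intros)

text \<open>An sl2-triple consists of multiples of its own brackets, so it persists in every term of
  the derived series.\<close>

lemma not_solvable_if_triple:
  assumes "x \<in> A" "h \<in> A" "y \<in> A" and nz: "x \<noteq> 0"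
    and br: "br6 h x = scale6 2 x" "br6 x y = h" "br6 h y = scale6 (-2) y"
  shows "\<not> solvable sl2_sl2 A"
proof -
  have "x \<in> ((\<lambda>B. bracket_set sl2_sl2 B B) ^^ n) A \<and> h \<in> ((\<lambda>B. bracket_set sl2_sl2 B B) ^^ n) A
      \<and> y \<in> ((\<lambda>B. bracket_set sl2_sl2 B B) ^^ n) A" for n
  proof (induction n)
    case 0
    then show ?case using assms by simp
  next
    case (Suc n)
    let ?B = "((\<lambda>B. bracket_set sl2_sl2 B B) ^^ n) A"
    have br_in: "br6 a b \<in> bracket_set sl2_sl2 ?B ?B" if "a \<in> ?B" "b \<in> ?B" for a b
    proof -
      have "br6 a b \<in> {br6 a b |a b. a \<in> ?B \<and> b \<in> ?B}" using that by blast
      then show ?thesis unfolding bracket_set_def[of _ ?B ?B] sl2_sl2_simps by (rule S6.span_base)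
    qed
    have sc: "scale6 c a \<in> bracket_set sl2_sl2 ?B ?B" if "a \<in> bracket_set sl2_sl2 ?B ?B" for a c
      using that unfolding bracket_set_def[of _ ?B ?B] sl2_sl2_simps by (rule S6.span_scale)
    have "scale6 (1/2) (br6 h x) = x" "scale6 (-1/2) (br6 h y) = y"
      unfolding br by (simp_all del: scale6.simps)
    then have "x \<in> bracket_set sl2_sl2 ?B ?B" "y \<in> bracket_set sl2_sl2 ?B ?B" "h \<in> bracket_set sl2_sl2 ?B ?B"
      using Suc sc[OF br_in[of h x], of "1/2"] sc[OF br_in[of h y], of "-1/2"] br_in[of x y]
      by (simp_all only: br(2))
    then show ?case by simp
  qed
  then have "((\<lambda>B. bracket_set sl2_sl2 B B) ^^ n) A \<noteq> {0}" for n using nz by blast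
  then show ?thesis unfolding solvable_def by blast
qed

lemma semisimple_sl2_sl2: "semisimple sl2_sl2"
  unfolding semisimple_def
proof (intro allI impI)
  fix A assume A: "lie_ideal sl2_sl2 A \<and> solvable sl2_sl2 A"
  have sub: "S6.subspace A" and br: "\<And>x y. y \<in> A \<Longrightarrow> br6 x y \<in> A"
    using A unfolding lie_ideal_def sl2_sl2_simps by blast+
  have sc: "x \<in> A \<Longrightarrow> scale6 c x \<in> A" for x c using S6.subspace_scale[OF sub] .
  let ?e0 = "((1, 0, 0), (0, 0, 0)) :: complex6" and ?f0 = "((0, 0, 1), (0, 0, 0)) :: complex6"
  let ?e1 = "((0, 0, 0), (1, 0, 0)) :: complex6" and ?f1 = "((0, 0, 0), (0, 0, 1)) :: complex6"
  have e0: "?e0 \<notin> A"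
  proof
    assume e: "?e0 \<in> A"
    have h: "hh 1 0 \<in> A" using sc[OF br[OF e, of ?f0], of "-1"] by (simp add: hh_def)
    have "?f0 \<in> A" using sc[OF br[OF h, of ?f0], of "1/2"] by (simp add: hh_def)
    from not_solvable_if_triple[OF e h this] show False using A by (simp add: hh_def zero_prod_def)
  qed
  have e1: "?e1 \<notin> A"
  proof
    assume e: "?e1 \<in> A"
    have h: "hh 0 1 \<in> A" using sc[OF br[OF e, of ?f1], of "-1"] by (simp add: hh_def)
    have "?f1 \<in> A" using sc[OF br[OF h, of ?f1], of "1/2"] by (simp add: hh_def)
    from not_solvable_if_triple[OF e h this] show False using A by (simp add: hh_def zero_prod_def)
  qed
  have "x = 0" if x: "x \<in> A" for x
  proof -
    obtain a b c p q r where x_eq: "x = ((a, b, c), (p, q, r))" by (metis surj_pair)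
    \<comment> \<open>Twofold bracketing with \<open>?e0\<close> gives - 2c times
      \<open>?e0\<close>, so a nonzero c would put \<open>?e0\<close> into the ideal. After that one
      bracket isolates b, and a bracket with the Cartan element isolates a.\<close>
    have c: "c = 0"
      using e0 sc[OF br[OF br[OF x, of ?e0], of ?e0], of "- 1 / (2 * c)"] by (auto simp: x_eq split: if_splits)
    have b: "b = 0"
      using e0 sc[OF br[OF x, of ?e0], of "- 1 / (2 * b)"] by (auto simp: x_eq c split: if_splits)
    have a: "a = 0"
      using e0 sc[OF br[OF x, of "hh 1 0"], of "1 / (2 * a)"] by (auto simp: x_eq b c hh_def split: if_splits)
    have r: "r = 0"
      using e1 sc[OF br[OF br[OF x, of ?e1], of ?e1], of "- 1 / (2 * r)"] by (auto simp: x_eq split: if_splits)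
    have q: "q = 0"
      using e1 sc[OF br[OF x, of ?e1], of "- 1 / (2 * q)"] by (auto simp: x_eq r split: if_splits)
    have p: "p = 0"
      using e1 sc[OF br[OF x, of "hh 0 1"], of "1 / (2 * p)"] by (auto simp: x_eq q r hh_def split: if_splits)
    show ?thesis by (simp add: x_eq a b c p q r zero_prod_def)
  qed
  then show "A = {0}" using S6.subspace_0[OF sub] by blast
qed

lemma hh_eq: "hh s t + hh s' t' = hh (s + s') (t + t')" "scale6 c (hh s t) = hh (c * s) (c * t)" "hh 0 0 = 0"
  "hh s t = hh s' t' \<longleftrightarrow> s = s' \<and> t = t'"
  by (auto simp: hh_def zero_prod_def)

lemma range_hh: "hh s t \<in> range (case_prod hh)"
  using rangeI[of "case_prod hh" "(s, t)"] by simp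

lemma cartan_subspace6: "S6.subspace (range (case_prod hh))"
proof (rule S6.subspaceI)
  show "0 \<in> range (case_prod hh)" using range_hh[of 0 0] by (simp add: hh_eq)
qed (auto simp: hh_eq range_hh)

lemma cartan_subalgebra_sl2_sl2: "cartan_subalgebra sl2_sl2 (cartan sl2_sl2)"
  unfolding cartan_subalgebra_def
proof (intro conjI allI impI)
  show "toral sl2_sl2 (cartan sl2_sl2)"
    unfolding toral_def sl2_sl2_simps ball_cartan
  proof (intro conjI allI cartan_subspace6)
    show "br6 (hh s t) (hh s' t') = 0" for s t s' t' by (simp add: hh_def zero_prod_def)
    fix s t
    have "\<exists>z. br6 (hh s t) ((1, 0, 0), (0, 0, 0)) = scale6 z ((1, 0, 0), (0, 0, 0))"
      "\<exists>z. br6 (hh s t) ((0, 1, 0), (0, 0, 0)) = scale6 z ((0, 1, 0), (0, 0, 0))"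
      "\<exists>z. br6 (hh s t) ((0, 0, 1), (0, 0, 0)) = scale6 z ((0, 0, 1), (0, 0, 0))"
      "\<exists>z. br6 (hh s t) ((0, 0, 0), (1, 0, 0)) = scale6 z ((0, 0, 0), (1, 0, 0))"
      "\<exists>z. br6 (hh s t) ((0, 0, 0), (0, 1, 0)) = scale6 z ((0, 0, 0), (0, 1, 0))"
      "\<exists>z. br6 (hh s t) ((0, 0, 0), (0, 0, 1)) = scale6 z ((0, 0, 0), (0, 0, 1))"
      by (auto simp: hh_def)
    then show "ad_diagonalizable sl2_sl2 (hh s t)"
      unfolding ad_diagonalizable_def sl2_sl2_simps by (intro span6_UNIV) blast
  qed
  fix K' assume K': "toral sl2_sl2 K' \<and> cartan sl2_sl2 \<subseteq> K'"
  have "x \<in> range (case_prod hh)" if x: "x \<in> K'" for x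
  proof -
    have "hh 1 0 \<in> K'" "hh 0 1 \<in> K'" using K' range_hh by auto
    then have c: "br6 (hh 1 0) x = 0" "br6 (hh 0 1) x = 0" using K' x by (auto simp: toral_def)
    obtain a b c p q r where x_eq: "x = ((a, b, c), (p, q, r))" by (metis surj_pair)
    \<comment> \<open>Commuting with the Cartan element of each factor kills the e- and
      f-coordinates.\<close>
    have "x = hh b q" using c by (simp add: x_eq hh_def zero_prod_def)
    then show ?thesis by (simp add: range_hh)
  qed
  then show "K' = cartan sl2_sl2" using K' by auto
qed

lemma root6_dual: "root6 i \<in> dual_cartan sl2_sl2"
  unfolding dual_cartan_def sl2_sl2_simps
  by (auto simp: hh_eq) (auto simp: root6_def)

lemma dual6_eqI:
  assumes "\<mu> \<in> dual_cartan sl2_sl2" "\<nu> \<in> dual_cartan sl2_sl2" "\<And>s t. \<mu> (hh s t) = \<nu> (hh s t)"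
  shows "\<mu> = \<nu>"
proof
  fix x show "\<mu> x = \<nu> x"
  proof (cases "x \<in> range (case_prod hh)")
    case True
    then show ?thesis using assms(3) by auto
  next
    case False
    then have "x \<notin> cartan sl2_sl2" by simp
    then have "\<mu> x = 0" "\<nu> x = 0" using assms(1,2) unfolding dual_cartan_def by blast+
    then show ?thesis by simp
  qed
qed

lemma root6_uminus_dual: "- root6 i \<in> dual_cartan sl2_sl2"
  using root6_dual[of i] by (auto simp: dual_cartan_def)

lemma br6_hh: "br6 (hh s t) ((a, b, c), (p, q, r)) = ((2 * s * a, 0, - 2 * s * c), (2 * t * p, 0, - 2 * t * r))"
  by (simp add: hh_def)

lemma root_space6_iff: "((a, b, c), (p, q, r)) \<in> root_space sl2_sl2 \<mu> \<longleftrightarrow>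
  (\<forall>s t. 2 * s * a = \<mu> (hh s t) * a \<and> 0 = \<mu> (hh s t) * b \<and> - 2 * s * c = \<mu> (hh s t) * c \<and>
     2 * t * p = \<mu> (hh s t) * p \<and> 0 = \<mu> (hh s t) * q \<and> - 2 * t * r = \<mu> (hh s t) * r)"
  unfolding root_space_def sl2_sl2_simps ball_cartan mem_Collect_eq br6_hh scale6.simps prod.inject
  by (simp only: conj_assoc)

lemma root_space6:
  "x \<in> root_space sl2_sl2 (root6 0) \<longleftrightarrow> (\<exists>a. x = ((a, 0, 0), (0, 0, 0)))"
  "x \<in> root_space sl2_sl2 (root6 (Suc 0)) \<longleftrightarrow> (\<exists>a. x = ((0, 0, 0), (a, 0, 0)))"
  "x \<in> root_space sl2_sl2 (- root6 0) \<longleftrightarrow> (\<exists>a. x = ((0, 0, a), (0, 0, 0)))"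
  "x \<in> root_space sl2_sl2 (- root6 (Suc 0)) \<longleftrightarrow> (\<exists>a. x = ((0, 0, 0), (0, 0, a)))"
proof -
  obtain a b c p q r where x: "x = ((a, b, c), (p, q, r))" by (metis surj_pair)
  let ?P = "\<lambda>\<mu> s t. 2 * s * a = \<mu> (hh s t) * a \<and> 0 = \<mu> (hh s t) * b \<and> - 2 * s * c = \<mu> (hh s t) * c \<and>
     2 * t * p = \<mu> (hh s t) * p \<and> 0 = \<mu> (hh s t) * q \<and> - 2 * t * r = \<mu> (hh s t) * r"
  show "x \<in> root_space sl2_sl2 (root6 0) \<longleftrightarrow> (\<exists>a. x = ((a, 0, 0), (0, 0, 0)))"
  proof
    assume "x \<in> root_space sl2_sl2 (root6 0)"
    then have *: "\<And>s t. ?P (root6 0) s t" unfolding x root_space6_iff by blast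
    show "\<exists>a. x = ((a, 0, 0), (0, 0, 0))" using *[of 1 0] *[of 0 1] by (simp add: x)
  qed (auto simp: root_space6_iff)
  show "x \<in> root_space sl2_sl2 (root6 (Suc 0)) \<longleftrightarrow> (\<exists>a. x = ((0, 0, 0), (a, 0, 0)))"
  proof
    assume "x \<in> root_space sl2_sl2 (root6 (Suc 0))"
    then have *: "\<And>s t. ?P (root6 (Suc 0)) s t" unfolding x root_space6_iff by blast
    show "\<exists>a. x = ((0, 0, 0), (a, 0, 0))" using *[of 1 0] *[of 0 1] by (simp add: x)
  qed (auto simp: root_space6_iff)
  show "x \<in> root_space sl2_sl2 (- root6 0) \<longleftrightarrow> (\<exists>a. x = ((0, 0, a), (0, 0, 0)))"
  proof
    assume "x \<in> root_space sl2_sl2 (- root6 0)"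
    then have *: "\<And>s t. ?P (- root6 0) s t" unfolding x root_space6_iff by blast
    show "\<exists>a. x = ((0, 0, a), (0, 0, 0))" using *[of 1 0] *[of 0 1] by (simp add: x)
  qed (auto simp: root_space6_iff)
  show "x \<in> root_space sl2_sl2 (- root6 (Suc 0)) \<longleftrightarrow> (\<exists>a. x = ((0, 0, 0), (0, 0, a)))"
  proof
    assume "x \<in> root_space sl2_sl2 (- root6 (Suc 0))"
    then have *: "\<And>s t. ?P (- root6 (Suc 0)) s t" unfolding x root_space6_iff by blast
    show "\<exists>a. x = ((0, 0, 0), (0, 0, a))" using *[of 1 0] *[of 0 1] by (simp add: x)
  qed (auto simp: root_space6_iff)
qed

lemma root6_neq: "root6 0 \<noteq> root6 (Suc 0)"
proof
  assume "root6 0 = root6 (Suc 0)"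
  from fun_cong[OF this, of "hh 1 0"] show False by simp
qed

text \<open>A nonzero root rules out Cartan coordinates in its root vectors, and any other nonzero
  coordinate determines the root by its eigenvalues.\<close>

lemma roots6: "roots sl2_sl2 = {root6 0, root6 (Suc 0), - root6 0, - root6 (Suc 0)}"
proof (intro equalityI subsetI)
  fix \<beta> assume "\<beta> \<in> roots sl2_sl2"
  then have \<beta>: "\<beta> \<in> dual_cartan sl2_sl2" "\<beta> \<noteq> 0" "root_space sl2_sl2 \<beta> \<noteq> {0}" by (auto simp: roots_def)
  have "0 \<in> root_space sl2_sl2 \<beta>" by (simp add: zero_prod_def root_space6_iff)
  then obtain x where x: "x \<in> root_space sl2_sl2 \<beta>" "x \<noteq> 0" using \<beta>(3) by blast
  obtain a b c p q r where x_eq: "x = ((a, b, c), (p, q, r))" by (metis surj_pair)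
  have zero: "0 \<in> dual_cartan sl2_sl2" by (auto simp: dual_cartan_def)
  obtain s t where st: "\<beta> (hh s t) \<noteq> 0"
    using dual6_eqI[OF \<beta>(1) zero] \<beta>(2) by (metis zero_fun_apply)
  note iff = x(1)[unfolded x_eq root_space6_iff]
  have bq: "b = 0" "q = 0" using iff st by (auto dest: spec)
  consider "a \<noteq> 0" | "c \<noteq> 0" | "p \<noteq> 0" | "r \<noteq> 0" using x(2) bq by (auto simp: x_eq zero_prod_def)
  then show "\<beta> \<in> {root6 0, root6 (Suc 0), - root6 0, - root6 (Suc 0)}"
  proof cases
    case 1
    then have "\<beta> = root6 0" using iff by (intro dual6_eqI[OF \<beta>(1) root6_dual]) auto
    then show ?thesis by simp
  next
    case 2
    then have "\<beta> (hh s t) = - 2 * s" for s t using iff by (metis mult_cancel_right)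
    then have "\<beta> = - root6 0" by (intro dual6_eqI[OF \<beta>(1) root6_uminus_dual]) simp
    then show ?thesis by simp
  next
    case 3
    then have "\<beta> = root6 (Suc 0)" using iff by (intro dual6_eqI[OF \<beta>(1) root6_dual]) auto
    then show ?thesis by simp
  next
    case 4
    then have "\<beta> (hh s t) = - 2 * t" for s t using iff by (metis mult_cancel_right)
    then have "\<beta> = - root6 (Suc 0)" by (intro dual6_eqI[OF \<beta>(1) root6_uminus_dual]) simp
    then show ?thesis by simp
  qed
next
  fix \<beta> assume \<beta>: "\<beta> \<in> {root6 0, root6 (Suc 0), - root6 0, - root6 (Suc 0)}"
  have "\<beta> (hh 1 1) \<noteq> 0" using \<beta> by auto
  then have "\<beta> \<noteq> 0" by auto
  moreover have "root_space sl2_sl2 \<beta> \<noteq> {0}"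
  proof
    assume "root_space sl2_sl2 \<beta> = {0}"
    moreover have "((1, 0, 0), (0, 0, 0)) \<in> root_space sl2_sl2 (root6 0)" "((0, 0, 0), (1, 0, 0)) \<in> root_space sl2_sl2 (root6 (Suc 0))"
      "((0, 0, 1), (0, 0, 0)) \<in> root_space sl2_sl2 (- root6 0)" "((0, 0, 0), (0, 0, 1)) \<in> root_space sl2_sl2 (- root6 (Suc 0))"
      unfolding root_space6 by blast+
    ultimately show False using \<beta> by (auto simp: zero_prod_def)
  qed
  ultimately show "\<beta> \<in> roots sl2_sl2"
    using \<beta> root6_dual root6_uminus_dual by (auto simp: roots_def)
qed

lemma root_cone6: "root_cone sl2_sl2 = {\<lambda>x. of_nat k * root6 0 x + of_nat l * root6 (Suc 0) x | k l. True}"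
proof -
  have eq: "(\<Sum>i\<in>{0, 1}. fun_scale (of_nat (k i)) (root6 i)) = (\<lambda>x. of_nat (k 0) * root6 0 x + of_nat (k 1) * root6 (Suc 0) x)" for k :: "nat \<Rightarrow> nat"
    by (simp add: fun_eq_iff fun_scale_def)
  show ?thesis
  proof (intro equalityI subsetI)
    fix \<beta> assume "\<beta> \<in> root_cone sl2_sl2"
    then show "\<beta> \<in> {\<lambda>x. of_nat k * root6 0 x + of_nat l * root6 (Suc 0) x | k l. True}"
      unfolding root_cone_def sl2_sl2_simps eq by blast
  next
    fix \<beta> assume "\<beta> \<in> {\<lambda>x. of_nat k * root6 0 x + of_nat l * root6 (Suc 0) x | k l. True}"
    then obtain k l where "\<beta> = (\<lambda>x. of_nat k * root6 0 x + of_nat l * root6 (Suc 0) x)" by blast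
    then show "\<beta> \<in> root_cone sl2_sl2"
      unfolding root_cone_def sl2_sl2_simps eq
      by (intro CollectI exI[of _ "\<lambda>i. if i = 0 then k else l"]) simp
  qed
qed

lemma root6_in_cone: "root6 0 \<in> root_cone sl2_sl2" "root6 (Suc 0) \<in> root_cone sl2_sl2"
    "- root6 0 \<notin> root_cone sl2_sl2" "- root6 (Suc 0) \<notin> root_cone sl2_sl2"
proof -
  show "root6 0 \<in> root_cone sl2_sl2"
    unfolding root_cone6 by (intro CollectI exI[of _ 1] exI[of _ 0]) simp
  show "root6 (Suc 0) \<in> root_cone sl2_sl2"
    unfolding root_cone6 by (intro CollectI exI[of _ 0] exI[of _ 1]) simp
  \<comment> \<open>Evaluated at the coroot, membership of a negative simple root in the cone would
    read - 2 = 2k with k natural.\<close>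
  have neg: "(- 2 :: complex) \<noteq> of_nat k * 2" for k
  proof
    assume "(- 2 :: complex) = of_nat k * 2"
    then have "(of_int (- 2) :: complex) = of_int (int k * 2)" by simp
    then have "- 2 = int k * 2" by (simp only: of_int_eq_iff)
    then show False by linarith
  qed
  show "- root6 0 \<notin> root_cone sl2_sl2"
  proof
    assume "- root6 0 \<in> root_cone sl2_sl2"
    then obtain k l where "- root6 0 = (\<lambda>x. of_nat k * root6 0 x + of_nat l * root6 (Suc 0) x)" unfolding root_cone6 by blast
    from fun_cong[OF this, of "hh 1 0"] show False using neg[of k] by simp
  qed
  show "- root6 (Suc 0) \<notin> root_cone sl2_sl2"
  proof
    assume "- root6 (Suc 0) \<in> root_cone sl2_sl2"
    then obtain k l where "- root6 (Suc 0) = (\<lambda>x. of_nat k * root6 0 x + of_nat l * root6 (Suc 0) x)" unfolding root_cone6 by blast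
    from fun_cong[OF this, of "hh 0 1"] show False using neg[of l] by simp
  qed
qed

lemma simple_system_sl2_sl2: "simple_system sl2_sl2"
proof -
  interpret F: vector_space "fun_scale :: complex \<Rightarrow> (complex6 \<Rightarrow> complex) \<Rightarrow> _" by (rule vector_space_fun_scale)
  have "\<not> F.dependent {root6 0, root6 (Suc 0)}"
  proof
    assume "F.dependent {root6 0, root6 (Suc 0)}"
    then have "\<exists>u. (\<exists>v\<in>{root6 0, root6 (Suc 0)}. u v \<noteq> 0) \<and> (\<Sum>v\<in>{root6 0, root6 (Suc 0)}. fun_scale (u v) v) = 0"
      by (subst (asm) F.dependent_finite) simp_all
    then obtain u where u: "u (root6 0) \<noteq> 0 \<or> u (root6 (Suc 0)) \<noteq> 0"
      "fun_scale (u (root6 0)) (root6 0) + fun_scale (u (root6 (Suc 0))) (root6 (Suc 0)) = 0"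
      using root6_neq by auto
    show False
      using u(1) fun_cong[OF u(2), of "hh 1 0"] fun_cong[OF u(2), of "hh 0 1"] by (simp add: fun_scale_def)
  qed
  then show ?thesis
    unfolding simple_system_def sl2_sl2_simps roots6 using root6_neq root6_in_cone by auto
qed

lemma n_plus6: "n_plus sl2_sl2 = {((a, 0, 0), (p, 0, 0)) | a p. True}" (is "_ = ?N")
proof -
  have "{\<beta> \<in> roots sl2_sl2. \<beta> \<in> root_cone sl2_sl2} = {root6 0, root6 (Suc 0)}"
    unfolding roots6 using root6_in_cone by blast
  then have n: "n_plus sl2_sl2 = S6.span (root_space sl2_sl2 (root6 0) \<union> root_space sl2_sl2 (root6 (Suc 0)))"
    by (simp add: n_plus_def)
  have "S6.subspace ?N" by (rule S6.subspaceI) (auto simp: zero_prod_def)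
  then have "n_plus sl2_sl2 \<subseteq> ?N" unfolding n by (rule S6.span_minimal[rotated]) (auto simp: root_space6)
  moreover have "((a, 0, 0), (p, 0, 0)) \<in> n_plus sl2_sl2" for a p
  proof -
    have "((a, 0, 0), (0, 0, 0)) + ((0, 0, 0), (p, 0, 0)) \<in> n_plus sl2_sl2"
      unfolding n by (intro S6.span_add S6.span_base) (auto simp: root_space6)
    then show ?thesis by simp
  qed
  ultimately show ?thesis by blast
qed

lemma n_minus6: "n_minus sl2_sl2 = {((0, 0, a), (0, 0, p)) | a p. True}" (is "_ = ?N")
proof -
  have "{\<beta> \<in> roots sl2_sl2. - \<beta> \<in> root_cone sl2_sl2} = {- root6 0, - root6 (Suc 0)}"
    unfolding roots6 using root6_in_cone by auto
  then have n: "n_minus sl2_sl2 = S6.span (root_space sl2_sl2 (- root6 0) \<union> root_space sl2_sl2 (- root6 (Suc 0)))"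
    by (simp add: n_minus_def)
  have "S6.subspace ?N" by (rule S6.subspaceI) (auto simp: zero_prod_def)
  then have "n_minus sl2_sl2 \<subseteq> ?N" unfolding n by (rule S6.span_minimal[rotated]) (auto simp: root_space6)
  moreover have "((0, 0, a), (0, 0, p)) \<in> n_minus sl2_sl2" for a p
  proof -
    have "((0, 0, a), (0, 0, 0)) + ((0, 0, 0), (0, 0, p)) \<in> n_minus sl2_sl2"
      unfolding n by (intro S6.span_add S6.span_base) (auto simp: root_space6)
    then show ?thesis by simp
  qed
  ultimately show ?thesis by blast
qed

lemma triangular_decomposition_sl2_sl2: "triangular_decomposition sl2_sl2"
  unfolding triangular_decomposition_def n_plus6 n_minus6 sl2_sl2_simps
proof (intro conjI allI ballI impI)
  fix x :: complex6
  obtain a b c p q r where "x = ((a, b, c), (p, q, r))" by (metis surj_pair)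
  then have "x = ((a, 0, 0), (p, 0, 0)) + hh b q + ((0, 0, c), (0, 0, r))" by (simp add: hh_def)
  then show "\<exists>a\<in>{((a, 0, 0), (p, 0, 0)) |a p. True}. \<exists>h\<in>range (case_prod hh). \<exists>b\<in>{((0, 0, a), (0, 0, p)) |a p. True}. x = a + h + b"
    using range_hh by blast
qed (auto simp: hh_def zero_prod_def)

lemma chevalley_generators_sl2_sl2: "chevalley_generators sl2_sl2"
proof -
  have gen_p: "lie_subalgebra sl2_sl2 hull {((1, 0, 0), (0, 0, 0)), ((0, 0, 0), (1, 0, 0))} = n_plus sl2_sl2"
  proof (rule hull_unique)
    show "lie_subalgebra sl2_sl2 (n_plus sl2_sl2)"
      unfolding lie_subalgebra_def n_plus6 sl2_sl2_simps
      by (intro conjI S6.subspaceI) (auto simp: zero_prod_def)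
    fix t assume t: "{((1, 0, 0), (0, 0, 0)), ((0, 0, 0), (1, 0, 0))} \<subseteq> t" "lie_subalgebra sl2_sl2 t"
    then have "scale6 a ((1, 0, 0), (0, 0, 0)) + scale6 p ((0, 0, 0), (1, 0, 0)) \<in> t" for a p
      unfolding lie_subalgebra_def by (intro S6.subspace_add S6.subspace_scale) auto
    then show "n_plus sl2_sl2 \<subseteq> t" by (auto simp: n_plus6)
  qed (auto simp: n_plus6)
  have gen_m: "lie_subalgebra sl2_sl2 hull {((0, 0, 1), (0, 0, 0)), ((0, 0, 0), (0, 0, 1))} = n_minus sl2_sl2"
  proof (rule hull_unique)
    show "lie_subalgebra sl2_sl2 (n_minus sl2_sl2)"
      unfolding lie_subalgebra_def n_minus6 sl2_sl2_simps
      by (intro conjI S6.subspaceI) (auto simp: zero_prod_def)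
    fix t assume t: "{((0, 0, 1), (0, 0, 0)), ((0, 0, 0), (0, 0, 1))} \<subseteq> t" "lie_subalgebra sl2_sl2 t"
    then have "scale6 a ((0, 0, 1), (0, 0, 0)) + scale6 p ((0, 0, 0), (0, 0, 1)) \<in> t" for a p
      unfolding lie_subalgebra_def by (intro S6.subspace_add S6.subspace_scale) auto
    then show "n_minus sl2_sl2 \<subseteq> t" by (auto simp: n_minus6)
  qed (auto simp: n_minus6)
  show ?thesis
    unfolding chevalley_generators_def
  proof (intro conjI)
    show "lie_subalgebra sl2_sl2 hull x_plus sl2_sl2 ` nodes sl2_sl2 = n_plus sl2_sl2"
      "lie_subalgebra sl2_sl2 hull x_minus sl2_sl2 ` nodes sl2_sl2 = n_minus sl2_sl2"
      using gen_p gen_m by simp_all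
  qed (auto simp: root_space6 range_hh hh_def[symmetric] zero_prod_def; simp add: hh_def)+
qed

lemma semisimple_lie_data_sl2_sl2: "semisimple_lie_data sl2_sl2"
  unfolding semisimple_lie_data_def
  by (intro conjI lie_algebra_sl2_sl2 finite_dimensional_sl2_sl2 semisimple_sl2_sl2 cartan_subalgebra_sl2_sl2
      simple_system_sl2_sl2 triangular_decomposition_sl2_sl2 chevalley_generators_sl2_sl2)

text \<open>Part (i) is proved for modules on any carrier; the modules asserted to exist live on the
  free algebra over the Lie algebra, where \<open>ex_quotient_module\<close> builds them.\<close>

theorem theorem5p2:
  shows
    "(\<forall>(L :: ('g::ab_group_add, 'i) lie_data) lam J'.
        semisimple_lie_data L \<and> lam \<in> dual_cartan L \<and> J' \<subseteq> J_weight L lam \<and>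
        card (J_weight L lam - J') \<le> 1 \<longrightarrow>
        (\<forall>(V :: ('g, 'v::ab_group_add) lie_module) v.
           highest_weight_module L lam V v \<longrightarrow>
           (J_module L lam V v = J' \<longrightarrow> wt_convex L lam V)))
     \<and>
     (\<exists>(L :: (complex6, nat) lie_data) lam J'.
        semisimple_lie_data L \<and> lam \<in> dual_cartan L \<and> J' \<subseteq> J_weight L lam \<and>
        card (J_weight L lam - J') = 2 \<and>
        (\<exists>(V :: (complex6, complex6 words) lie_module) v.
           highest_weight_module L lam V v \<and>
           \<not> (J_module L lam V v = J' \<longrightarrow> wt_convex L lam V)))
     \<and>
     (\<forall>(L :: ('g, 'i) lie_data) lam J'.
        semisimple_lie_data L \<and> lam \<in> dual_cartan L \<and> J' \<subseteq> J_weight L lam \<and>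
        card (J_weight L lam - J') \<ge> 3 \<longrightarrow>
        (\<exists>(V :: ('g, 'g words) lie_module) v.
           highest_weight_module L lam V v \<and>
           J_module L lam V v = J' \<and> \<not> wt_convex L lam V))"
proof (intro conjI allI impI; (elim conjE)?)
  fix L :: "('g, 'i) lie_data" and lam J' and V :: "('g, 'v) lie_module" and v
  assume L: "semisimple_lie_data L" "lam \<in> dual_cartan L" "card (J_weight L lam - J') \<le> 1"
    and V: "highest_weight_module L lam V v" "J_module L lam V v = J'"
  interpret hw_module L V lam v using L(1,2) V(1) by (rule hw_moduleI)
  show "wt_convex L lam V" using wt_convex_if_card_le_1 L(3) V(2) by simp
next
  \<comment> \<open>At weight 0 on sl2 x sl2 both nodes lie in \<open>J_weight\<close> and are
    orthogonal; taking J' empty leaves exactly these two missing.\<close>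
  have J: "J_weight sl2_sl2 0 = {0, 1}" by (auto simp: J_weight_def)
  have zero: "0 \<in> dual_cartan sl2_sl2" by (auto simp: dual_cartan_def)
  have "simple_root sl2_sl2 1 (coroot sl2_sl2 0) = 0" by simp
  then obtain V :: "(complex6, complex6 words) lie_module" and v where
    "highest_weight_module sl2_sl2 0 V v" "J_module sl2_sl2 0 V v = J_weight sl2_sl2 0 - {0, 1}" "\<not> wt_convex sl2_sl2 0 V"
    using ex_nonconvex_module[OF semisimple_lie_data_sl2_sl2 zero, of "{0, 1}" 0 1] J by auto
  moreover have "card (J_weight sl2_sl2 0 - {}) = 2" unfolding J by simp
  ultimately show "\<exists>(L :: (complex6, nat) lie_data) lam J'.
        semisimple_lie_data L \<and> lam \<in> dual_cartan L \<and> J' \<subseteq> J_weight L lam \<and>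
        card (J_weight L lam - J') = 2 \<and>
        (\<exists>(V :: (complex6, complex6 words) lie_module) v.
           highest_weight_module L lam V v \<and>
           \<not> (J_module L lam V v = J' \<longrightarrow> wt_convex L lam V))"
    using semisimple_lie_data_sl2_sl2 zero
    by (intro exI[of _ sl2_sl2] exI[of _ "0 :: complex6 \<Rightarrow> complex"] exI[of _ "{} :: nat set"] exI[of _ V] exI[of _ v] conjI)
      (assumption | rule empty_subsetI | simp add: J)+
next
  fix L :: "('g, 'i) lie_data" and lam J'
  assume L: "semisimple_lie_data L" "lam \<in> dual_cartan L" and J': "J' \<subseteq> J_weight L lam"
    and card: "3 \<le> card (J_weight L lam - J')"
  interpret split_lie L by unfold_locales (rule L(1))
  \<comment> \<open>Three missing nodes already contain an orthogonal pair, while all of the missing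
    nodes together form the set \<open>X\<close> of the construction.\<close>
  obtain T where T: "T \<subseteq> J_weight L lam - J'" "card T = 3" by (rule obtain_subset_with_card_n[OF card])
  then obtain i j k where ijk: "T = {i, j, k}" "i \<noteq> j" "j \<noteq> k" "i \<noteq> k" unfolding card_3_iff by blast
  have "{i, j, k} \<subseteq> I" using T(1) unfolding ijk(1) J_weight_def by blast
  from ex_unlinked_pair[OF this ijk(2-4)]
  obtain p q where pq: "p \<in> {i, j, k}" "q \<in> {i, j, k}" "p \<noteq> q" "cm p q = 0" by blast
  have "p \<in> J_weight L lam - J'" "q \<in> J_weight L lam - J'" using pq T(1) ijk(1) by blast+
  moreover have "\<alpha> q (co p) = 0" using cm[of p q] pq \<open>{i, j, k} \<subseteq> I\<close> by auto
  moreover have "J_weight L lam - (J_weight L lam - J') = J'" using J' by blast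
  ultimately show "\<exists>(V :: ('g, 'g words) lie_module) v.
           highest_weight_module L lam V v \<and>
           J_module L lam V v = J' \<and> \<not> wt_convex L lam V"
    using ex_nonconvex_module[OF L, of "J_weight L lam - J'" p q] pq(3) by auto
qed

end
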